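(* Let $H$ be a nonzero complex Hilbert space, let $\mathcal C=S_1(H)_+$ be the cone of positive trace-class operators on $H$, and let $\varepsilon,\delta\ge0$. Let $T:\mathcal C\to\mathcal C$ be a map with $T(0)=0$ such that $$\bigl|\|T(A)-T(B)\|_1-\|A-B\|_1\bigr|\le\varepsilon\qquad\text{for all }A,B\in\mathcal C,$$ and such that $T$ is $\delta$-surjective for the trace metric, i.e. for every $B\in\mathcal C$ there is $A\in\mathcal C$ with $\|T(A)-B\|_1\le\delta$. Then there is a unitary or antiunitary $U$ on $H$ such that $$\|T(A)-UAU^*\|_1\le3\varepsilon\qquad\text{for all }A\in\mathcal C.$$
   Context: $H$ may have any dimension and need not be separable. $S_1(H)$ denotes the trace-class operators on $H$, $\mathcal C=S_1(H)_+$ its positive cone, and $\|X\|_1=\operatorname{Tr}|X|$ the trace norm. A unitary is a linear surjection $U:H\to H$ with $\langle Ux,Uy\rangle=\langle x,y\rangle$. An antiunitary is a conjugate-linear surjection $U:H\to H$ with $\langle Ux,Uy\rangle=\overline{\langle x,y\rangle}$. In both cases $U^*=U^{-1}$, and $UAU^*$ is a linear operator on $H$. *)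

theory Defs
  imports "HOL-Analysis.Analysis"
begin

(* Complex Hilbert spaces are built on top of the real inner product spaces of HOL-Analysis: the
   real inner product is the real part of the complex one. Norm, metric and topology are then the
   inherited ones; in particular norm x = sqrt (Re <x,x>), with <x,x> real by cinner_commute, and
   <x,y> is definite because inner is. The form is linear in its second argument. *)
class complex_inner = real_inner +
  fixes scaleC :: "complex \<Rightarrow> 'a \<Rightarrow> 'a"  (infixr "*\<^sub>C" 75)
    and cinner :: "'a \<Rightarrow> 'a \<Rightarrow> complex"
  assumes scaleC_add_right: "c *\<^sub>C (x + y) = c *\<^sub>C x + c *\<^sub>C y"
    and scaleC_add_left: "(c + d) *\<^sub>C x = c *\<^sub>C x + d *\<^sub>C x"
    and scaleC_scaleC: "c *\<^sub>C d *\<^sub>C x = (c * d) *\<^sub>C x"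
    and scaleR_scaleC: "r *\<^sub>R x = complex_of_real r *\<^sub>C x"
    and cinner_commute: "cinner x y = cnj (cinner y x)"
    and cinner_add_right: "cinner x (y + z) = cinner x y + cinner x z"
    and cinner_scaleC_right: "cinner x (c *\<^sub>C y) = c * cinner x y"
    and inner_eq_Re_cinner: "inner x y = Re (cinner x y)"

class chilbert_space = complex_inner + complete_space

definition bounded_clinear :: "('a::complex_inner \<Rightarrow> 'a) \<Rightarrow> bool" where
  "bounded_clinear A \<longleftrightarrow>
     (\<forall>x y. A (x + y) = A x + A y) \<and> (\<forall>c x. A (c *\<^sub>C x) = c *\<^sub>C A x) \<and>
     (\<exists>K. \<forall>x. norm (A x) \<le> K * norm x)"

definition positive_op :: "('a::complex_inner \<Rightarrow> 'a) \<Rightarrow> bool" where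
  "positive_op A \<longleftrightarrow> bounded_clinear A \<and> (\<forall>x. cinner x (A x) \<in> \<real>\<^sub>\<ge>\<^sub>0)"

(* The next two descriptions are meaningful for bounded complex-linear operators on a Hilbert
   space: the adjoint, and |A| as the positive square root of A* A. *)
definition adj_op :: "('a::chilbert_space \<Rightarrow> 'a) \<Rightarrow> 'a \<Rightarrow> 'a" where
  "adj_op A = (THE B. \<forall>x y. cinner (B x) y = cinner x (A y))"

definition abs_op :: "('a::chilbert_space \<Rightarrow> 'a) \<Rightarrow> 'a \<Rightarrow> 'a" where
  "abs_op A = (THE P. positive_op P \<and> P \<circ> P = adj_op A \<circ> A)"

definition is_onb :: "'a::chilbert_space set \<Rightarrow> bool" where
  "is_onb E \<longleftrightarrow>
     (\<forall>e\<in>E. norm e = 1) \<and> (\<forall>e\<in>E. \<forall>f\<in>E. e \<noteq> f \<longrightarrow> cinner e f = 0) \<and>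
     closure (module.span scaleC E) = UNIV"

(* Both notions below do not depend on the orthonormal basis, which may be uncountable: the sums
   are unconditional sums over the set of basis vectors. The trace is meant for trace-class A. *)
definition trace_class :: "('a::chilbert_space \<Rightarrow> 'a) \<Rightarrow> bool" where
  "trace_class A \<longleftrightarrow>
     bounded_clinear A \<and> (\<exists>E. is_onb E \<and> (\<lambda>e. cinner e (abs_op A e)) summable_on E)"

definition op_trace :: "('a::chilbert_space \<Rightarrow> 'a) \<Rightarrow> complex" where
  "op_trace A = (\<Sum>\<^sub>\<infinity>e\<in>(SOME E. is_onb E). cinner e (A e))"

definition trace_norm :: "('a::chilbert_space \<Rightarrow> 'a) \<Rightarrow> real" where
  "trace_norm A = Re (op_trace (abs_op A))"

definition trace_class_cone :: "('a::chilbert_space \<Rightarrow> 'a) set" where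
  "trace_class_cone = {A. trace_class A \<and> positive_op A}"

definition unitary :: "('a::complex_inner \<Rightarrow> 'a) \<Rightarrow> bool" where
  "unitary U \<longleftrightarrow>
     (\<forall>x y. U (x + y) = U x + U y) \<and> (\<forall>c x. U (c *\<^sub>C x) = c *\<^sub>C U x) \<and>
     surj U \<and> (\<forall>x y. cinner (U x) (U y) = cinner x y)"

definition antiunitary :: "('a::complex_inner \<Rightarrow> 'a) \<Rightarrow> bool" where
  "antiunitary U \<longleftrightarrow>
     (\<forall>x y. U (x + y) = U x + U y) \<and> (\<forall>c x. U (c *\<^sub>C x) = cnj c *\<^sub>C U x) \<and>
     surj U \<and> (\<forall>x y. cinner (U x) (U y) = cnj (cinner x y))"

end

theory Submission
  imports Defs
begin

text \<open>For positive trace-class operators the trace norm is the trace, and for a difference \<open>X = A - B\<close> it is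
  \<open>\<parallel>X\<parallel>\<^sub>1 = 2 Tr X\<^sub>+ - Tr X\<close>, where \<open>Tr X\<^sub>+\<close> is the supremum of \<open>\<Sum>\<^sub>s \<langle>s, Xs\<rangle>\<close> over finite orthonormal
  sets (\<open>tdist_le_iff\<close>). So the trace metric knows the traces, the order, and more precisely how much of
  \<open>A\<close> exceeds \<open>B\<close>. Two consequences carry the proof.

  First, for a finite-rank projection \<open>P\<close> the distance from \<open>B\<close> to the ray through \<open>P\<close> satisfies
  \<open>\<parallel>rP - B\<parallel>\<^sub>1 - \<parallel>rP\<parallel>\<^sub>1 \<rightarrow> Tr B - 2 Tr PB\<close> from above. If the images of \<open>rP\<close> are asymptotic to the ray through a
  projection \<open>P'\<close> of the same rank, with a relative error tending to \<open>0\<close>, then comparing \<open>A\<close> with far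
  points of the ray, and \<open>T A\<close> with their images, gives
  \<open>2 Tr P'(T A) - 2 Tr PA \<le> Tr (T A) - Tr A + 2\<epsilon>\<close> (\<open>trace_comparison\<close>). If \<open>P' = UPU\<^sup>*\<close> for all \<open>P\<close>,
  the supremum over \<open>P\<close> of this inequality is \<open>\<parallel>T A - UAU\<^sup>*\<parallel>\<^sub>1 \<le> 2\<epsilon>\<close> (\<open>near_conjugation\<close>), and in
  particular the distance is at most \<open>3\<epsilon>\<close>.

  Second, rays through rank-one projections are recognizable: everything below \<open>tP\<close> is a multiple of \<open>P\<close>, and
  everything almost below \<open>tP\<close> is a multiple of \<open>P\<close> up to order \<open>\<surd>t\<close>. By \<open>\<delta>\<close>-surjectivity the same holds for
  \<open>T (tP)\<close>, so that two orthogonal parts of \<open>T (tP)\<close> cannot both be large and \<open>T (tP)\<close> has rank one up to order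
  \<open>\<surd>t\<close> (\<open>dominant_eigenvector\<close>). Its dominant eigenvectors for \<open>t = 4\<^sup>n\<close> form a Cauchy sequence, because \<open>T\<close> is
  monotone up to a constant (\<open>rank_one_ray_limit\<close>). The resulting map of rank-one projections does not
  increase transition probabilities by \<open>trace_comparison\<close>; nor does the one coming from a coarse inverse of
  \<open>T\<close>. So it preserves them, and Wigner's theorem (\<open>wigner\<close>) provides the unitary or antiunitary \<open>U\<close>.
  Rays through projections of higher finite rank then follow \<open>U\<close> as well (\<open>finite_rank_ray\<close>).\<close>

section \<open>Complex inner product spaces\<close>

interpretation cvec: vector_space "scaleC :: complex \<Rightarrow> 'a::complex_inner \<Rightarrow> 'a"
  by unfold_locales
    (simp_all add: scaleC_add_right scaleC_add_left scaleC_scaleC,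
     metis of_real_1 scaleR_one scaleR_scaleC)

lemma cinner_add_left: "cinner (x + y) z = cinner x z + cinner y z"
  by (metis cinner_add_right cinner_commute complex_cnj_add)

lemma cinner_scaleC_left: "cinner (c *\<^sub>C x) y = cnj c * cinner x y"
  by (metis cinner_commute cinner_scaleC_right complex_cnj_mult)

lemma cinner_zero_right [simp]: "cinner x 0 = 0"
  by (metis cinner_add_right add_cancel_right_right)

lemma cinner_zero_left [simp]: "cinner 0 x = 0"
  by (metis cinner_commute cinner_zero_right complex_cnj_zero)

lemma cinner_minus_right: "cinner x (- y) = - cinner x y"
  by (metis add.right_inverse cinner_add_right cinner_zero_right neg_eq_iff_add_eq_0)

lemma cinner_minus_left: "cinner (- x) y = - cinner x y"
  by (metis add.right_inverse cinner_add_left cinner_zero_left neg_eq_iff_add_eq_0)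

lemma cinner_diff_right: "cinner x (y - z) = cinner x y - cinner x z"
  by (metis add_uminus_conv_diff cinner_add_right cinner_minus_right)

lemma cinner_diff_left: "cinner (x - y) z = cinner x z - cinner y z"
  by (metis add_uminus_conv_diff cinner_add_left cinner_minus_left)

lemma cinner_sum_right: "cinner x (\<Sum>i\<in>I. f i) = (\<Sum>i\<in>I. cinner x (f i))"
  by (induction I rule: infinite_finite_induct) (auto simp: cinner_add_right)

lemma cinner_sum_left: "cinner (\<Sum>i\<in>I. f i) x = (\<Sum>i\<in>I. cinner (f i) x)"
  by (induction I rule: infinite_finite_induct) (auto simp: cinner_add_left)

lemma cinner_scaleR_right: "cinner x (r *\<^sub>R y) = complex_of_real r * cinner x y"
  by (simp add: scaleR_scaleC cinner_scaleC_right)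

lemma cinner_scaleR_left: "cinner (r *\<^sub>R x) y = complex_of_real r * cinner x y"
  by (simp add: scaleR_scaleC cinner_scaleC_left)

lemmas cinner_simps = cinner_add_left cinner_add_right cinner_diff_left cinner_diff_right
  cinner_minus_left cinner_minus_right cinner_scaleC_left cinner_scaleC_right
  cinner_scaleR_left cinner_scaleR_right

lemma scaleR_scaleC_commute: "c *\<^sub>C (r *\<^sub>R (x::'a::complex_inner)) = r *\<^sub>R (c *\<^sub>C x)"
  by (simp add: scaleR_scaleC mult.commute)

lemma cinner_self: "cinner x x = complex_of_real ((norm x)\<^sup>2)"
proof (rule complex_eqI)
  show "Re (cinner x x) = Re (complex_of_real ((norm x)\<^sup>2))"
    by (simp add: inner_eq_Re_cinner[symmetric] power2_norm_eq_inner)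
  have "cinner x x = cnj (cinner x x)" by (rule cinner_commute)
  then have "Im (cinner x x) = Im (cnj (cinner x x))" by simp
  then show "Im (cinner x x) = Im (complex_of_real ((norm x)\<^sup>2))" by simp
qed

lemma norm_scaleC: "norm (c *\<^sub>C x) = cmod c * norm (x::'a::complex_inner)"
proof -
  have "complex_of_real ((norm (c *\<^sub>C x))\<^sup>2) = cnj c * c * complex_of_real ((norm x)\<^sup>2)"
    by (metis (no_types) cinner_self cinner_scaleC_left cinner_scaleC_right mult.assoc mult.left_commute)
  also have "\<dots> = complex_of_real ((cmod c * norm x)\<^sup>2)"
    by (simp only: power_mult_distrib of_real_mult complex_norm_square[symmetric] mult.commute[of "cnj c"])
  finally have "(norm (c *\<^sub>C x))\<^sup>2 = (cmod c * norm x)\<^sup>2"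
    using of_real_eq_iff by blast
  then show ?thesis
    by (simp add: power2_eq_iff_nonneg)
qed

lemma cinner_eqI: "(\<And>x. cinner x y = cinner x z) \<Longrightarrow> y = (z::'a::complex_inner)"
proof -
  assume "\<And>x. cinner x y = cinner x z"
  then have "cinner (y - z) (y - z) = 0"
    by (simp add: cinner_diff_right)
  then show "y = z"
    by (simp add: cinner_self)
qed

text \<open>Rotating one argument makes the complex inner product real and nonnegative, which reduces the
  complex Cauchy--Schwarz inequality to the real one.\<close>

lemma cinner_cauchy_schwarz: "cmod (cinner x y) \<le> norm x * norm y"
proof (cases "cinner x y = 0")
  case False
  define c where "c = cnj (cinner x y) / cmod (cinner x y)"
  have c: "cmod c = 1"
    using False by (simp add: c_def norm_divide)
  have "c * cinner x y = complex_of_real (cmod (cinner x y))"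
    using False complex_norm_square[of "cinner x y"]
    by (simp add: c_def field_simps power2_eq_square)
  then have "inner x (c *\<^sub>C y) = cmod (cinner x y)"
    by (simp add: inner_eq_Re_cinner cinner_scaleC_right)
  then show ?thesis
    using norm_cauchy_schwarz[of x "c *\<^sub>C y"] c by (simp add: norm_scaleC)
qed simp

lemma bounded_bilinear_cinner: "bounded_bilinear (cinner :: 'a::complex_inner \<Rightarrow> 'a \<Rightarrow> complex)"
proof
  show "\<exists>K. \<forall>(a::'a) b. norm (cinner a b) \<le> norm a * norm b * K"
    by (rule exI[of _ 1]) (simp add: cinner_cauchy_schwarz)
qed (simp_all add: cinner_simps scaleR_conv_of_real)

lemma bounded_bilinear_scaleC:
  "bounded_bilinear (scaleC :: complex \<Rightarrow> 'a::complex_inner \<Rightarrow> 'a)"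
proof
  show "\<exists>K. \<forall>a (b::'a). norm (a *\<^sub>C b) \<le> norm a * norm b * K"
    by (rule exI[of _ 1]) (simp add: norm_scaleC)
qed (simp_all add: scaleC_add_right scaleC_add_left scaleR_scaleC scaleR_conv_of_real mult.commute)

lemmas [tendsto_intros] = bounded_bilinear.tendsto[OF bounded_bilinear_cinner]
lemmas [tendsto_intros] = bounded_bilinear.tendsto[OF bounded_bilinear_scaleC]
lemmas bounded_linear_cinner_right = bounded_bilinear.bounded_linear_right[OF bounded_bilinear_cinner]
lemmas bounded_linear_scaleC_left = bounded_bilinear.bounded_linear_left[OF bounded_bilinear_scaleC]

lemma norm_diff_sq: "(norm (x - y))\<^sup>2 = (norm x)\<^sup>2 - 2 * Re (cinner x y) + (norm y)\<^sup>2"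
  by (simp add: power2_norm_eq_inner inner_eq_Re_cinner[symmetric] inner_diff_left inner_diff_right
      inner_commute)

lemma norm_add_sq: "(norm (x + y))\<^sup>2 = (norm x)\<^sup>2 + 2 * Re (cinner x y) + (norm y)\<^sup>2"
  by (simp add: power2_norm_eq_inner inner_eq_Re_cinner[symmetric] inner_add_left inner_add_right
      inner_commute)

section \<open>Orthonormal families\<close>

definition orthonormal :: "'a::complex_inner set \<Rightarrow> bool" where
  "orthonormal E \<longleftrightarrow> (\<forall>e\<in>E. norm e = 1) \<and> (\<forall>e\<in>E. \<forall>f\<in>E. e \<noteq> f \<longrightarrow> cinner e f = 0)"

lemma orthonormal_cinner:
  "orthonormal E \<Longrightarrow> e \<in> E \<Longrightarrow> f \<in> E \<Longrightarrow> cinner e f = (if e = f then 1 else 0)"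
  by (auto simp: orthonormal_def cinner_self)

lemma orthonormal_norm: "orthonormal E \<Longrightarrow> e \<in> E \<Longrightarrow> norm e = 1"
  by (simp add: orthonormal_def)

lemma orthonormal_subset: "orthonormal E \<Longrightarrow> F \<subseteq> E \<Longrightarrow> orthonormal F"
  by (auto simp: orthonormal_def)

lemma orthonormal_empty [simp]: "orthonormal {}"
  by (simp add: orthonormal_def)

lemma orthonormal_singleton [simp]: "orthonormal {x} \<longleftrightarrow> norm x = 1"
  by (simp add: orthonormal_def)

lemma is_onb_orthonormal: "is_onb E \<Longrightarrow> orthonormal E"
  by (simp add: is_onb_def orthonormal_def)

lemma cinner_sum_orthonormal:
  assumes "orthonormal E" "finite F" "F \<subseteq> E" "e \<in> E"
  shows "cinner e (\<Sum>f\<in>F. c f *\<^sub>C f) = (if e \<in> F then c e else 0)"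
proof -
  have "cinner e (\<Sum>f\<in>F. c f *\<^sub>C f) = (\<Sum>f\<in>F. if f = e then c f else 0)"
    unfolding cinner_sum_right
    by (rule sum.cong) (use assms in \<open>auto simp: cinner_scaleC_right orthonormal_cinner[OF assms(1)] subset_iff\<close>)
  then show ?thesis
    using assms(2) by simp
qed

lemma norm_sum_orthonormal:
  assumes "orthonormal F" "finite F"
  shows "(norm (\<Sum>f\<in>F. c f *\<^sub>C f))\<^sup>2 = (\<Sum>f\<in>F. (cmod (c f))\<^sup>2)"
proof -
  have "complex_of_real ((norm (\<Sum>f\<in>F. c f *\<^sub>C f))\<^sup>2)
      = (\<Sum>e\<in>F. cnj (c e) * cinner e (\<Sum>f\<in>F. c f *\<^sub>C f))"
    unfolding cinner_self[symmetric] by (subst (1) cinner_sum_left) (simp only: cinner_scaleC_left)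
  also have "\<dots> = (\<Sum>e\<in>F. cnj (c e) * c e)"
    by (rule sum.cong) (use assms in \<open>auto simp: cinner_sum_orthonormal\<close>)
  also have "\<dots> = complex_of_real (\<Sum>f\<in>F. (cmod (c f))\<^sup>2)"
    by (simp add: complex_norm_square mult.commute del: of_real_power)
  finally show ?thesis
    using of_real_eq_iff by blast
qed

text \<open>The orthogonal projection onto the span of \<open>F\<close>, when \<open>F\<close> is finite and orthonormal.\<close>

definition coord_sum :: "'a::complex_inner set \<Rightarrow> 'a \<Rightarrow> 'a" where
  "coord_sum F x = (\<Sum>e\<in>F. cinner e x *\<^sub>C e)"

lemma norm_sub_sum_orthonormal:
  assumes "orthonormal F" "finite F"
  shows "(norm (x - (\<Sum>f\<in>F. c f *\<^sub>C f)))\<^sup>2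
    = (norm x)\<^sup>2 - (\<Sum>f\<in>F. (cmod (cinner f x))\<^sup>2) + (\<Sum>f\<in>F. (cmod (c f - cinner f x))\<^sup>2)"
proof -
  have "Re (cinner x (\<Sum>f\<in>F. c f *\<^sub>C f)) = (\<Sum>f\<in>F. Re (c f * cnj (cinner f x)))"
    by (simp add: cinner_sum_right cinner_scaleC_right cinner_commute[of x])
  moreover have "(cmod (c f - cinner f x))\<^sup>2
      = (cmod (c f))\<^sup>2 - 2 * Re (c f * cnj (cinner f x)) + (cmod (cinner f x))\<^sup>2" for f
    unfolding cmod_power2 by (simp add: power2_eq_square algebra_simps)
  ultimately show ?thesis
    by (simp add: norm_diff_sq norm_sum_orthonormal[OF assms] sum.distrib sum_subtractf
        sum_distrib_left[symmetric])
qed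

lemma norm_sub_coord_sum:
  assumes "orthonormal F" "finite F"
  shows "(norm (x - coord_sum F x))\<^sup>2 = (norm x)\<^sup>2 - (\<Sum>f\<in>F. (cmod (cinner f x))\<^sup>2)"
  unfolding coord_sum_def norm_sub_sum_orthonormal[OF assms] by simp

lemma bessel:
  assumes "orthonormal F" "finite F"
  shows "(\<Sum>f\<in>F. (cmod (cinner f x))\<^sup>2) \<le> (norm x)\<^sup>2"
  using norm_sub_coord_sum[OF assms, of x] zero_le_power2[of "norm (x - coord_sum F x)"] by linarith

lemma coord_sum_best_approximation:
  assumes "orthonormal F" "finite F"
  shows "norm (x - coord_sum F x) \<le> norm (x - (\<Sum>f\<in>F. c f *\<^sub>C f))"
proof (rule power2_le_imp_le)
  show "(norm (x - coord_sum F x))\<^sup>2 \<le> (norm (x - (\<Sum>f\<in>F. c f *\<^sub>C f)))\<^sup>2"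
    unfolding norm_sub_coord_sum[OF assms] norm_sub_sum_orthonormal[OF assms]
    by (simp add: sum_nonneg)
qed simp

text \<open>The coordinate sum over \<open>F\<close> is the best approximation of \<open>x\<close> from the span of \<open>F\<close>, so density of the span
  of \<open>E\<close> gives convergence along the finite subsets of \<open>E\<close>.\<close>

lemma onb_expansion:
  assumes E: "is_onb E"
  shows "((\<lambda>e. cinner e x *\<^sub>C e) has_sum x) E"
  unfolding has_sum_def tendsto_iff
proof (intro allI impI)
  fix r :: real assume "r > 0"
  have "x \<in> closure (cvec.span E)"
    using E by (simp add: is_onb_def)
  then obtain y where y: "y \<in> cvec.span E" "dist y x < r"
    using \<open>r > 0\<close> closure_approachable by blast
  then obtain t c where t: "finite t" "t \<subseteq> E" "y = (\<Sum>a\<in>t. c a *\<^sub>C a)"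
    unfolding cvec.span_explicit by blast
  show "eventually (\<lambda>F. dist (\<Sum>e\<in>F. cinner e x *\<^sub>C e) x < r) (finite_subsets_at_top E)"
    unfolding eventually_finite_subsets_at_top
  proof (intro exI conjI allI impI)
    fix F assume F: "finite F \<and> t \<subseteq> F \<and> F \<subseteq> E"
    then have oF: "orthonormal F"
      using E is_onb_orthonormal orthonormal_subset by blast
    have yF: "y = (\<Sum>a\<in>F. (if a \<in> t then c a else 0) *\<^sub>C a)"
      unfolding t(3) by (rule sum.mono_neutral_cong_left) (use F in auto)
    have "norm (x - coord_sum F x) \<le> norm (x - y)"
      unfolding yF by (rule coord_sum_best_approximation[OF oF]) (use F in blast)
    then show "dist (\<Sum>e\<in>F. cinner e x *\<^sub>C e) x < r"
      using y(2) by (simp add: dist_norm coord_sum_def norm_minus_commute)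
  qed (use t(1,2) in auto)
qed

lemma parseval:
  assumes "is_onb E"
  shows "((\<lambda>e. (cmod (cinner e x))\<^sup>2) has_sum (norm x)\<^sup>2) E"
proof -
  have "((\<lambda>e. Re (cinner x (cinner e x *\<^sub>C e))) has_sum Re (cinner x x)) E"
    by (intro has_sum_Re has_sum_bounded_linear[OF bounded_linear_cinner_right] onb_expansion assms)
  moreover have "Re (cinner x (cinner e x *\<^sub>C e)) = (cmod (cinner e x))\<^sup>2" for e
    by (simp add: cinner_scaleC_right cinner_commute[of x e] complex_mult_cnj cmod_power2)
  ultimately show ?thesis
    unfolding cinner_self by (simp only: Re_complex_of_real)
qed

text \<open>Riesz--Fischer: square-summable coefficients along an orthonormal family define a vector. A
  sequence of finite index sets that exhausts the sum of squares up to \<open>4\<^sup>-\<^sup>n\<close> has Cauchy partial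
  sums, and every larger finite partial sum stays within \<open>2\<^sup>-\<^sup>n\<close> of them.\<close>

lemma riesz_fischer:
  fixes E :: "'a::chilbert_space set"
  assumes E: "orthonormal E" and c: "(\<lambda>e. (cmod (c e))\<^sup>2) summable_on E"
  shows "(\<lambda>e. c e *\<^sub>C e) summable_on E"
proof -
  let ?g = "\<lambda>e. (cmod (c e))\<^sup>2" and ?s = "\<lambda>F. \<Sum>e\<in>F. c e *\<^sub>C e"
  obtain s where s: "(?g has_sum s) E"
    using c unfolding summable_on_def by blast
  have "\<exists>F. finite F \<and> F \<subseteq> E \<and> dist (sum ?g F) s \<le> (1/4)^n" for n :: nat
    using has_sum_finite_approximation[OF s, of "(1/4)^n"] by auto
  then obtain G where G: "\<And>n::nat. finite (G n) \<and> G n \<subseteq> E \<and> dist (sum ?g (G n)) s \<le> (1/4)^n"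
    by metis
  have near: "norm (?s F - ?s (G n)) \<le> (1/2)^n" if F: "finite F" "G n \<subseteq> F" "F \<subseteq> E" for F n
  proof (rule power2_le_imp_le)
    have "?s F - ?s (G n) = ?s (F - G n)"
      using F by (simp add: sum_diff)
    then have "(norm (?s F - ?s (G n)))\<^sup>2 = sum ?g (F - G n)"
      using norm_sum_orthonormal[of "F - G n" c] F orthonormal_subset[OF E] by (metis Diff_subset finite_Diff subset_trans)
    also have "\<dots> = sum ?g F - sum ?g (G n)"
      using F by (simp add: sum_diff)
    also have "\<dots> \<le> s - sum ?g (G n)"
      using finite_sum_le_has_sum[OF s F(1) F(3)] by simp
    also have "\<dots> \<le> ((1/2)^n)\<^sup>2"
    proof -
      have "((1/2::real)^n)\<^sup>2 = (1/4)^n"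
        by (simp add: power2_eq_square power_mult_distrib[symmetric])
      moreover have "\<bar>sum ?g (G n) - s\<bar> \<le> (1/4)^n"
        using G[of n] by (simp add: dist_real_def)
      ultimately show ?thesis
        by linarith
    qed
    finally show "(norm (?s F - ?s (G n)))\<^sup>2 \<le> ((1/2)^n)\<^sup>2" .
  qed simp
  define H where "H n = (\<Union>i\<le>n. G i)" for n
  have H: "finite (H n)" "H n \<subseteq> E" for n
    using G by (auto simp: H_def)
  have GH: "G m \<subseteq> H n" if "m \<le> n" for m n
    using that by (auto simp: H_def)
  have two: "norm (?s F - ?s F') \<le> 2 * (1/2)^n"
    if "finite F" "G n \<subseteq> F" "F \<subseteq> E" "finite F'" "G n \<subseteq> F'" "F' \<subseteq> E" for F F' n
    using near[OF that(1-3)] near[OF that(4-6)] norm_triangle_ineq4[of "?s F - ?s (G n)" "?s F' - ?s (G n)"]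
    by simp
  have small: "\<exists>N. 2 * (1/2)^N < r" if pos: "r > 0" for r :: real
  proof -
    obtain N where "(1/2::real)^N < r/2"
      using real_arch_pow_inv[OF half_gt_zero[OF pos], of "1/2"] by auto
    then show ?thesis
      by (intro exI[of _ N]) simp
  qed
  have "Cauchy (\<lambda>n. ?s (H n))"
  proof (rule metric_CauchyI)
    fix r :: real assume "r > 0"
    then obtain N where N: "2 * (1/2::real)^N < r" using small by blast
    show "\<exists>M. \<forall>m\<ge>M. \<forall>n\<ge>M. dist (?s (H m)) (?s (H n)) < r"
    proof (intro exI allI impI)
      fix m n assume "m \<ge> N" "n \<ge> N"
      then show "dist (?s (H m)) (?s (H n)) < r"
        using two[OF H(1) GH H(2) H(1) GH H(2)] N by (fastforce simp: dist_norm)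
    qed
  qed
  then obtain y where y: "(\<lambda>n. ?s (H n)) \<longlonglongrightarrow> y"
    using Cauchy_convergent convergent_def by blast
  have "((\<lambda>e. c e *\<^sub>C e) has_sum y) E"
    unfolding has_sum_def tendsto_iff
  proof (intro allI impI)
    fix r :: real assume "r > 0"
    then obtain N where N: "2 * (1/2::real)^N < r" using small by blast
    show "eventually (\<lambda>F. dist (?s F) y < r) (finite_subsets_at_top E)"
      unfolding eventually_finite_subsets_at_top
    proof (intro exI[of _ "G N"] conjI allI impI)
      fix F assume F: "finite F \<and> G N \<subseteq> F \<and> F \<subseteq> E"
      have "norm (?s F - y) \<le> 2 * (1/2)^N"
      proof (rule LIMSEQ_le_const2)
        show "(\<lambda>n. norm (?s F - ?s (H n))) \<longlonglongrightarrow> norm (?s F - y)"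
          by (intro tendsto_intros y)
        show "\<exists>M. \<forall>n\<ge>M. norm (?s F - ?s (H n)) \<le> 2 * (1/2)^N"
          by (intro exI[of _ N] allI impI two H GH) (use F in auto)
      qed
      then show "dist (?s F) y < r"
        using N by (simp add: dist_norm)
    qed (use G in auto)
  qed
  then show ?thesis
    by (rule has_sum_imp_summable)
qed

lemma orthonormal_square_summable:
  assumes "orthonormal E"
  shows "(\<lambda>e. (cmod (cinner e x))\<^sup>2) summable_on E"
proof (rule nonneg_bdd_above_summable_on)
  show "bdd_above (sum (\<lambda>e. (cmod (cinner e x))\<^sup>2) ` {F. F \<subseteq> E \<and> finite F})"
    using bessel orthonormal_subset[OF assms] by (intro bdd_aboveI[of _ "(norm x)\<^sup>2"]) blast
qed simp

lemma onb_if_trivial_complement: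
  fixes E :: "'a::chilbert_space set"
  assumes E: "orthonormal E" and triv: "\<And>x. (\<And>e. e \<in> E \<Longrightarrow> cinner e x = 0) \<Longrightarrow> x = 0"
  shows "is_onb E"
proof -
  have "x \<in> closure (cvec.span E)" for x
  proof -
    obtain y where y: "((\<lambda>e. cinner e x *\<^sub>C e) has_sum y) E"
      using riesz_fischer[OF E orthonormal_square_summable[OF E]] unfolding summable_on_def by blast
    have "cinner f (x - y) = 0" if "f \<in> E" for f
    proof -
      have "((\<lambda>e. cinner f (cinner e x *\<^sub>C e)) has_sum cinner f y) E"
        by (rule has_sum_bounded_linear[OF bounded_linear_cinner_right y])
      moreover have "((\<lambda>e. cinner f (cinner e x *\<^sub>C e)) has_sum cinner f x) E"
        by (rule has_sum_finite_neutralI[of "{f}"])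
          (use that in \<open>auto simp: cinner_scaleC_right orthonormal_cinner[OF E]\<close>)
      ultimately have "cinner f y = cinner f x"
        using has_sum_unique by blast
      then show ?thesis
        by (simp add: cinner_diff_right)
    qed
    then have "x = y"
      using triv[of "x - y"] by simp
    show ?thesis
    proof (unfold closure_approachable, intro allI impI)
      fix r :: real assume "r > 0"
      then obtain F where "finite F" "F \<subseteq> E" "dist (\<Sum>e\<in>F. cinner e x *\<^sub>C e) y \<le> r/2"
        using has_sum_finite_approximation[OF y, of "r/2"] by auto
      moreover from this have "(\<Sum>e\<in>F. cinner e x *\<^sub>C e) \<in> cvec.span E"
        by (intro cvec.span_sum cvec.span_scale cvec.span_base) auto
      ultimately show "\<exists>z\<in>cvec.span E. dist z x < r"
        using \<open>r > 0\<close> \<open>x = y\<close> by force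
    qed
  qed
  then show ?thesis
    using E by (auto simp: is_onb_def orthonormal_def)
qed

text \<open>Zorn's lemma, relative to a property \<open>P\<close> of the vectors. With \<open>P\<close> trivial it extends \<open>S\<close> to an orthonormal
  basis; with \<open>P\<close> saying that a vector is an eigenvector it is the frame of the spectral theorem.\<close>

lemma maximal_orthonormal_extension:
  assumes "orthonormal S" and "\<And>s. s \<in> S \<Longrightarrow> P s"
  obtains E where "S \<subseteq> E" "orthonormal E" "\<And>e. e \<in> E \<Longrightarrow> P e"
    "\<And>x. norm x = 1 \<Longrightarrow> P x \<Longrightarrow> (\<And>e. e \<in> E \<Longrightarrow> cinner e x = 0) \<Longrightarrow> False"
proof -
  let ?A = "{E. S \<subseteq> E \<and> orthonormal E \<and> (\<forall>e\<in>E. P e)}"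
  have "\<exists>M\<in>?A. \<forall>X\<in>?A. M \<subseteq> X \<longrightarrow> X = M"
  proof (rule subset_Zorn_nonempty)
    show "?A \<noteq> {}" using assms by blast
    fix C assume C: "C \<noteq> {}" "subset.chain ?A C"
    then have 1: "S \<subseteq> X" "orthonormal X" "\<And>e. e \<in> X \<Longrightarrow> P e" if "X \<in> C" for X
      using that by (auto simp: subset_chain_def)
    have 2: "X \<subseteq> Y \<or> Y \<subseteq> X" if "X \<in> C" "Y \<in> C" for X Y
      using that C(2) by (auto simp: subset_chain_def)
    have "cinner e f = 0" if "e \<in> \<Union>C" "f \<in> \<Union>C" "e \<noteq> f" for e f
    proof -
      obtain X where "X \<in> C" "e \<in> X" "f \<in> X"
        using \<open>e \<in> \<Union>C\<close> \<open>f \<in> \<Union>C\<close> 2 by blast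
      then show ?thesis
        using orthonormal_cinner[OF 1(2)] \<open>e \<noteq> f\<close> by simp
    qed
    moreover have "norm e = 1" if "e \<in> \<Union>C" for e
      using that 1(2) orthonormal_norm by (meson UnionE)
    ultimately have "orthonormal (\<Union>C)"
      unfolding orthonormal_def by simp
    moreover have "S \<subseteq> \<Union>C"
      using 1(1) C(1) by (meson Union_upper ex_in_conv subset_trans)
    moreover have "\<forall>e\<in>\<Union>C. P e"
      using 1(3) by (meson UnionE)
    ultimately show "\<Union>C \<in> ?A"
      by simp
  qed
  then obtain M where M: "M \<in> ?A" and max: "\<forall>X\<in>?A. M \<subseteq> X \<longrightarrow> X = M" by (elim bexE)
  show thesis
  proof (rule that[of M])
    fix x assume x: "norm x = 1" "P x" "\<And>e. e \<in> M \<Longrightarrow> cinner e x = 0"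
    have "cinner x e = 0" if "e \<in> M" for e
      using x(3)[OF that] cinner_commute[of x e] by simp
    then have "insert x M \<in> ?A"
      using M x by (auto simp: orthonormal_def)
    from bspec[OF max this] have "x \<in> M"
      by auto
    then show False
      using x(1) x(3)[of x] by (simp add: cinner_self)
  qed (use M in auto)
qed

lemma orthonormal_extends_to_onb:
  fixes S :: "'a::chilbert_space set"
  assumes "orthonormal S"
  obtains E where "S \<subseteq> E" "is_onb E"
proof -
  obtain E where E: "S \<subseteq> E" "orthonormal E"
    "\<And>x. norm x = 1 \<Longrightarrow> (\<And>e. e \<in> E \<Longrightarrow> cinner e x = 0) \<Longrightarrow> False"
    by (rule maximal_orthonormal_extension[OF assms, of "\<lambda>_. True"]) auto
  have "is_onb E"
  proof (rule onb_if_trivial_complement[OF E(2)], rule ccontr)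
    fix x assume x: "\<And>e. e \<in> E \<Longrightarrow> cinner e x = 0" "x \<noteq> 0"
    show False
      by (rule E(3)[of "(1 / norm x) *\<^sub>R x"]) (use x in \<open>auto simp: cinner_scaleR_right\<close>)
  qed
  then show thesis
    using E that by blast
qed

definition some_onb :: "'a::chilbert_space set" where
  "some_onb = (SOME E. is_onb E)"

lemma is_onb_some_onb: "is_onb some_onb"
  unfolding some_onb_def by (rule someI_ex) (metis orthonormal_extends_to_onb orthonormal_empty)

section \<open>Bounded, hermitian and positive operators\<close>

lemma bounded_clinear_add: "bounded_clinear A \<Longrightarrow> A (x + y) = A x + A y"
  by (simp add: bounded_clinear_def)

lemma bounded_clinear_scaleC: "bounded_clinear A \<Longrightarrow> A (c *\<^sub>C x) = c *\<^sub>C A x"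
  by (simp add: bounded_clinear_def)

lemma bounded_clinear_scaleR: "bounded_clinear A \<Longrightarrow> A (r *\<^sub>R x) = r *\<^sub>R A x"
  by (simp add: bounded_clinear_scaleC scaleR_scaleC)

lemma bounded_clinear_bound:
  assumes "bounded_clinear A"
  obtains K where "K > 0" "\<And>x::'a::complex_inner. norm (A x :: 'a) \<le> K * norm x"
proof -
  obtain K where K: "\<And>x::'a. norm (A x) \<le> K * norm x"
    using assms unfolding bounded_clinear_def by auto
  show thesis
  proof (rule that[of "\<bar>K\<bar> + 1"])
    fix x :: 'a
    have "K * norm x \<le> (\<bar>K\<bar> + 1) * norm x"
      by (intro mult_right_mono) auto
    then show "norm (A x) \<le> (\<bar>K\<bar> + 1) * norm x"
      using K[of x] by linarith
  qed simp
qed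

lemma bounded_clinear_bounded_linear:
  assumes "bounded_clinear A"
  shows "bounded_linear A"
proof -
  obtain K where "\<And>x. norm (A x) \<le> K * norm x"
    using bounded_clinear_bound[OF assms] by blast
  then show ?thesis
    by (intro bounded_linear_intro[of A K])
      (simp_all add: bounded_clinear_add[OF assms] bounded_clinear_scaleR[OF assms] mult.commute)
qed

lemma bounded_clinear_zero: "bounded_clinear A \<Longrightarrow> A 0 = 0"
  using bounded_clinear_bounded_linear linear_simps(3) by blast

lemma bounded_clinear_diff: "bounded_clinear A \<Longrightarrow> A (x - y) = A x - A y"
  using bounded_clinear_bounded_linear linear_simps(2) by blast

lemma bounded_clinear_uminus: "bounded_clinear A \<Longrightarrow> A (- x) = - A x"
  using bounded_clinear_scaleR[of A "-1" x] by simp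

lemma bounded_clinear_sum: "bounded_clinear A \<Longrightarrow> A (\<Sum>i\<in>I. f i) = (\<Sum>i\<in>I. A (f i))"
  by (rule linear_sum) (simp add: bounded_clinear_bounded_linear bounded_linear.linear)

lemma bounded_clinearI:
  assumes "\<And>x y. A (x + y) = A x + A y" "\<And>c x. A (c *\<^sub>C x) = c *\<^sub>C A x"
    "\<And>x. norm (A x) \<le> K * norm x"
  shows "bounded_clinear A"
  using assms unfolding bounded_clinear_def by blast

lemma bounded_clinear_plus:
  assumes "bounded_clinear A" "bounded_clinear B"
  shows "bounded_clinear (\<lambda>x. A x + B x)"
proof -
  obtain K L where K: "\<And>x. norm (A x) \<le> K * norm x" and L: "\<And>x. norm (B x) \<le> L * norm x"
    using bounded_clinear_bound assms by metis
  have "norm (A x + B x) \<le> (K + L) * norm x" for x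
    using norm_triangle_ineq[of "A x" "B x"] K[of x] L[of x] by (simp add: algebra_simps)
  then show ?thesis
    by (intro bounded_clinearI[of _ "K + L"])
      (simp_all add: assms[THEN bounded_clinear_add] assms[THEN bounded_clinear_scaleC] scaleC_add_right)
qed

lemma bounded_clinear_real_scale:
  assumes "bounded_clinear A"
  shows "bounded_clinear (\<lambda>x. r *\<^sub>R A x)"
proof -
  obtain K where K: "\<And>x. norm (A x) \<le> K * norm x"
    using bounded_clinear_bound assms by metis
  have "norm (r *\<^sub>R A x) \<le> (\<bar>r\<bar> * K) * norm x" for x
    using mult_left_mono[OF K[of x], of "\<bar>r\<bar>"] by (simp add: mult.assoc)
  then show ?thesis
    by (intro bounded_clinearI[of _ "\<bar>r\<bar> * K"])
      (simp_all add: assms[THEN bounded_clinear_add] assms[THEN bounded_clinear_scaleC]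
        scaleR_add_right scaleR_scaleC_commute)
qed

lemma bounded_clinear_minus:
  assumes "bounded_clinear A" "bounded_clinear B"
  shows "bounded_clinear (\<lambda>x. A x - B x)"
  using bounded_clinear_plus[OF assms(1) bounded_clinear_real_scale[OF assms(2), of "-1"]] by simp

lemma bounded_clinear_compose:
  assumes "bounded_clinear A" "bounded_clinear B"
  shows "bounded_clinear (\<lambda>x. A (B x))"
proof -
  obtain K L where K: "K > 0" "\<And>x. norm (A x) \<le> K * norm x" and L: "\<And>x. norm (B x) \<le> L * norm x"
    using bounded_clinear_bound assms by metis
  have "norm (A (B x)) \<le> (K * L) * norm x" for x
    using K(2)[of "B x"] mult_left_mono[OF L[of x] less_imp_le[OF K(1)]] by (simp add: mult.assoc)
  then show ?thesis
    by (intro bounded_clinearI[of _ "K * L"])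
      (simp_all add: assms[THEN bounded_clinear_add] assms[THEN bounded_clinear_scaleC])
qed

definition hermitian :: "('a::complex_inner \<Rightarrow> 'a) \<Rightarrow> bool" where
  "hermitian A \<longleftrightarrow> (\<forall>x y. cinner (A x) y = cinner x (A y))"

lemma hermitianD: "hermitian A \<Longrightarrow> cinner (A x) y = cinner x (A y)"
  by (simp add: hermitian_def)

definition qform :: "('a::complex_inner \<Rightarrow> 'a) \<Rightarrow> 'a \<Rightarrow> real" where
  "qform A x = Re (cinner x (A x))"

lemma qform_scaleC:
  assumes "bounded_clinear A"
  shows "qform A (c *\<^sub>C x) = (cmod c)\<^sup>2 * qform A x"
proof -
  have "cinner (c *\<^sub>C x) (A (c *\<^sub>C x)) = (c * cnj c) * cinner x (A x)"
    by (simp add: bounded_clinear_scaleC[OF assms] cinner_simps)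
  then show ?thesis
    by (simp add: qform_def complex_norm_square[symmetric] del: of_real_power)
qed

lemma qform_scaleR:
  assumes "bounded_clinear A"
  shows "qform A (r *\<^sub>R x) = r\<^sup>2 * qform A x"
  using qform_scaleC[OF assms, of "complex_of_real r"] by (simp add: scaleR_scaleC)

lemma qform_add:
  assumes "bounded_clinear A" "hermitian A"
  shows "qform A (x + y) = qform A x + qform A y + 2 * Re (cinner x (A y))"
proof -
  have "Re (cinner y (A x)) = Re (cinner x (A y))"
    by (metis assms(2) cinner_commute complex_cnj hermitian_def complex.sel(1) cnj.simps(1))
  then show ?thesis
    by (simp add: qform_def bounded_clinear_add[OF assms(1)] cinner_simps)
qed

lemma qform_norm_bound:
  assumes "\<And>x. norm (A x) \<le> K * norm x"
  shows "\<bar>qform A x\<bar> \<le> K * (norm x)\<^sup>2"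
proof -
  have "\<bar>qform A x\<bar> \<le> norm x * norm (A x)"
    unfolding qform_def using abs_Re_le_cmod cinner_cauchy_schwarz order_trans by blast
  also have "\<dots> \<le> norm x * (K * norm x)"
    by (intro mult_left_mono assms) simp
  finally show ?thesis
    by (simp add: power2_eq_square mult_ac)
qed

lemma positive_op_bounded_clinear: "positive_op A \<Longrightarrow> bounded_clinear A"
  by (simp add: positive_op_def)

lemma positive_op_nonneg: "positive_op A \<Longrightarrow> 0 \<le> qform A x"
  by (simp add: positive_op_def qform_def complex_nonneg_Reals_iff)

lemma positive_op_cinner: "positive_op A \<Longrightarrow> cinner x (A x) = complex_of_real (qform A x)"
  by (simp add: positive_op_def qform_def complex_nonneg_Reals_iff complex_eq_iff)

text \<open>Polarization: a complex form that is real on the diagonal is hermitian.\<close>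

lemma positive_op_hermitian:
  assumes "positive_op A"
  shows "hermitian A"
  unfolding hermitian_def
proof (intro allI)
  fix x y
  have A: "bounded_clinear A" and real: "\<And>z. Im (cinner z (A z)) = 0"
    using assms by (auto simp: positive_op_def complex_nonneg_Reals_iff)
  have "Im (cinner (x + y) (A (x + y))) = Im (cinner x (A y)) + Im (cinner y (A x))"
    using real[of x] real[of y] by (simp add: bounded_clinear_add[OF A] cinner_simps)
  moreover have "Im (cinner (x + \<i> *\<^sub>C y) (A (x + \<i> *\<^sub>C y))) = Re (cinner x (A y)) - Re (cinner y (A x))"
    using real[of x] real[of y]
    by (simp add: bounded_clinear_add[OF A] bounded_clinear_scaleC[OF A] cinner_simps)
  ultimately have "cinner x (A y) = cnj (cinner y (A x))"
    using real[of "x + y"] real[of "x + \<i> *\<^sub>C y"] by (simp add: complex_eq_iff)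
  then show "cinner (A x) y = cinner x (A y)"
    using cinner_commute[of "A x" y] by simp
qed

lemma positive_opI:
  assumes "bounded_clinear A" "hermitian A" "\<And>x. 0 \<le> qform A x"
  shows "positive_op A"
proof -
  have "Im (cinner x (A x)) = 0" for x
  proof -
    have "cinner x (A x) = cnj (cinner x (A x))"
      using hermitianD[OF assms(2), of x x] cinner_commute[of "A x" x] by simp
    then have "Im (cinner x (A x)) = Im (cnj (cinner x (A x)))" by simp
    then show ?thesis by simp
  qed
  then show ?thesis
    using assms(1,3) by (auto simp: positive_op_def complex_nonneg_Reals_iff qform_def)
qed

lemma hermitian_plus: "hermitian A \<Longrightarrow> hermitian B \<Longrightarrow> hermitian (\<lambda>x. A x + B x)"
  by (simp add: hermitian_def cinner_simps)

lemma hermitian_minus: "hermitian A \<Longrightarrow> hermitian B \<Longrightarrow> hermitian (\<lambda>x. A x - B x)"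
  by (simp add: hermitian_def cinner_simps)

lemma hermitian_real_scale: "hermitian A \<Longrightarrow> hermitian (\<lambda>x. r *\<^sub>R A x)"
  by (simp add: hermitian_def cinner_simps)

lemma qform_plus: "qform (\<lambda>x. A x + B x) x = qform A x + qform B x"
  by (simp add: qform_def cinner_simps)

lemma qform_minus: "qform (\<lambda>x. A x - B x) x = qform A x - qform B x"
  by (simp add: qform_def cinner_simps)

lemma qform_real_scale: "qform (\<lambda>x. r *\<^sub>R A x) x = r * qform A x"
  by (simp add: qform_def cinner_simps)

lemma positive_op_plus: "positive_op A \<Longrightarrow> positive_op B \<Longrightarrow> positive_op (\<lambda>x. A x + B x)"
  by (intro positive_opI bounded_clinear_plus hermitian_plus)
    (auto simp: positive_op_bounded_clinear positive_op_hermitian qform_plus positive_op_nonneg)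

lemma positive_op_real_scale: "positive_op A \<Longrightarrow> 0 \<le> r \<Longrightarrow> positive_op (\<lambda>x. r *\<^sub>R A x)"
  by (intro positive_opI bounded_clinear_real_scale hermitian_real_scale)
    (auto simp: positive_op_bounded_clinear positive_op_hermitian qform_real_scale positive_op_nonneg)

text \<open>Expand \<open>0 \<le> q(\<surd>\<eta> x - y / \<surd>\<eta>)\<close>. With \<open>\<eta>\<close> small or large, this keeps one of the two summands almost
  intact at the expense of the other.\<close>

lemma qform_add_le:
  assumes A: "positive_op A" and "\<eta> > 0"
  shows "qform A (x + y) \<le> (1 + \<eta>) * qform A x + (1 + 1 / \<eta>) * qform A y"
proof -
  let ?s = "sqrt \<eta>"
  note bA = positive_op_bounded_clinear[OF A] and hA = positive_op_hermitian[OF A]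
  have s: "?s > 0" "?s\<^sup>2 = \<eta>" "(- 1 / ?s)\<^sup>2 = 1 / \<eta>"
    using \<open>\<eta> > 0\<close> by (simp_all add: power_divide)
  have "0 \<le> qform A (?s *\<^sub>R x + (- 1 / ?s) *\<^sub>R y)"
    using A by (rule positive_op_nonneg)
  also have "\<dots> = \<eta> * qform A x + qform A y / \<eta> - 2 * Re (cinner x (A y))"
    using s unfolding qform_add[OF bA hA] qform_scaleR[OF bA]
    by (simp add: bounded_clinear_scaleR[OF bA] bounded_clinear_uminus[OF bA] cinner_simps)
  finally show ?thesis
    unfolding qform_add[OF bA hA] by (simp add: algebra_simps)
qed

lemma positive_op_cauchy_schwarz:
  assumes A: "positive_op A"
  shows "(cmod (cinner x (A y)))\<^sup>2 \<le> qform A x * qform A y"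
proof -
  note bA = positive_op_bounded_clinear[OF A] and hA = positive_op_hermitian[OF A]
  define z where "z = cinner x (A y)"
  define b where "b = cmod z"
  have *: "0 \<le> b\<^sup>2 * qform A x - 2 * s * b\<^sup>2 + s\<^sup>2 * qform A y" for s
  proof -
    have "0 \<le> qform A (z *\<^sub>C x + (- s) *\<^sub>R y)"
      using A by (rule positive_op_nonneg)
    also have "\<dots> = b\<^sup>2 * qform A x + s\<^sup>2 * qform A y - 2 * s * Re (cnj z * z)"
      unfolding qform_add[OF bA hA] qform_scaleR[OF bA] qform_scaleC[OF bA]
      by (simp add: bounded_clinear_scaleR[OF bA] bounded_clinear_uminus[OF bA] cinner_simps z_def b_def)
    also have "Re (cnj z * z) = b\<^sup>2"
      unfolding b_def cmod_power2 by (simp add: power2_eq_square)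
    finally show ?thesis by simp
  qed
  have "b\<^sup>2 \<le> qform A x * qform A y"
  proof (cases "b = 0")
    case True
    then show ?thesis using positive_op_nonneg[OF A] by simp
  next
    case False
    have "qform A y \<noteq> 0"
    proof
      assume "qform A y = 0"
      then have "0 \<le> b\<^sup>2 * qform A x - 2 * (qform A x) * b\<^sup>2 - 2 * b\<^sup>2"
        using *[of "qform A x + 1"] by (simp add: algebra_simps)
      moreover have "0 \<le> b\<^sup>2 * qform A x"
        using positive_op_nonneg[OF A] by simp
      ultimately have "b\<^sup>2 \<le> 0"
        unfolding mult.assoc mult.commute[of "qform A x"] by linarith
      then show False using False by simp
    qed
    then have q: "qform A y > 0"
      using positive_op_nonneg[OF A, of y] by linarith
    have "0 \<le> b\<^sup>2 * (qform A x - b\<^sup>2 / qform A y)"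
      using *[of "b\<^sup>2 / qform A y"] q by (simp add: field_simps power2_eq_square)
    then have "b\<^sup>2 / qform A y \<le> qform A x"
      using False by (simp add: zero_le_mult_iff)
    then show ?thesis
      using q by (simp add: field_simps)
  qed
  then show ?thesis by (simp add: b_def z_def)
qed

lemma positive_op_norm_le:
  assumes A: "positive_op A" and K: "\<And>x. norm (A x) \<le> K * norm x"
  shows "(norm (A x))\<^sup>2 \<le> K * qform A x"
proof (cases "A x = 0")
  case True
  then show ?thesis by (simp add: qform_def)
next
  case False
  have "((norm (A x))\<^sup>2)\<^sup>2 = (cmod (cinner (A x) (A x)))\<^sup>2"
    by (simp add: cinner_self norm_power)
  also have "\<dots> \<le> qform A (A x) * qform A x"
    using A by (rule positive_op_cauchy_schwarz)
  also have "\<dots> \<le> (K * (norm (A x))\<^sup>2) * qform A x"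
    using qform_norm_bound[OF K, of "A x"] positive_op_nonneg[OF A]
    by (intro mult_right_mono) auto
  finally have "(norm (A x))\<^sup>2 * (norm (A x))\<^sup>2 \<le> (norm (A x))\<^sup>2 * (K * qform A x)"
    by (simp add: power2_eq_square mult_ac)
  moreover have "0 < (norm (A x))\<^sup>2"
    using False by simp
  ultimately show ?thesis
    using mult_le_cancel_left_pos by blast
qed

section \<open>Norming sequences and uniqueness of positive square roots\<close>

text \<open>If \<open>D\<close> is hermitian with norm \<open>m\<close> on an invariant set \<open>M\<close>, then unit vectors on which \<open>D\<close>
  almost attains its norm are approximate eigenvectors of \<open>D\<^sup>2\<close>, because
  \<open>\<parallel>D\<^sup>2x - m\<^sup>2x\<parallel>\<^sup>2 = \<parallel>D\<^sup>2x\<parallel>\<^sup>2 - 2m\<^sup>2\<parallel>Dx\<parallel>\<^sup>2 + m\<^sup>4 \<le> m\<^sup>2(m\<^sup>2 - \<parallel>Dx\<parallel>\<^sup>2)\<close>. This serves both the uniqueness of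
  square roots and the spectral theorem for compact operators.\<close>

lemma hermitian_norming_sequence:
  fixes D :: "'a::complex_inner \<Rightarrow> 'a"
  assumes D: "bounded_clinear D" "hermitian D"
    and M: "\<exists>x\<in>M. norm x = 1" "\<And>x. x \<in> M \<Longrightarrow> D x \<in> M" "\<And>r x. x \<in> M \<Longrightarrow> r *\<^sub>R x \<in> M"
  obtains m x where "m \<ge> 0" "\<And>y. y \<in> M \<Longrightarrow> norm (D y) \<le> m * norm y"
    "\<And>n. x n \<in> M" "\<And>n. norm (x n) = 1" "(\<lambda>n. norm (D (x n))) \<longlonglongrightarrow> m"
    "(\<lambda>n. D (D (x n)) - m\<^sup>2 *\<^sub>R x n) \<longlonglongrightarrow> 0"
proof -
  let ?B = "{x\<in>M. norm x = 1}"
  define m where "m = (SUP x\<in>?B. norm (D x))"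
  obtain K where K: "K > 0" "\<And>x. norm (D x) \<le> K * norm x"
    using bounded_clinear_bound[OF D(1)] by metis
  have "norm (D x) \<le> K" if "x \<in> ?B" for x
    using K(2)[of x] that by simp
  then have bdd: "bdd_above ((\<lambda>x. norm (D x)) ` ?B)"
    by (rule bdd_aboveI2)
  have unit: "norm (D x) \<le> m" if "x \<in> M" "norm x = 1" for x
    unfolding m_def by (rule cSUP_upper) (use that bdd in auto)
  have m0: "m \<ge> 0"
    using M(1) unit norm_ge_zero order_trans by meson
  have le: "norm (D y) \<le> m * norm y" if y: "y \<in> M" for y
  proof (cases "y = 0")
    case False
    then have "norm (D ((1 / norm y) *\<^sub>R y)) \<le> m"
      by (intro unit M(3) y) simp
    then show ?thesis
      using False by (simp add: bounded_clinear_scaleR[OF D(1)] field_simps)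
  qed (simp add: bounded_clinear_zero[OF D(1)])
  have "\<exists>x\<in>?B. m - 1 / real (Suc n) < norm (D x)" for n
  proof -
    have "m - 1 / real (Suc n) < (SUP x\<in>?B. norm (D x))"
      unfolding m_def by simp
    then show ?thesis
      using less_cSUP_iff[OF _ bdd] M(1) by auto
  qed
  then obtain x where x: "\<And>n. x n \<in> M" "\<And>n. norm (x n) = 1"
    "\<And>n. m - 1 / real (Suc n) < norm (D (x n))"
    by (metis (mono_tags, lifting) mem_Collect_eq)
  have lim: "(\<lambda>n. norm (D (x n))) \<longlonglongrightarrow> m"
  proof (rule tendsto_sandwich)
    show "(\<lambda>n. m - 1 / real (Suc n)) \<longlonglongrightarrow> m"
      using tendsto_diff[OF tendsto_const[of m] LIMSEQ_inverse_real_of_nat]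
      by (simp add: inverse_eq_divide)
    show "\<forall>\<^sub>F n in sequentially. m - 1 / real (Suc n) \<le> norm (D (x n))"
      using x(3) by (simp add: less_imp_le)
    show "\<forall>\<^sub>F n in sequentially. norm (D (x n)) \<le> m"
      using unit x by simp
  qed simp
  have "(\<lambda>n. (norm (D (D (x n)) - m\<^sup>2 *\<^sub>R x n))\<^sup>2) \<longlonglongrightarrow> 0"
  proof (rule Lim_null_comparison)
    show "(\<lambda>n. m\<^sup>2 * (m\<^sup>2 - (norm (D (x n)))\<^sup>2)) \<longlonglongrightarrow> 0"
      by (rule tendsto_eq_intros lim refl)+ simp
    have "(norm (D (D (x n)) - m\<^sup>2 *\<^sub>R x n))\<^sup>2 \<le> m\<^sup>2 * (m\<^sup>2 - (norm (D (x n)))\<^sup>2)" for n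
    proof -
      have "cinner (D (D (x n))) (x n) = cinner (D (x n)) (D (x n))"
        by (rule hermitianD[OF D(2)])
      then have "Re (cinner (D (D (x n))) (m\<^sup>2 *\<^sub>R x n)) = m\<^sup>2 * (norm (D (x n)))\<^sup>2"
        by (simp add: cinner_scaleR_right cinner_self del: of_real_power)
      then have "(norm (D (D (x n)) - m\<^sup>2 *\<^sub>R x n))\<^sup>2
          = (norm (D (D (x n))))\<^sup>2 - 2 * m\<^sup>2 * (norm (D (x n)))\<^sup>2 + m\<^sup>2 * m\<^sup>2"
        unfolding norm_diff_sq by (simp add: x(2) power2_eq_square)
      moreover have "(norm (D (D (x n))))\<^sup>2 \<le> m\<^sup>2 * (norm (D (x n)))\<^sup>2"
        using power_mono[OF le[OF M(2)[OF x(1)]], of n 2] by (simp add: power_mult_distrib)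
      ultimately show ?thesis
        by (simp add: algebra_simps)
    qed
    then show "\<forall>\<^sub>F n in sequentially.
        norm ((norm (D (D (x n)) - m\<^sup>2 *\<^sub>R x n))\<^sup>2) \<le> m\<^sup>2 * (m\<^sup>2 - (norm (D (x n)))\<^sup>2)"
      by simp
  qed
  then have "(\<lambda>n. sqrt ((norm (D (D (x n)) - m\<^sup>2 *\<^sub>R x n))\<^sup>2)) \<longlonglongrightarrow> sqrt 0"
    by (rule tendsto_real_sqrt)
  then have "(\<lambda>n. D (D (x n)) - m\<^sup>2 *\<^sub>R x n) \<longlonglongrightarrow> 0"
    by (simp add: tendsto_norm_zero_iff)
  with that[of m x] m0 le x lim show thesis
    by blast
qed

text \<open>Two positive operators \<open>P\<close>, \<open>A\<close> with the same square satisfy \<open>SD + DS = 0\<close> for \<open>S = P + A\<close> and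
  \<open>D = P - A\<close>. Hence \<open>\<langle>Dx, SDx\<rangle> = - \<langle>D\<^sup>2x, Sx\<rangle>\<close>, which is close to \<open>- m\<^sup>2 \<langle>x, Sx\<rangle>\<close> along a norming
  sequence of \<open>D\<close>; both sides have opposite signs, so \<open>\<langle>x, Sx\<rangle>\<close> and with it \<open>Px\<close> and \<open>Ax\<close> tend to
  zero, unless \<open>m = 0\<close>.\<close>

lemma positive_sqrt_unique:
  fixes P A :: "'a::complex_inner \<Rightarrow> 'a"
  assumes P: "positive_op P" and A: "positive_op A" and sq: "\<And>x. P (P x) = A (A x)"
  shows "P = A"
proof (rule ccontr)
  assume "P \<noteq> A"
  then obtain y where y: "P y \<noteq> A y" by auto
  note bP = positive_op_bounded_clinear[OF P] and bA = positive_op_bounded_clinear[OF A]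
  note hP = positive_op_hermitian[OF P] and hA = positive_op_hermitian[OF A]
  define D where "D = (\<lambda>x. P x - A x)"
  define S where "S = (\<lambda>x. P x + A x)"
  have D: "bounded_clinear D" "hermitian D" and S: "positive_op S"
    unfolding D_def S_def using P A bP bA hP hA
    by (auto intro: bounded_clinear_minus hermitian_minus positive_op_plus)
  have "y \<noteq> 0"
    using y bounded_clinear_zero[OF bP] bounded_clinear_zero[OF bA] by auto
  then have unit: "\<exists>x\<in>(UNIV::'a set). norm x = 1"
    by (intro bexI[of _ "(1 / norm y) *\<^sub>R y"]) auto
  obtain m x where m: "m \<ge> 0" "\<And>y. norm (D y) \<le> m * norm y" "\<And>n. norm (x n) = 1"
    "(\<lambda>n. norm (D (x n))) \<longlonglongrightarrow> m" "(\<lambda>n. D (D (x n)) - m\<^sup>2 *\<^sub>R x n) \<longlonglongrightarrow> 0"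
    using hermitian_norming_sequence[OF D unit] by (metis UNIV_I)
  obtain k where k: "k > 0" "\<And>x. norm (S x) \<le> k * norm x"
    using bounded_clinear_bound[OF positive_op_bounded_clinear[OF S]] by metis
  obtain p where p: "p > 0" "\<And>x. norm (P x) \<le> p * norm x"
    using bounded_clinear_bound[OF bP] by metis
  obtain a where a: "a > 0" "\<And>x. norm (A x) \<le> a * norm x"
    using bounded_clinear_bound[OF bA] by metis
  have anti: "S (D z) = - D (S z)" for z
    unfolding S_def D_def
    by (simp add: bounded_clinear_add[OF bP] bounded_clinear_add[OF bA] bounded_clinear_diff[OF bP]
        bounded_clinear_diff[OF bA] sq)
  have le: "m\<^sup>2 * qform S (x n) \<le> k * norm (D (D (x n)) - m\<^sup>2 *\<^sub>R x n)" for n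
  proof -
    let ?r = "D (D (x n)) - m\<^sup>2 *\<^sub>R x n"
    have "qform S (D (x n)) = - Re (cinner (D (D (x n))) (S (x n)))"
      by (simp add: qform_def anti cinner_simps hermitianD[OF D(2)])
    also have "\<dots> = - Re (cinner ?r (S (x n))) - m\<^sup>2 * qform S (x n)"
      by (simp add: qform_def cinner_simps)
    finally have "m\<^sup>2 * qform S (x n) \<le> - Re (cinner ?r (S (x n)))"
      using positive_op_nonneg[OF S, of "D (x n)"] by linarith
    also have "\<dots> \<le> norm ?r * norm (S (x n))"
      using abs_Re_le_cmod[of "cinner ?r (S (x n))"] cinner_cauchy_schwarz[of ?r "S (x n)"] by linarith
    also have "\<dots> \<le> norm ?r * k"
      using k(2)[of "x n"] m(3) by (intro mult_left_mono) auto
    finally show ?thesis by (simp add: mult.commute)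
  qed
  have "(\<lambda>n. k * norm (D (D (x n)) - m\<^sup>2 *\<^sub>R x n)) \<longlonglongrightarrow> 0"
    using tendsto_mult_right_zero[OF tendsto_norm_zero[OF m(5)]] by simp
  then have lim0: "(\<lambda>n. m\<^sup>2 * qform S (x n)) \<longlonglongrightarrow> 0"
    by (rule Lim_null_comparison[rotated]) (use le in \<open>simp add: positive_op_nonneg[OF S]\<close>)
  have "m \<noteq> 0"
  proof
    assume "m = 0"
    then have "D y = 0" using m(2)[of y] by simp
    then show False using y by (simp add: D_def)
  qed
  then have limS: "(\<lambda>n. qform S (x n)) \<longlonglongrightarrow> 0"
    using tendsto_mult_left[OF lim0, of "1 / m\<^sup>2"] by simp
  have small: "(\<lambda>n. norm (B (x n))) \<longlonglongrightarrow> 0"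
    if B: "positive_op B" "\<And>z. qform B z \<le> qform S z" "b > 0" "\<And>z. norm (B z) \<le> b * norm z" for B b
  proof -
    have le: "(norm (B (x n)))\<^sup>2 \<le> b * qform S (x n)" for n
      by (rule order_trans[OF positive_op_norm_le[OF B(1,4)] mult_left_mono[OF B(2) less_imp_le[OF B(3)]]])
    have "(\<lambda>n. b * qform S (x n)) \<longlonglongrightarrow> 0"
      using tendsto_mult_right_zero[OF limS] by simp
    then have "(\<lambda>n. (norm (B (x n)))\<^sup>2) \<longlonglongrightarrow> 0"
      by (rule Lim_null_comparison[rotated]) (use le in simp)
    from tendsto_real_sqrt[OF this] show ?thesis
      by simp
  qed
  have qS: "qform S z = qform P z + qform A z" for z
    unfolding S_def by (rule qform_plus)
  have "(\<lambda>n. norm (P (x n)) + norm (A (x n))) \<longlonglongrightarrow> 0 + 0"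
    by (intro tendsto_add small[OF P _ p] small[OF A _ a])
      (simp_all add: qS positive_op_nonneg[OF P] positive_op_nonneg[OF A])
  then have "(\<lambda>n. norm (P (x n)) + norm (A (x n))) \<longlonglongrightarrow> 0"
    by simp
  then have "(\<lambda>n. norm (D (x n))) \<longlonglongrightarrow> 0"
    by (rule Lim_null_comparison[rotated]) (simp add: D_def norm_triangle_ineq4)
  then have "m = 0"
    using m(4) LIMSEQ_unique by blast
  with \<open>m \<noteq> 0\<close> show False by simp
qed

lemma adj_op_hermitian:
  fixes A :: "'a::chilbert_space \<Rightarrow> 'a"
  assumes "hermitian A"
  shows "adj_op A = A"
  unfolding adj_op_def
proof (rule the_equality)
  show "\<forall>x y. cinner (A x) y = cinner x (A y)"
    using assms by (simp add: hermitian_def)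
  fix B assume B: "\<forall>x y. cinner (B x) y = cinner x (A y)"
  have "B x = A x" for x
  proof (rule cinner_eqI)
    fix y
    have "cnj (cinner (B x) y) = cnj (cinner (A x) y)"
      using B assms by (simp add: hermitian_def)
    then show "cinner y (B x) = cinner y (A x)"
      using cinner_commute by metis
  qed
  then show "B = A" by auto
qed

lemma abs_op_eqI:
  fixes A :: "'a::chilbert_space \<Rightarrow> 'a"
  assumes "hermitian A" "positive_op P" "\<And>x. P (P x) = A (A x)"
  shows "abs_op A = P"
  unfolding abs_op_def adj_op_hermitian[OF assms(1)]
proof (rule the_equality)
  show "positive_op P \<and> P \<circ> P = A \<circ> A"
    using assms by auto
  fix Q assume Q: "positive_op Q \<and> Q \<circ> Q = A \<circ> A"
  then have "Q (Q x) = P (P x)" for x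
    using assms(3)[of x] fun_cong[of "Q \<circ> Q" "A \<circ> A" x] unfolding comp_def by auto
  then show "Q = P"
    using positive_sqrt_unique Q assms(2) by blast
qed

lemma abs_op_positive:
  fixes A :: "'a::chilbert_space \<Rightarrow> 'a"
  shows "positive_op A \<Longrightarrow> abs_op A = A"
  by (rule abs_op_eqI) (auto simp: positive_op_hermitian)

text \<open>On positive operators the absolute value in the definition of the trace class disappears, because a
  positive operator is its own positive square root of \<open>A\<^sup>*A\<close>.\<close>

lemma trace_class_cone_iff:
  "A \<in> trace_class_cone \<longleftrightarrow> positive_op A \<and> (\<exists>E. is_onb E \<and> qform A summable_on E)"
proof (cases "positive_op A")
  case True
  have "(\<lambda>e. cinner e (A e)) summable_on E \<longleftrightarrow> qform A summable_on E" for E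
    using summable_on_Re[of "\<lambda>e. cinner e (A e)" E] summable_on_of_real[of "qform A" E]
    by (auto simp: positive_op_cinner[OF True] comp_def)
  then show ?thesis
    using True by (simp add: trace_class_cone_def trace_class_def abs_op_positive positive_op_bounded_clinear)
qed (simp add: trace_class_cone_def)

section \<open>Compactness and the spectral theorem\<close>

definition compact_op :: "('a::real_normed_vector \<Rightarrow> 'a) \<Rightarrow> bool" where
  "compact_op X \<longleftrightarrow> (\<forall>x. (\<forall>n::nat. norm (x n) \<le> 1) \<longrightarrow>
     (\<exists>r l. strict_mono r \<and> (\<lambda>n. X (x (r n))) \<longlonglongrightarrow> l))"

lemma compact_op_minus:
  assumes "compact_op X" "compact_op Y"
  shows "compact_op (\<lambda>x. X x - Y x)"
  unfolding compact_op_def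
proof (intro allI impI)
  fix x :: "nat \<Rightarrow> 'a" assume x: "\<forall>n. norm (x n) \<le> 1"
  then obtain r l where r: "strict_mono r" "(\<lambda>n. X (x (r n))) \<longlonglongrightarrow> l"
    using assms(1) unfolding compact_op_def by meson
  have "\<forall>n. norm (x (r n)) \<le> 1" using x by simp
  then obtain s k where s: "strict_mono s" "(\<lambda>n. Y (x (r (s n)))) \<longlonglongrightarrow> k"
    using assms(2)[unfolded compact_op_def, rule_format, of "\<lambda>n. x (r n)"] by auto
  have "(\<lambda>n. X (x (r (s n)))) \<longlonglongrightarrow> l"
    using LIMSEQ_subseq_LIMSEQ[OF r(2) s(1)] by (simp add: comp_def)
  then have "(\<lambda>n. X (x ((r \<circ> s) n)) - Y (x ((r \<circ> s) n))) \<longlonglongrightarrow> l - k"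
    using tendsto_diff[OF _ s(2)] by simp
  then show "\<exists>r l. strict_mono r \<and> (\<lambda>n. X (x (r n)) - Y (x (r n))) \<longlonglongrightarrow> l"
    using strict_mono_o[OF r(1) s(1)] by blast
qed

lemma compact_bounded_combinations:
  fixes v :: "'i \<Rightarrow> 'a::complex_inner"
  assumes "finite F"
  shows "compact {\<Sum>e\<in>F. c e *\<^sub>C v e |c. \<forall>e\<in>F. cmod (c e) \<le> 1}"
  using assms
proof (induction F rule: finite_induct)
  case (insert f F)
  let ?S = "{\<Sum>e\<in>F. c e *\<^sub>C v e |c. \<forall>e\<in>F. cmod (c e) \<le> 1}"
  let ?L = "(\<lambda>c. c *\<^sub>C v f) ` cball 0 1"
  have "compact ?L"
    by (intro compact_continuous_image linear_continuous_on bounded_linear_scaleC_left compact_cball)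
  then have "compact {x + y |x y. x \<in> ?L \<and> y \<in> ?S}"
    by (intro compact_sums insert.IH)
  also have "{x + y |x y. x \<in> ?L \<and> y \<in> ?S}
      = {\<Sum>e\<in>insert f F. c e *\<^sub>C v e |c. \<forall>e\<in>insert f F. cmod (c e) \<le> 1}" (is "?A = ?B")
  proof
    show "?A \<subseteq> ?B"
    proof
      fix z assume "z \<in> ?A"
      then obtain a c where "cmod a \<le> 1" "\<forall>e\<in>F. cmod (c e) \<le> 1"
        "z = a *\<^sub>C v f + (\<Sum>e\<in>F. c e *\<^sub>C v e)"
        by auto
      moreover from this have "z = (\<Sum>e\<in>insert f F. (c(f := a)) e *\<^sub>C v e)"
        using insert.hyps by (simp add: sum.insert) (rule sum.cong, auto)
      ultimately show "z \<in> ?B"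
        using insert.hyps by (intro CollectI exI[of _ "c(f := a)"]) auto
    qed
    show "?B \<subseteq> ?A"
    proof
      fix z assume "z \<in> ?B"
      then obtain c where c: "\<forall>e\<in>insert f F. cmod (c e) \<le> 1" "z = (\<Sum>e\<in>insert f F. c e *\<^sub>C v e)"
        by auto
      then have "z = c f *\<^sub>C v f + (\<Sum>e\<in>F. c e *\<^sub>C v e)"
        using insert.hyps by simp
      moreover have "c f *\<^sub>C v f \<in> ?L" "(\<Sum>e\<in>F. c e *\<^sub>C v e) \<in> ?S"
        using c(1) by auto
      ultimately show "z \<in> ?A" by blast
    qed
  qed
  finally show ?case .
qed simp

text \<open>The form Cauchy--Schwarz inequality entrywise, then the one for sums: a combination of basis vectors with
  small total diagonal has a small form.\<close>

lemma qform_sum_bound: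
  assumes A: "positive_op A" and "finite G"
  shows "qform A (\<Sum>e\<in>G. c e *\<^sub>C e) \<le> (\<Sum>e\<in>G. (cmod (c e))\<^sup>2) * (\<Sum>e\<in>G. qform A e)"
proof -
  note bA = positive_op_bounded_clinear[OF A]
  have "qform A (\<Sum>e\<in>G. c e *\<^sub>C e) = (\<Sum>f\<in>G. \<Sum>e\<in>G. Re (cnj (c e) * c f * cinner e (A f)))"
    by (simp add: qform_def bounded_clinear_sum[OF bA] bounded_clinear_scaleC[OF bA] cinner_sum_left
        cinner_sum_right cinner_simps sum_distrib_left mult.assoc mult.left_commute del: times_complex.sel)
  also have "\<dots> = (\<Sum>e\<in>G. \<Sum>f\<in>G. Re (cnj (c e) * c f * cinner e (A f)))"
    by (rule sum.swap)
  also have "\<dots> \<le> (\<Sum>e\<in>G. \<Sum>f\<in>G. (cmod (c e) * sqrt (qform A e)) * (cmod (c f) * sqrt (qform A f)))"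
  proof (intro sum_mono)
    fix e f
    have "cmod (cinner e (A f)) \<le> sqrt (qform A e * qform A f)"
      using positive_op_cauchy_schwarz[OF A, of e f] by (simp add: real_le_rsqrt)
    then have "cmod (cnj (c e) * c f * cinner e (A f)) \<le> cmod (c e) * cmod (c f) * sqrt (qform A e * qform A f)"
      by (simp add: norm_mult mult_left_mono)
    then show "Re (cnj (c e) * c f * cinner e (A f))
        \<le> (cmod (c e) * sqrt (qform A e)) * (cmod (c f) * sqrt (qform A f))"
      using complex_Re_le_cmod[of "cnj (c e) * c f * cinner e (A f)"]
      unfolding real_sqrt_mult by (simp only: mult_ac)
  qed
  also have "\<dots> = (\<Sum>e\<in>G. cmod (c e) * sqrt (qform A e))\<^sup>2"
    by (simp add: power2_eq_square sum_product)
  also have "\<dots> \<le> (\<Sum>e\<in>G. (cmod (c e))\<^sup>2) * (\<Sum>e\<in>G. (sqrt (qform A e))\<^sup>2)"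
    by (rule Cauchy_Schwarz_ineq_sum)
  finally show ?thesis
    by (simp add: positive_op_nonneg[OF A])
qed

text \<open>A positive operator with finite trace is a norm limit of its restrictions to finitely many basis
  vectors: beyond a finite set carrying all but \<open>\<kappa>\<close> of the trace, the form is at most \<open>\<kappa>\<close> on unit
  vectors, and \<open>\<parallel>Ax\<parallel>\<^sup>2\<close> is controlled by the form. So the image of the unit ball is totally bounded.\<close>

lemma compact_op_finite_trace:
  fixes A :: "'a::chilbert_space \<Rightarrow> 'a"
  assumes A: "positive_op A" and E: "is_onb E" and sA: "qform A summable_on E"
  shows "compact_op A"
proof -
  note bA = positive_op_bounded_clinear[OF A]
  note oE = is_onb_orthonormal[OF E]
  obtain k where k: "k > 0" "\<And>x. norm (A x) \<le> k * norm x"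
    using bounded_clinear_bound[OF bA] by metis
  obtain \<tau> where \<tau>: "(qform A has_sum \<tau>) E"
    using sA unfolding summable_on_def by blast
  have approx: "\<exists>F. finite F \<and> F \<subseteq> E \<and> (\<forall>x. norm x \<le> 1 \<longrightarrow> norm (A x - A (coord_sum F x)) \<le> \<rho>)"
    if \<rho>: "\<rho> > 0" for \<rho>
  proof -
    define \<kappa> where "\<kappa> = \<rho>\<^sup>2 / k"
    have \<kappa>: "\<kappa> > 0" using that k by (simp add: \<kappa>_def)
    obtain F where F: "finite F" "F \<subseteq> E" "dist (sum (qform A) F) \<tau> \<le> \<kappa>"
      using has_sum_finite_approximation[OF \<tau> \<kappa>] by auto
    have tail: "norm (A (coord_sum G x) - A (coord_sum F x)) \<le> \<rho>"
      if G: "finite G" "F \<subseteq> G" "G \<subseteq> E" and x: "norm x \<le> 1" for G x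
    proof (rule power2_le_imp_le)
      have oG: "orthonormal (G - F)"
        using orthonormal_subset[OF oE] G by blast
      have "coord_sum G x - coord_sum F x = coord_sum (G - F) x"
        unfolding coord_sum_def using G by (simp add: sum_diff)
      then have "(norm (A (coord_sum G x) - A (coord_sum F x)))\<^sup>2 = (norm (A (coord_sum (G - F) x)))\<^sup>2"
        by (simp add: bounded_clinear_diff[OF bA, symmetric])
      also have "\<dots> \<le> k * qform A (coord_sum (G - F) x)"
        by (rule positive_op_norm_le[OF A k(2)])
      also have "qform A (coord_sum (G - F) x)
          \<le> (\<Sum>e\<in>G - F. (cmod (cinner e x))\<^sup>2) * (\<Sum>e\<in>G - F. qform A e)"
        unfolding coord_sum_def by (rule qform_sum_bound[OF A]) (use G in simp)
      also have "\<dots> \<le> 1 * \<kappa>"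
      proof (rule mult_mono)
        have "(\<Sum>e\<in>G - F. (cmod (cinner e x))\<^sup>2) \<le> (norm x)\<^sup>2"
          by (rule bessel[OF oG]) (use G in simp)
        also have "\<dots> \<le> 1" using x by (simp add: power_le_one)
        finally show "(\<Sum>e\<in>G - F. (cmod (cinner e x))\<^sup>2) \<le> 1" .
        have "sum (qform A) G \<le> \<tau>"
          using G positive_op_nonneg[OF A] by (intro finite_sum_le_has_sum[OF \<tau>]) auto
        moreover have "sum (qform A) (G - F) = sum (qform A) G - sum (qform A) F"
          using G by (simp add: sum_diff)
        ultimately show "sum (qform A) (G - F) \<le> \<kappa>"
          using F(3) by (simp add: dist_real_def)
      qed (auto intro!: sum_nonneg simp: positive_op_nonneg[OF A])
      finally show "(norm (A (coord_sum G x) - A (coord_sum F x)))\<^sup>2 \<le> \<rho>\<^sup>2"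
        using k(1) by (simp add: \<kappa>_def)
    qed (use \<rho> in simp)
    have "norm (A x - A (coord_sum F x)) \<le> \<rho>" if x: "norm x \<le> 1" for x
    proof (rule Lim_norm_ubound)
      have "((\<lambda>e. A (cinner e x *\<^sub>C e)) has_sum A x) E"
        by (intro has_sum_bounded_linear[OF bounded_clinear_bounded_linear[OF bA]] onb_expansion E)
      then have "((\<lambda>G. A (coord_sum G x)) \<longlongrightarrow> A x) (finite_subsets_at_top E)"
        by (simp add: has_sum_def coord_sum_def bounded_clinear_sum[OF bA])
      then show "((\<lambda>G. A (coord_sum G x) - A (coord_sum F x)) \<longlongrightarrow> A x - A (coord_sum F x))
          (finite_subsets_at_top E)"
        by (intro tendsto_intros)
      show "\<forall>\<^sub>F G in finite_subsets_at_top E. norm (A (coord_sum G x) - A (coord_sum F x)) \<le> \<rho>"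
        unfolding eventually_finite_subsets_at_top
        by (intro exI[of _ F]) (use F tail x in auto)
    qed simp
    then show ?thesis using F by blast
  qed
  let ?Y = "closure (A ` cball 0 1)"
  have "\<exists>K. finite K \<and> ?Y \<subseteq> (\<Union>x\<in>K. ball x e)" if e: "e > 0" for e
  proof -
    obtain F where F: "finite F" "F \<subseteq> E" "\<And>x. norm x \<le> 1 \<Longrightarrow> norm (A x - A (coord_sum F x)) \<le> e / 4"
      using approx[of "e/4"] e by auto
    let ?C = "{\<Sum>f\<in>F. c f *\<^sub>C A f |c. \<forall>f\<in>F. cmod (c f) \<le> 1}"
    have "compact ?C"
      by (rule compact_bounded_combinations[OF F(1)])
    then have "\<exists>K. finite K \<and> ?C \<subseteq> (\<Union>x\<in>K. ball x (e/4))"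
      using that unfolding compact_eq_totally_bounded by simp
    then obtain K where K: "finite K" "?C \<subseteq> (\<Union>x\<in>K. ball x (e/4))" by blast
    have "A ` cball 0 1 \<subseteq> (\<Union>x\<in>K. cball x (e/2))"
    proof (rule image_subsetI)
      fix x :: 'a assume "x \<in> cball 0 1"
      then have x: "norm x \<le> 1" by simp
      have "cmod (cinner f x) \<le> 1" if "f \<in> F" for f
        using cinner_cauchy_schwarz[of f x] orthonormal_norm[OF oE, of f] that F(2) x by auto
      then have "A (coord_sum F x) \<in> ?C"
        by (auto simp: coord_sum_def bounded_clinear_sum[OF bA] bounded_clinear_scaleC[OF bA])
      then obtain y where "y \<in> K" "dist y (A (coord_sum F x)) < e/4"
        using K(2) by auto
      moreover have "dist (A (coord_sum F x)) (A x) \<le> e/4"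
        using F(3)[OF x] by (simp add: dist_norm norm_minus_commute)
      ultimately have "y \<in> K" "dist y (A x) \<le> e/2"
        using dist_triangle[of y "A x" "A (coord_sum F x)"] by auto
      then show "A x \<in> (\<Union>x\<in>K. cball x (e/2))" by auto
    qed
    then have "?Y \<subseteq> (\<Union>x\<in>K. cball x (e/2))"
      by (rule closure_minimal) (use K(1) in blast)
    also have "\<dots> \<subseteq> (\<Union>x\<in>K. ball x e)"
      using that by (intro UN_mono) (auto simp: subset_eq)
    finally show ?thesis using K(1) by blast
  qed
  then have "compact ?Y"
    by (simp add: compact_eq_totally_bounded complete_eq_closed)
  then show ?thesis
    unfolding compact_op_def compact_def
  proof (intro allI impI)
    fix x :: "nat \<Rightarrow> 'a"
    assume Y: "\<forall>f :: nat \<Rightarrow> 'a. (\<forall>n. f n \<in> ?Y) \<longrightarrow> (\<exists>l\<in>?Y. \<exists>r. strict_mono r \<and> (f \<circ> r) \<longlonglongrightarrow> l)"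
      and x: "\<forall>n. norm (x n) \<le> 1"
    have "A (x n) \<in> ?Y" for n
      using x closure_subset by fastforce
    then show "\<exists>r l. strict_mono r \<and> (\<lambda>n. A (x (r n))) \<longlonglongrightarrow> l"
      using Y[rule_format, of "\<lambda>n. A (x n)"] by (auto simp: comp_def)
  qed
qed

text \<open>A norming sequence of a compact hermitian \<open>X\<close> on the complement of a maximal orthonormal set of
  eigenvectors would have a subsequence converging to an eigenvector \<open>z\<close> of \<open>X\<^sup>2\<close>, say for \<open>m\<^sup>2\<close>;
  then \<open>Xz + mz\<close> or, if that vanishes, \<open>z\<close> is an eigenvector of \<open>X\<close>.\<close>

lemma compact_hermitian_eigenbasis:
  fixes X :: "'a::chilbert_space \<Rightarrow> 'a"
  assumes X: "bounded_clinear X" "hermitian X" "compact_op X"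
  obtains E \<mu> where "is_onb E" "\<And>e. e \<in> E \<Longrightarrow> X e = \<mu> e *\<^sub>R e"
proof -
  define P where "P e = (\<exists>r::real. X e = r *\<^sub>R e)" for e
  obtain E where E: "orthonormal E" "\<And>e. e \<in> E \<Longrightarrow> P e"
    and maxE: "\<And>x. norm x = 1 \<Longrightarrow> P x \<Longrightarrow> (\<And>e. e \<in> E \<Longrightarrow> cinner e x = 0) \<Longrightarrow> False"
    by (rule maximal_orthonormal_extension[of "{}" P]) auto
  define M where "M = {x. \<forall>e\<in>E. cinner e x = 0}"
  have Mscale: "r *\<^sub>R x \<in> M" if "x \<in> M" for r x
    using that by (simp add: M_def cinner_simps)
  have Madd: "x + y \<in> M" if "x \<in> M" "y \<in> M" for x y
    using that by (simp add: M_def cinner_simps)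
  have MX: "X x \<in> M" if "x \<in> M" for x
  proof -
    have "cinner e (X x) = 0" if e: "e \<in> E" for e
    proof -
      obtain r :: real where "X e = r *\<^sub>R e" using E(2)[OF e] unfolding P_def by blast
      then show ?thesis
        using hermitianD[OF X(2), of e x] \<open>x \<in> M\<close> e by (simp add: M_def cinner_simps)
    qed
    then show ?thesis by (simp add: M_def)
  qed
  have no_eigen: False if "x \<in> M" "x \<noteq> 0" "X x = r *\<^sub>R x" for x r
  proof (rule maxE[of "(1 / norm x) *\<^sub>R x"])
    show "P ((1 / norm x) *\<^sub>R x)"
      unfolding P_def by (intro exI[of _ r]) (simp add: bounded_clinear_scaleR[OF X(1)] that)
  qed (use that Mscale in \<open>auto simp: M_def cinner_simps\<close>)
  have "is_onb E"
  proof (rule onb_if_trivial_complement[OF E(1)], rule ccontr)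
    fix x assume x: "\<And>e. e \<in> E \<Longrightarrow> cinner e x = 0" "x \<noteq> 0"
    then have "x \<in> M" by (simp add: M_def)
    with x(2) have unit: "\<exists>x\<in>M. norm x = 1"
      by (intro bexI[of _ "(1 / norm x) *\<^sub>R x"] Mscale) auto
    obtain m u where m: "m \<ge> 0" "\<And>y. y \<in> M \<Longrightarrow> norm (X y) \<le> m * norm y"
      and u: "\<And>n. u n \<in> M" "\<And>n. norm (u n) = 1" "(\<lambda>n. X (X (u n)) - m\<^sup>2 *\<^sub>R u n) \<longlonglongrightarrow> 0"
      using hermitian_norming_sequence[OF X(1,2) unit MX Mscale] by metis
    have "m \<noteq> 0"
    proof
      assume "m = 0"
      then have "X x = 0 *\<^sub>R x" using m(2)[OF \<open>x \<in> M\<close>] by simp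
      then show False using no_eigen[OF \<open>x \<in> M\<close> x(2)] by blast
    qed
    obtain r l where r: "strict_mono r" "(\<lambda>n. X (u (r n))) \<longlonglongrightarrow> l"
      using X(3)[unfolded compact_op_def, rule_format, of u] u(2) by auto
    define z where "z = (1 / m\<^sup>2) *\<^sub>R X l"
    have lX: "(\<lambda>n. X (f n)) \<longlonglongrightarrow> X y" if "f \<longlonglongrightarrow> y" for f y
      using bounded_linear.tendsto[OF bounded_clinear_bounded_linear[OF X(1)] that] .
    have "(\<lambda>n. X (X (u (r n))) - m\<^sup>2 *\<^sub>R u (r n)) \<longlonglongrightarrow> 0"
      using LIMSEQ_subseq_LIMSEQ[OF u(3) r(1)] by (simp add: comp_def)
    from tendsto_diff[OF lX[OF r(2)] this] have "(\<lambda>n. m\<^sup>2 *\<^sub>R u (r n)) \<longlonglongrightarrow> X l"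
      by simp
    then have "(\<lambda>n. (1 / m\<^sup>2) *\<^sub>R (m\<^sup>2 *\<^sub>R u (r n))) \<longlonglongrightarrow> z"
      unfolding z_def by (intro tendsto_intros)
    then have lim: "(\<lambda>n. u (r n)) \<longlonglongrightarrow> z"
      using \<open>m \<noteq> 0\<close> by simp
    have "norm z = 1"
      using tendsto_norm[OF lim] u(2) by (simp add: LIMSEQ_const_iff)
    have "z \<in> M"
      unfolding M_def
    proof (intro CollectI ballI)
      fix e assume "e \<in> E"
      have "(\<lambda>n. cinner e (u (r n))) \<longlonglongrightarrow> cinner e z"
        by (intro tendsto_intros lim)
      then show "cinner e z = 0"
        using u(1) \<open>e \<in> E\<close> by (simp add: M_def LIMSEQ_const_iff)
    qed
    have "(\<lambda>n. X (X (u (r n)))) \<longlonglongrightarrow> X (X z)"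
      by (intro lX lim)
    moreover have "(\<lambda>n. X (X (u (r n)))) \<longlonglongrightarrow> m\<^sup>2 *\<^sub>R z"
    proof -
      have "(\<lambda>n. (X (X (u (r n))) - m\<^sup>2 *\<^sub>R u (r n)) + m\<^sup>2 *\<^sub>R u (r n)) \<longlonglongrightarrow> 0 + m\<^sup>2 *\<^sub>R z"
        by (intro tendsto_intros lim LIMSEQ_subseq_LIMSEQ[OF u(3) r(1), unfolded comp_def])
      then show ?thesis by simp
    qed
    ultimately have XXz: "X (X z) = m\<^sup>2 *\<^sub>R z"
      using LIMSEQ_unique by blast
    show False
    proof (cases "X z + m *\<^sub>R z = 0")
      case True
      then have neg: "X z = (- m) *\<^sub>R z"
        by (simp add: eq_neg_iff_add_eq_0)
      then show False
        using no_eigen[OF \<open>z \<in> M\<close> _ neg] \<open>norm z = 1\<close> by force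
    next
      case False
      have "X (X z + m *\<^sub>R z) = m *\<^sub>R (X z + m *\<^sub>R z)"
        by (simp add: bounded_clinear_add[OF X(1)] bounded_clinear_scaleR[OF X(1)] XXz
            scaleR_add_right power2_eq_square)
      then show False
        using no_eigen[OF _ False] Madd[OF MX[OF \<open>z \<in> M\<close>] Mscale[OF \<open>z \<in> M\<close>]] by blast
    qed
  qed
  moreover obtain \<mu> where "\<And>e. e \<in> E \<Longrightarrow> X e = \<mu> e *\<^sub>R e"
    using E(2) unfolding P_def by metis
  ultimately show thesis using that by blast
qed

lemma qform_eigenvector: "norm e = 1 \<Longrightarrow> X e = r *\<^sub>R e \<Longrightarrow> qform X e = r"
  by (simp add: qform_def cinner_simps cinner_self)

lemma qform_eigenbasis_has_sum:
  assumes X: "bounded_clinear X" and E: "is_onb E" "\<And>e. e \<in> E \<Longrightarrow> X e = \<mu> e *\<^sub>R e"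
  shows "((\<lambda>e. \<mu> e * (cmod (cinner e x))\<^sup>2) has_sum qform X x) E"
proof -
  have "((\<lambda>e. Re (cinner x (X (cinner e x *\<^sub>C e)))) has_sum qform X x) E"
    unfolding qform_def
    by (intro has_sum_Re has_sum_bounded_linear[OF bounded_linear_cinner_right]
        has_sum_bounded_linear[OF bounded_clinear_bounded_linear[OF X]] onb_expansion E)
  moreover have "Re (cinner x (X (cinner e x *\<^sub>C e))) = \<mu> e * (cmod (cinner e x))\<^sup>2" if "e \<in> E" for e
    unfolding cmod_power2
    by (simp add: bounded_clinear_scaleC[OF X] E(2)[OF that] cinner_simps cinner_commute[of x e]
        power2_eq_square algebra_simps)
  ultimately show ?thesis
    using has_sum_cong by (metis (no_types, lifting))
qed

section \<open>Traces of positive operators\<close>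

lemma has_sum_finite_sum:
  fixes f :: "'i \<Rightarrow> 'b \<Rightarrow> 'c::topological_comm_monoid_add"
  assumes "\<And>i. i \<in> I \<Longrightarrow> (f i has_sum s i) A"
  shows "((\<lambda>x. \<Sum>i\<in>I. f i x) has_sum (\<Sum>i\<in>I. s i)) A"
  using assms by (induction I rule: infinite_finite_induct) (auto intro: has_sum_add)

lemma cmod_cinner_commute: "cmod (cinner x y) = cmod (cinner y x)"
  by (metis cinner_commute complex_mod_cnj)

lemma sum_qform_eigenbasis_has_sum:
  assumes X: "bounded_clinear X" and E: "is_onb E" "\<And>e. e \<in> E \<Longrightarrow> X e = \<mu> e *\<^sub>R e"
  shows "((\<lambda>e. \<mu> e * (\<Sum>s\<in>S. (cmod (cinner s e))\<^sup>2)) has_sum (\<Sum>s\<in>S. qform X s)) E"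
proof -
  have "((\<lambda>e. \<Sum>s\<in>S. \<mu> e * (cmod (cinner e s))\<^sup>2) has_sum (\<Sum>s\<in>S. qform X s)) E"
    by (intro has_sum_finite_sum qform_eigenbasis_has_sum assms)
  then show ?thesis
    by (simp add: sum_distrib_left cmod_cinner_commute)
qed

lemma positive_eigenvalue_nonneg:
  assumes "positive_op A" "norm e = 1" "A e = r *\<^sub>R e"
  shows "0 \<le> r"
  using positive_op_nonneg[OF assms(1), of e] qform_eigenvector[of e A, OF assms(2,3)] by simp

text \<open>Comparing an arbitrary orthonormal basis with an eigenbasis in both directions shows that the
  diagonal sums agree; each comparison needs only finite partial sums and Parseval or Bessel.\<close>

lemma sum_eigenvalues_le_diagonal_sum:
  assumes A: "positive_op A" and G: "is_onb G" "\<And>g. g \<in> G \<Longrightarrow> A g = \<mu> g *\<^sub>R g"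
    and F: "is_onb F" "(qform A has_sum s) F" and G': "finite G'" "G' \<subseteq> G"
  shows "sum \<mu> G' \<le> s"
proof -
  note bA = positive_op_bounded_clinear[OF A]
  have \<mu>: "0 \<le> \<mu> g" if "g \<in> G" for g
    using positive_eigenvalue_nonneg[OF A _ G(2)] orthonormal_norm[OF is_onb_orthonormal[OF G(1)]] that
    by blast
  have "((\<lambda>f. \<Sum>g\<in>G'. \<mu> g * (cmod (cinner f g))\<^sup>2) has_sum (\<Sum>g\<in>G'. \<mu> g * (norm g)\<^sup>2)) F"
    by (intro has_sum_finite_sum has_sum_cmult_right parseval F)
  moreover have "(\<Sum>g\<in>G'. \<mu> g * (norm g)\<^sup>2) = sum \<mu> G'"
    by (rule sum.cong) (use G' orthonormal_norm[OF is_onb_orthonormal[OF G(1)]] in auto)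
  ultimately have "((\<lambda>f. \<Sum>g\<in>G'. \<mu> g * (cmod (cinner f g))\<^sup>2) has_sum sum \<mu> G') F"
    by simp
  then show ?thesis
  proof (rule has_sum_mono[OF _ F(2)])
    fix f
    have "(\<Sum>g\<in>G'. \<mu> g * (cmod (cinner g f))\<^sup>2) \<le> qform A f"
      by (rule finite_sum_le_has_sum[OF qform_eigenbasis_has_sum[OF bA G]]) (use G' \<mu> in auto)
    then show "(\<Sum>g\<in>G'. \<mu> g * (cmod (cinner f g))\<^sup>2) \<le> qform A f"
      by (simp add: cmod_cinner_commute)
  qed
qed

lemma diagonal_sum_le_sum_eigenvalues:
  assumes A: "positive_op A" and G: "is_onb G" "\<And>g. g \<in> G \<Longrightarrow> A g = \<mu> g *\<^sub>R g"
    and t: "(\<mu> has_sum t) G" and S: "orthonormal S" "finite S"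
  shows "sum (qform A) S \<le> t"
proof (rule has_sum_mono[OF sum_qform_eigenbasis_has_sum[OF positive_op_bounded_clinear[OF A] G] t])
  fix g assume "g \<in> G"
  then have n: "norm g = 1" and "0 \<le> \<mu> g"
    using positive_eigenvalue_nonneg[OF A _ G(2)] orthonormal_norm[OF is_onb_orthonormal[OF G(1)]]
    by blast+
  then show "\<mu> g * (\<Sum>s\<in>S. (cmod (cinner s g))\<^sup>2) \<le> \<mu> g"
    using bessel[OF S, of g] mult_left_mono[of "\<Sum>s\<in>S. (cmod (cinner s g))\<^sup>2" 1 "\<mu> g"] by simp
qed

lemma diagonal_has_sum_eigenvalue_sum:
  assumes A: "positive_op A" and G: "is_onb G" "\<And>g. g \<in> G \<Longrightarrow> A g = \<mu> g *\<^sub>R g"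
    and t: "(\<mu> has_sum t) G" and F: "is_onb F"
  shows "(qform A has_sum t) F"
proof -
  have le: "sum (qform A) S \<le> t" if "finite S" "S \<subseteq> F" for S
    using diagonal_sum_le_sum_eigenvalues[OF A G t] orthonormal_subset[OF is_onb_orthonormal[OF F]] that
    by blast
  have "qform A summable_on F"
    using le by (intro nonneg_bdd_above_summable_on bdd_aboveI2[of _ _ t]) (auto simp: positive_op_nonneg[OF A])
  then obtain u where u: "(qform A has_sum u) F"
    unfolding summable_on_def by blast
  have "u \<le> t"
    using has_sum_le_finite_sums[OF u] le by blast
  moreover have "t \<le> u"
    using has_sum_le_finite_sums[OF t] sum_eigenvalues_le_diagonal_sum[OF A G F u] by blast
  ultimately show ?thesis using u by simp
qed

lemma cone_positive: "A \<in> trace_class_cone \<Longrightarrow> positive_op A"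
  by (simp add: trace_class_cone_iff)

lemma cone_compact: "A \<in> trace_class_cone \<Longrightarrow> compact_op A"
  using compact_op_finite_trace by (auto simp: trace_class_cone_iff)

lemma cone_eigenbasis:
  assumes "A \<in> trace_class_cone"
  obtains G \<mu> where "is_onb G" "\<And>g. g \<in> G \<Longrightarrow> A g = \<mu> g *\<^sub>R g" "\<And>g. g \<in> G \<Longrightarrow> 0 \<le> \<mu> g"
    "\<mu> summable_on G"
proof -
  have A: "positive_op A" using assms by (rule cone_positive)
  obtain G \<mu> where G: "is_onb G" "\<And>g. g \<in> G \<Longrightarrow> A g = \<mu> g *\<^sub>R g"
    using compact_hermitian_eigenbasis[OF positive_op_bounded_clinear[OF A] positive_op_hermitian[OF A]
        cone_compact[OF assms]] by metis
  have nn: "0 \<le> \<mu> g" if "g \<in> G" for g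
    using positive_eigenvalue_nonneg[OF A _ G(2)] orthonormal_norm[OF is_onb_orthonormal[OF G(1)]] that
    by blast
  obtain F s where F: "is_onb F" "(qform A has_sum s) F"
    using assms unfolding trace_class_cone_iff summable_on_def by blast
  have "\<mu> summable_on G"
    using sum_eigenvalues_le_diagonal_sum[OF A G F] nn
    by (intro nonneg_bdd_above_summable_on bdd_aboveI2[of _ _ s]) auto
  with G nn show thesis using that by blast
qed

text \<open>The trace as a real number. The reference basis is immaterial on the cone, by \<open>cone_has_sum_rtrace\<close>.\<close>

definition rtrace :: "('a::chilbert_space \<Rightarrow> 'a) \<Rightarrow> real" where
  "rtrace A = infsum (qform A) some_onb"

lemma cone_rtrace_eigenvalues:
  assumes "A \<in> trace_class_cone" "is_onb G" "\<And>g. g \<in> G \<Longrightarrow> A g = \<mu> g *\<^sub>R g" "(\<mu> has_sum t) G"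
  shows "rtrace A = t"
  unfolding rtrace_def
  by (rule infsumI diagonal_has_sum_eigenvalue_sum cone_positive is_onb_some_onb assms | assumption)+

lemma cone_has_sum_rtrace:
  assumes "A \<in> trace_class_cone" "is_onb F"
  shows "(qform A has_sum rtrace A) F"
proof -
  obtain G \<mu> where G: "is_onb G" "\<And>g. g \<in> G \<Longrightarrow> A g = \<mu> g *\<^sub>R g" "\<mu> summable_on G"
    using cone_eigenbasis[OF assms(1)] by metis
  then obtain t where t: "(\<mu> has_sum t) G"
    unfolding summable_on_def by blast
  show ?thesis
    using diagonal_has_sum_eigenvalue_sum[OF cone_positive[OF assms(1)] G(1,2) t assms(2)]
      cone_rtrace_eigenvalues[OF assms(1) G(1,2) t] by simp
qed

lemma rtrace_eqI: "A \<in> trace_class_cone \<Longrightarrow> is_onb F \<Longrightarrow> (qform A has_sum s) F \<Longrightarrow> rtrace A = s"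
  using cone_has_sum_rtrace has_sum_unique by blast

lemma sum_qform_le_rtrace:
  assumes "A \<in> trace_class_cone" "orthonormal S" "finite S"
  shows "sum (qform A) S \<le> rtrace A"
proof -
  obtain E where E: "S \<subseteq> E" "is_onb E"
    using orthonormal_extends_to_onb[OF assms(2)] by blast
  show ?thesis
    by (rule finite_sum_le_has_sum[OF cone_has_sum_rtrace[OF assms(1) E(2)] assms(3) E(1)])
      (rule positive_op_nonneg[OF cone_positive[OF assms(1)]])
qed

lemma qform_le_rtrace:
  assumes "A \<in> trace_class_cone"
  shows "qform A x \<le> rtrace A * (norm x)\<^sup>2"
proof (cases "x = 0")
  case False
  have "qform A ((1 / norm x) *\<^sub>R x) \<le> rtrace A"
    using sum_qform_le_rtrace[OF assms, of "{(1 / norm x) *\<^sub>R x}"] False by simp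
  then show ?thesis
    using False unfolding qform_scaleR[OF positive_op_bounded_clinear[OF cone_positive[OF assms]]]
    by (simp add: field_simps power2_eq_square)
qed (simp add: qform_def)

lemma rtrace_nonneg: "A \<in> trace_class_cone \<Longrightarrow> 0 \<le> rtrace A"
  using sum_qform_le_rtrace[of A "{}"] by simp

lemma coneI:
  assumes "positive_op A" "is_onb F" "(qform A has_sum s) F"
  shows "A \<in> trace_class_cone" "rtrace A = s"
proof -
  show "A \<in> trace_class_cone"
    using assms unfolding trace_class_cone_iff summable_on_def by blast
  then show "rtrace A = s"
    using assms by (intro rtrace_eqI)
qed

lemma cone_zero:
  "(\<lambda>x::'a::chilbert_space. 0::'a) \<in> trace_class_cone" "rtrace (\<lambda>x::'a. 0::'a) = 0"
proof -
  have "positive_op (\<lambda>x::'a. 0::'a)"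
    by (intro positive_opI bounded_clinearI[of _ 0]) (auto simp: hermitian_def qform_def)
  moreover have "(qform (\<lambda>x::'a. 0::'a) has_sum 0) some_onb"
    by (intro has_sum_0) (simp add: qform_def)
  ultimately show "(\<lambda>x::'a. 0::'a) \<in> trace_class_cone" "rtrace (\<lambda>x::'a. 0::'a) = 0"
    using coneI is_onb_some_onb by blast+
qed

lemma cone_plus:
  assumes "A \<in> trace_class_cone" "B \<in> trace_class_cone"
  shows "(\<lambda>x. A x + B x) \<in> trace_class_cone" "rtrace (\<lambda>x. A x + B x) = rtrace A + rtrace B"
proof -
  have "positive_op (\<lambda>x. A x + B x)"
    using assms by (intro positive_op_plus cone_positive)
  moreover have "(qform (\<lambda>x. A x + B x) has_sum (rtrace A + rtrace B)) some_onb"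
    unfolding qform_plus by (intro has_sum_add cone_has_sum_rtrace assms is_onb_some_onb)
  ultimately show "(\<lambda>x. A x + B x) \<in> trace_class_cone" "rtrace (\<lambda>x. A x + B x) = rtrace A + rtrace B"
    using coneI is_onb_some_onb by blast+
qed

lemma cone_real_scale:
  assumes "A \<in> trace_class_cone" "0 \<le> r"
  shows "(\<lambda>x. r *\<^sub>R A x) \<in> trace_class_cone" "rtrace (\<lambda>x. r *\<^sub>R A x) = r * rtrace A"
proof -
  have "positive_op (\<lambda>x. r *\<^sub>R A x)"
    using assms by (intro positive_op_real_scale cone_positive)
  moreover have "(qform (\<lambda>x. r *\<^sub>R A x) has_sum (r * rtrace A)) some_onb"
    unfolding qform_real_scale by (intro has_sum_cmult_right cone_has_sum_rtrace assms is_onb_some_onb)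
  ultimately show "(\<lambda>x. r *\<^sub>R A x) \<in> trace_class_cone" "rtrace (\<lambda>x. r *\<^sub>R A x) = r * rtrace A"
    using coneI is_onb_some_onb by blast+
qed

section \<open>The trace norm of a difference of positive trace-class operators\<close>

lemma cinner_diagonal_sum:
  fixes X :: "'a::chilbert_space \<Rightarrow> 'a"
  assumes E: "is_onb E" and X: "((\<lambda>e. (\<nu> e * cinner e x) *\<^sub>C e) has_sum y) E" and f: "f \<in> E"
  shows "cinner f y = \<nu> f * cinner f x"
proof -
  have "((\<lambda>e. cinner f ((\<nu> e * cinner e x) *\<^sub>C e)) has_sum cinner f y) E"
    by (rule has_sum_bounded_linear[OF bounded_linear_cinner_right X])
  moreover have "((\<lambda>e. cinner f ((\<nu> e * cinner e x) *\<^sub>C e)) has_sum \<nu> f * cinner f x) E"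
    by (rule has_sum_finite_neutralI[of "{f}"])
      (use f in \<open>auto simp: cinner_scaleC_right orthonormal_cinner[OF is_onb_orthonormal[OF E]]\<close>)
  ultimately show ?thesis
    using has_sum_unique by blast
qed

lemma onb_eqI:
  assumes "is_onb E" "\<And>e. e \<in> E \<Longrightarrow> cinner e x = cinner e y"
  shows "x = y"
  using onb_expansion[OF assms(1), of x] onb_expansion[OF assms(1), of y] assms(2)
  by (metis (no_types, lifting) has_sum_cong has_sum_unique)

text \<open>Bounded real diagonal operators; they supply \<open>\<bar>X\<bar>\<close> from an eigenbasis of \<open>X\<close>.\<close>

lemma diagonal_operator:
  fixes E :: "'a::chilbert_space set"
  assumes E: "is_onb E" and K: "\<And>e. e \<in> E \<Longrightarrow> 0 \<le> \<nu> e \<and> \<nu> e \<le> K"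
  obtains N where "positive_op N" "\<And>e. e \<in> E \<Longrightarrow> N e = \<nu> e *\<^sub>R e"
    "\<And>x e. e \<in> E \<Longrightarrow> cinner e (N x) = \<nu> e * cinner e x"
proof -
  note oE = is_onb_orthonormal[OF E]
  have K0: "0 \<le> K \<or> E = {}" using K by fastforce
  have le: "(cmod (\<nu> e * cinner e x))\<^sup>2 \<le> K\<^sup>2 * (cmod (cinner e x))\<^sup>2" if "e \<in> E" for e x
    using K[OF that] by (simp add: norm_mult power_mult_distrib mult_right_mono power_mono)
  have "(\<lambda>e. (\<nu> e * cinner e x) *\<^sub>C e) summable_on E" for x
  proof (rule riesz_fischer[OF oE])
    have "(\<lambda>e. K\<^sup>2 * (cmod (cinner e x))\<^sup>2) summable_on E"
      by (intro summable_on_cmult_right orthonormal_square_summable oE)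
    then show "(\<lambda>e. (cmod (\<nu> e * cinner e x))\<^sup>2) summable_on E"
      by (rule summable_on_comparison_test) (use le in auto)
  qed
  then have "\<exists>y. ((\<lambda>e. (\<nu> e * cinner e x) *\<^sub>C e) has_sum y) E" for x
    unfolding summable_on_def by blast
  then obtain N where N: "\<And>x. ((\<lambda>e. (\<nu> e * cinner e x) *\<^sub>C e) has_sum N x) E"
    by metis
  have c: "cinner e (N x) = \<nu> e * cinner e x" if "e \<in> E" for e x
    using N that by (rule cinner_diagonal_sum[OF E])
  have bN: "bounded_clinear N"
  proof (rule bounded_clinearI[of _ "\<bar>K\<bar>"])
    show "N (x + y) = N x + N y" for x y
      by (rule onb_eqI[OF E]) (simp add: c cinner_add_right algebra_simps)
    show "N (a *\<^sub>C x) = a *\<^sub>C N x" for a x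
      by (rule onb_eqI[OF E]) (simp add: c cinner_scaleC_right algebra_simps)
    show "norm (N x) \<le> \<bar>K\<bar> * norm x" for x
    proof (rule power2_le_imp_le)
      have "((\<lambda>e. K\<^sup>2 * (cmod (cinner e x))\<^sup>2) has_sum K\<^sup>2 * (norm x)\<^sup>2) E"
        by (intro has_sum_cmult_right parseval E)
      then have "(norm (N x))\<^sup>2 \<le> K\<^sup>2 * (norm x)\<^sup>2"
        by (rule has_sum_mono[OF parseval[OF E]]) (use c le in auto)
      then show "(norm (N x))\<^sup>2 \<le> (\<bar>K\<bar> * norm x)\<^sup>2"
        by (simp add: power_mult_distrib)
    qed simp
  qed
  have herm: "hermitian N"
    unfolding hermitian_def
  proof (intro allI)
    fix x y
    have 1: "((\<lambda>e. cinner z (cinner e w *\<^sub>C e)) has_sum cinner z w) E" for z w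
      by (intro has_sum_bounded_linear[OF bounded_linear_cinner_right] onb_expansion E)
    have "((\<lambda>e. cinner (N x) (cinner e y *\<^sub>C e)) has_sum cinner x (N y)) E"
    proof (rule has_sum_cong[THEN iffD1, OF _ 1[of x "N y"]])
      fix e assume e: "e \<in> E"
      have "cinner (N x) e = cnj (\<nu> e * cinner e x)"
        using c[OF e, of x] cinner_commute[of "N x" e] by simp
      then show "cinner x (cinner e (N y) *\<^sub>C e) = cinner (N x) (cinner e y *\<^sub>C e)"
        using cinner_commute[of x e] by (simp add: c[OF e] cinner_scaleC_right)
    qed
    then show "cinner (N x) y = cinner x (N y)"
      using 1[of "N x" y] has_sum_unique by blast
  qed
  have eig: "N e = \<nu> e *\<^sub>R e" if "e \<in> E" for e
    by (rule onb_eqI[OF E])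
      (use that in \<open>simp add: c cinner_scaleR_right orthonormal_cinner[OF oE]\<close>)
  have "0 \<le> qform N x" for x
    by (rule has_sum_nonneg[OF qform_eigenbasis_has_sum[OF bN E eig]]) (use K in auto)
  then have "positive_op N"
    using bN herm by (intro positive_opI)
  then show thesis using eig c that by blast
qed

definition tdist :: "('a::chilbert_space \<Rightarrow> 'a) \<Rightarrow> ('a \<Rightarrow> 'a) \<Rightarrow> real" where
  "tdist A B = trace_norm (\<lambda>x. A x - B x)"

text \<open>In an eigenbasis of \<open>A - B\<close>, which is compact, the absolute value is the diagonal operator with entries
  \<open>\<bar>\<mu> g\<bar>\<close>. These are summable since \<open>\<bar>\<mu> g\<bar> \<le> \<langle>g, Ag\<rangle> + \<langle>g, Bg\<rangle>\<close>.\<close>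

lemma difference_eigenbasis:
  fixes A B :: "'a::chilbert_space \<Rightarrow> 'a"
  assumes A: "A \<in> trace_class_cone" and B: "B \<in> trace_class_cone"
  obtains G \<mu> where "is_onb G" "\<And>g. g \<in> G \<Longrightarrow> A g - B g = \<mu> g *\<^sub>R g"
    "((\<lambda>g. \<bar>\<mu> g\<bar>) has_sum tdist A B) G" "(\<mu> has_sum (rtrace A - rtrace B)) G"
proof -
  note pA = cone_positive[OF A] and pB = cone_positive[OF B]
  let ?X = "\<lambda>x. A x - B x"
  have bX: "bounded_clinear ?X" and hX: "hermitian ?X"
    using pA pB by (auto intro: bounded_clinear_minus hermitian_minus positive_op_bounded_clinear
        positive_op_hermitian)
  obtain G \<mu> where G: "is_onb G" "\<And>g. g \<in> G \<Longrightarrow> A g - B g = \<mu> g *\<^sub>R g"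
    using compact_hermitian_eigenbasis[OF bX hX compact_op_minus[OF cone_compact[OF A] cone_compact[OF B]]]
    by metis
  have \<mu>: "\<mu> g = qform A g - qform B g" if "g \<in> G" for g
    using qform_eigenvector[of g ?X, OF _ G(2)[OF that]] orthonormal_norm[OF is_onb_orthonormal[OF G(1)] that]
    by (simp add: qform_minus)
  have "((\<lambda>g. qform A g - qform B g) has_sum (rtrace A - rtrace B)) G"
    using has_sum_add[OF cone_has_sum_rtrace[OF A G(1)] has_sum_uminusI[OF cone_has_sum_rtrace[OF B G(1)]]]
    by simp
  then have sum\<mu>: "(\<mu> has_sum (rtrace A - rtrace B)) G"
    by (rule has_sum_cong[THEN iffD2, rotated]) (rule \<mu>)
  have abs: "\<bar>\<mu> g\<bar> \<le> qform A g + qform B g" if "g \<in> G" for g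
    using \<mu>[OF that] positive_op_nonneg[OF pA, of g] positive_op_nonneg[OF pB, of g] by linarith
  have "\<bar>\<mu> g\<bar> \<le> rtrace A + rtrace B" if "g \<in> G" for g
    using abs[OF that] qform_le_rtrace[OF A, of g] qform_le_rtrace[OF B, of g]
      orthonormal_norm[OF is_onb_orthonormal[OF G(1)] that] by simp
  then obtain N where N: "positive_op N" "\<And>g. g \<in> G \<Longrightarrow> N g = \<bar>\<mu> g\<bar> *\<^sub>R g"
    "\<And>x g. g \<in> G \<Longrightarrow> cinner g (N x) = \<bar>\<mu> g\<bar> * cinner g x"
    using diagonal_operator[OF G(1), of "\<lambda>g. \<bar>\<mu> g\<bar>" "rtrace A + rtrace B"] by auto
  have cX: "cinner g (?X x) = \<mu> g * cinner g x" if "g \<in> G" for g x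
    using hermitianD[OF hX, of g x] G(2)[OF that] by (simp add: cinner_scaleR_left)
  have "N (N x) = ?X (?X x)" for x
  proof (rule onb_eqI[OF G(1)])
    fix g assume g: "g \<in> G"
    have "cinner g (N (N x)) = complex_of_real (\<bar>\<mu> g\<bar> * \<bar>\<mu> g\<bar>) * cinner g x"
      by (simp only: N(3)[OF g] mult.assoc of_real_mult)
    also have "\<dots> = complex_of_real (\<mu> g * \<mu> g) * cinner g x"
      by (simp only: abs_mult_self_eq)
    also have "\<dots> = cinner g (?X (?X x))"
      by (simp only: cX[OF g] mult.assoc of_real_mult)
    finally show "cinner g (N (N x)) = cinner g (?X (?X x))" .
  qed
  then have absX: "abs_op ?X = N"
    by (rule abs_op_eqI[OF hX N(1)])
  have "(\<lambda>g. qform A g + qform B g) summable_on G"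
    using has_sum_add[OF cone_has_sum_rtrace[OF A G(1)] cone_has_sum_rtrace[OF B G(1)]]
    by (rule has_sum_imp_summable)
  then have "(\<lambda>g. \<bar>\<mu> g\<bar>) summable_on G"
    by (rule summable_on_comparison_test) (use abs in auto)
  then obtain t where t: "((\<lambda>g. \<bar>\<mu> g\<bar>) has_sum t) G"
    unfolding summable_on_def by blast
  have "(qform N has_sum t) some_onb"
    by (rule diagonal_has_sum_eigenvalue_sum[OF N(1) G(1) N(2) t is_onb_some_onb])
  then have "((\<lambda>e. complex_of_real (qform N e)) has_sum complex_of_real t) some_onb"
    by (rule has_sum_of_real)
  then have "op_trace N = complex_of_real t"
    unfolding op_trace_def some_onb_def[symmetric] positive_op_cinner[OF N(1)] by (rule infsumI)
  then have "tdist A B = t"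
    by (simp add: tdist_def trace_norm_def absX)
  with G t sum\<mu> show thesis using that by blast
qed

text \<open>The trace distance as a one-sided supremum over finite orthonormal sets: with
  \<open>X = A - B\<close> one has \<open>\<parallel>X\<parallel>\<^sub>1 = 2 Tr X\<^sub>+ - Tr X\<close>, and \<open>Tr X\<^sub>+\<close> is the supremum of
  \<open>\<Sum>\<^sub>s \<langle>s, Xs\<rangle>\<close>. Apart from symmetry, the metric
  estimates below rest on this formula.\<close>

lemma tdist_le_iff:
  assumes A: "A \<in> trace_class_cone" and B: "B \<in> trace_class_cone"
  shows "tdist A B \<le> c \<longleftrightarrow>
    (\<forall>S. orthonormal S \<and> finite S \<longrightarrow>
       2 * (\<Sum>s\<in>S. qform A s - qform B s) - rtrace A + rtrace B \<le> c)"
proof -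
  let ?X = "\<lambda>x. A x - B x"
  have bX: "bounded_clinear ?X"
    using A B by (auto intro: bounded_clinear_minus positive_op_bounded_clinear cone_positive)
  obtain G \<mu> where G: "is_onb G" "\<And>g. g \<in> G \<Longrightarrow> A g - B g = \<mu> g *\<^sub>R g"
    and abs: "((\<lambda>g. \<bar>\<mu> g\<bar>) has_sum tdist A B) G" and tr: "(\<mu> has_sum (rtrace A - rtrace B)) G"
    using difference_eigenbasis[OF A B] by metis
  note oG = is_onb_orthonormal[OF G(1)]
  have both: "((\<lambda>g. \<bar>\<mu> g\<bar> + \<mu> g) has_sum (tdist A B + (rtrace A - rtrace B))) G"
    by (rule has_sum_add[OF abs tr])
  show ?thesis
  proof (intro iffI allI impI)
    fix S :: "'a set" assume le: "tdist A B \<le> c" and S: "orthonormal S \<and> finite S"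
    have "((\<lambda>g. 2 * (\<mu> g * (\<Sum>s\<in>S. (cmod (cinner s g))\<^sup>2))) has_sum 2 * (\<Sum>s\<in>S. qform ?X s)) G"
      by (intro has_sum_cmult_right sum_qform_eigenbasis_has_sum bX G)
    then have "2 * (\<Sum>s\<in>S. qform ?X s) \<le> tdist A B + (rtrace A - rtrace B)"
    proof (rule has_sum_mono[OF _ both])
      fix g assume g: "g \<in> G"
      \<comment> \<open>the diagonal entry at \<open>g\<close> of the projection onto the span of \<open>S\<close>\<close>
      let ?w = "\<Sum>s\<in>S. (cmod (cinner s g))\<^sup>2"
      have w: "0 \<le> ?w" "?w \<le> 1"
        using bessel[of S g] S orthonormal_norm[OF oG g] by (auto intro: sum_nonneg)
      show "2 * (\<mu> g * ?w) \<le> \<bar>\<mu> g\<bar> + \<mu> g"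
      proof (cases "\<mu> g \<ge> 0")
        case True
        then show ?thesis using mult_left_mono[OF w(2) True] by simp
      next
        case False
        then show ?thesis using w(1) by (simp add: mult_nonpos_nonneg)
      qed
    qed
    then show "2 * (\<Sum>s\<in>S. qform A s - qform B s) - rtrace A + rtrace B \<le> c"
      using le by (simp add: qform_minus)
  next
    assume *: "\<forall>S. orthonormal S \<and> finite S \<longrightarrow>
       2 * (\<Sum>s\<in>S. qform A s - qform B s) - rtrace A + rtrace B \<le> c"
    have "tdist A B + (rtrace A - rtrace B) \<le> c + (rtrace A - rtrace B)"
    proof (rule has_sum_le_finite_sums[OF both])
      fix F assume F: "finite F" "F \<subseteq> G"
      \<comment> \<open>the finite part of the positive spectral subspace that sees \<open>F\<close>\<close>
      let ?S = "{g\<in>F. \<mu> g > 0}"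
      have S: "orthonormal ?S" "finite ?S"
        using F by (auto intro: orthonormal_subset[OF oG])
      have "(\<Sum>g\<in>F. \<bar>\<mu> g\<bar> + \<mu> g) = (\<Sum>g\<in>?S. \<bar>\<mu> g\<bar> + \<mu> g)"
        by (rule sum.mono_neutral_right) (use F in auto)
      also have "\<dots> = (\<Sum>g\<in>?S. 2 * (qform A g - qform B g))"
      proof (rule sum.cong)
        fix g assume g: "g \<in> ?S"
        then have "qform ?X g = \<mu> g"
          using F by (intro qform_eigenvector G(2) orthonormal_norm[OF oG]) auto
        then show "\<bar>\<mu> g\<bar> + \<mu> g = 2 * (qform A g - qform B g)"
          using g by (simp add: qform_minus)
      qed simp
      also have "\<dots> \<le> c + (rtrace A - rtrace B)"
        using *[rule_format, of ?S] S unfolding sum_distrib_left[symmetric] by linarith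
      finally show "(\<Sum>g\<in>F. \<bar>\<mu> g\<bar> + \<mu> g) \<le> c + (rtrace A - rtrace B)" .
    qed
    then show "tdist A B \<le> c" by simp
  qed
qed

lemma tdist_commute:
  assumes "A \<in> trace_class_cone" "B \<in> trace_class_cone"
  shows "tdist A B = tdist B A"
proof -
  let ?X = "\<lambda>x. A x - B x" and ?Y = "\<lambda>x. B x - A x"
  note p = cone_positive[OF assms(1)] cone_positive[OF assms(2)]
  note b = p[THEN positive_op_bounded_clinear] and h = p[THEN positive_op_hermitian]
  have "?X \<circ> ?X = ?Y \<circ> ?Y"
    by (rule ext) (simp add: b[THEN bounded_clinear_diff])
  then have "abs_op ?X = abs_op ?Y"
    unfolding abs_op_def adj_op_hermitian[OF hermitian_minus[OF h]]
      adj_op_hermitian[OF hermitian_minus[OF h(2,1)]] by simp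
  then show ?thesis
    by (simp add: tdist_def trace_norm_def)
qed

lemma tdist_ge:
  assumes "A \<in> trace_class_cone" "B \<in> trace_class_cone" "orthonormal S" "finite S"
  shows "2 * (\<Sum>s\<in>S. qform A s - qform B s) - rtrace A + rtrace B \<le> tdist A B"
  using tdist_le_iff[OF assms(1,2), of "tdist A B"] assms(3,4) by blast

lemma tdist_leI:
  assumes "A \<in> trace_class_cone" "B \<in> trace_class_cone"
    and "\<And>S. orthonormal S \<Longrightarrow> finite S \<Longrightarrow>
      2 * (\<Sum>s\<in>S. qform A s - qform B s) - rtrace A + rtrace B \<le> c"
  shows "tdist A B \<le> c"
  using tdist_le_iff[OF assms(1,2)] assms(3) by blast

lemma rtrace_diff_le_tdist:
  assumes "A \<in> trace_class_cone" "B \<in> trace_class_cone"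
  shows "\<bar>rtrace A - rtrace B\<bar> \<le> tdist A B"
  using tdist_ge[OF assms, of "{}"] tdist_ge[OF assms(2,1), of "{}"] tdist_commute[OF assms] by simp

lemma tdist_nonneg:
  assumes "A \<in> trace_class_cone" "B \<in> trace_class_cone"
  shows "0 \<le> tdist A B"
  using rtrace_diff_le_tdist[OF assms] by linarith

lemma qform_diff_le_tdist:
  assumes A: "A \<in> trace_class_cone" and B: "B \<in> trace_class_cone" and x: "norm x = 1"
  shows "qform A x \<le> qform B x + tdist A B"
proof -
  have "orthonormal {x}" using x by simp
  from tdist_ge[OF A B this] rtrace_diff_le_tdist[OF A B] show ?thesis
    by (simp del: orthonormal_singleton)
qed

lemma tdist_triangle:
  assumes A: "A \<in> trace_class_cone" and B: "B \<in> trace_class_cone" and C: "C \<in> trace_class_cone"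
  shows "tdist A C \<le> tdist A B + tdist B C"
proof (rule tdist_leI[OF A C])
  fix S :: "'a set" assume "orthonormal S" "finite S"
  from tdist_ge[OF A B this] tdist_ge[OF B C this]
  show "2 * (\<Sum>s\<in>S. qform A s - qform C s) - rtrace A + rtrace C \<le> tdist A B + tdist B C"
    by (simp add: sum_subtractf)
qed

lemma tdist_zero:
  assumes A: "A \<in> trace_class_cone"
  shows "tdist A (\<lambda>x. 0) = rtrace A"
proof (rule antisym)
  show "tdist A (\<lambda>x. 0) \<le> rtrace A"
  proof (rule tdist_leI[OF A cone_zero(1)])
    fix S :: "'a set" assume "orthonormal S" "finite S"
    from sum_qform_le_rtrace[OF A this]
    show "2 * (\<Sum>s\<in>S. qform A s - qform (\<lambda>x. 0) s) - rtrace A + rtrace (\<lambda>x::'a. 0::'a) \<le> rtrace A"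
      by (simp add: cone_zero(2) qform_def)
  qed
  show "rtrace A \<le> tdist A (\<lambda>x. 0)"
    using rtrace_diff_le_tdist[OF A cone_zero(1)] by (simp add: cone_zero(2))
qed

lemma tdist_real_scale_le:
  assumes A: "A \<in> trace_class_cone" and B: "B \<in> trace_class_cone" and r: "0 \<le> r"
  shows "tdist (\<lambda>x. r *\<^sub>R A x) (\<lambda>x. r *\<^sub>R B x) \<le> r * tdist A B"
proof (rule tdist_leI)
  fix S :: "'a set" assume "orthonormal S" "finite S"
  from mult_left_mono[OF tdist_ge[OF A B this] r]
  have "r * (2 * (\<Sum>s\<in>S. qform A s - qform B s) - rtrace A + rtrace B) \<le> r * tdist A B" .
  moreover have "(\<Sum>s\<in>S. qform (\<lambda>x. r *\<^sub>R A x) s - qform (\<lambda>x. r *\<^sub>R B x) s)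
      = r * (\<Sum>s\<in>S. qform A s - qform B s)"
    by (simp add: qform_real_scale sum_distrib_left right_diff_distrib)
  ultimately
  show "2 * (\<Sum>s\<in>S. qform (\<lambda>x. r *\<^sub>R A x) s - qform (\<lambda>x. r *\<^sub>R B x) s)
      - rtrace (\<lambda>x. r *\<^sub>R A x) + rtrace (\<lambda>x. r *\<^sub>R B x) \<le> r * tdist A B"
    by (simp add: cone_real_scale(2)[OF A r] cone_real_scale(2)[OF B r] distrib_left right_diff_distrib)
qed (use cone_real_scale A B r in auto)

lemma tdist_shrink_le:
  assumes A: "A \<in> trace_class_cone" and r: "0 \<le> r" "r \<le> 1"
  shows "tdist A (\<lambda>x. r *\<^sub>R A x) \<le> (1 - r) * rtrace A"
proof (rule tdist_leI[OF A cone_real_scale(1)[OF A r(1)]])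
  fix S :: "'a set" assume S: "orthonormal S" "finite S"
  have "(\<Sum>s\<in>S. qform A s - qform (\<lambda>x. r *\<^sub>R A x) s) = (1 - r) * sum (qform A) S"
    by (simp add: qform_real_scale sum_subtractf sum_distrib_left left_diff_distrib)
  also have "\<dots> \<le> (1 - r) * rtrace A"
    using r by (intro mult_left_mono sum_qform_le_rtrace A S) simp
  finally show "2 * (\<Sum>s\<in>S. qform A s - qform (\<lambda>x. r *\<^sub>R A x) s) - rtrace A
      + rtrace (\<lambda>x. r *\<^sub>R A x) \<le> (1 - r) * rtrace A"
    by (simp add: cone_real_scale(2)[OF A r(1)] algebra_simps)
qed

text \<open>If \<open>B \<le> A + Y\<close>, then \<open>Tr (B - A)\<^sub>+ \<le> Tr Y\<close>, which bounds the distance.\<close>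

lemma tdist_le_of_majorant:
  assumes A: "A \<in> trace_class_cone" and B: "B \<in> trace_class_cone" and Y: "Y \<in> trace_class_cone"
    and le: "\<And>x. qform B x \<le> qform A x + qform Y x"
  shows "tdist A B \<le> rtrace A - rtrace B + 2 * rtrace Y"
  unfolding tdist_commute[OF A B]
proof (rule tdist_leI[OF B A])
  fix S :: "'a set" assume S: "orthonormal S" "finite S"
  have "(\<Sum>s\<in>S. qform B s - qform A s) \<le> sum (qform Y) S"
    using le by (intro sum_mono) (simp add: algebra_simps)
  also have "\<dots> \<le> rtrace Y"
    by (rule sum_qform_le_rtrace[OF Y S])
  finally show "2 * (\<Sum>s\<in>S. qform B s - qform A s) - rtrace B + rtrace A
      \<le> rtrace A - rtrace B + 2 * rtrace Y" by simp
qed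

text \<open>Conversely, distance and traces bound the part of \<open>A\<close> that exceeds \<open>B\<close>.\<close>

lemma sum_qform_le_add_tdist:
  assumes "A \<in> trace_class_cone" "B \<in> trace_class_cone" "orthonormal S" "finite S"
    and "tdist A B \<le> rtrace B - rtrace A + 2 * c"
  shows "sum (qform A) S \<le> sum (qform B) S + c"
  using tdist_ge[OF assms(1-4)] assms(5) by (simp add: sum_subtractf)

section \<open>Finite-rank projections and their complements\<close>

lemma bounded_clinear_coord_sum:
  assumes "orthonormal S" "finite S"
  shows "bounded_clinear (coord_sum S)"
proof (rule bounded_clinearI[of _ 1])
  show "coord_sum S (x + y) = coord_sum S x + coord_sum S y" for x y
    by (simp add: coord_sum_def cinner_add_right scaleC_add_left sum.distrib)
  show "coord_sum S (c *\<^sub>C x) = c *\<^sub>C coord_sum S x" for c x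
    by (simp add: coord_sum_def cinner_scaleC_right cvec.scale_sum_right)
  show "norm (coord_sum S x) \<le> 1 * norm x" for x
  proof (rule power2_le_imp_le)
    show "(norm (coord_sum S x))\<^sup>2 \<le> (1 * norm x)\<^sup>2"
      unfolding coord_sum_def norm_sum_orthonormal[OF assms] using bessel[OF assms] by simp
  qed simp
qed

lemma hermitian_coord_sum: "hermitian (coord_sum S)"
  unfolding hermitian_def
proof (intro allI)
  fix x y
  have "cinner (coord_sum S x) y = (\<Sum>e\<in>S. cnj (cinner e x) * cinner e y)"
    by (simp add: coord_sum_def cinner_sum_left cinner_scaleC_left)
  also have "\<dots> = (\<Sum>e\<in>S. cinner e y * cinner x e)"
    by (rule sum.cong) (simp_all add: cinner_commute[of x] mult.commute)
  also have "\<dots> = cinner x (coord_sum S y)"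
    by (simp add: coord_sum_def cinner_sum_right cinner_scaleC_right)
  finally show "cinner (coord_sum S x) y = cinner x (coord_sum S y)" .
qed

lemma qform_coord_sum: "qform (coord_sum S) x = (\<Sum>s\<in>S. (cmod (cinner s x))\<^sup>2)"
proof -
  have "qform (coord_sum S) x = (\<Sum>s\<in>S. Re (cinner s x * cinner x s))"
    by (simp add: qform_def coord_sum_def cinner_sum_right cinner_scaleC_right)
  also have "\<dots> = (\<Sum>s\<in>S. (cmod (cinner s x))\<^sup>2)"
    by (rule sum.cong)
      (simp_all add: cinner_commute[of x] complex_mult_cnj cmod_power2 del: times_complex.sel)
  finally show ?thesis .
qed

lemma coord_sum_mem:
  assumes "orthonormal E" "S \<subseteq> E" "finite S" "e \<in> E"
  shows "coord_sum S e = (if e \<in> S then e else 0)"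
proof -
  have "coord_sum S e = (\<Sum>s\<in>S. if s = e then e else 0)"
    unfolding coord_sum_def
    by (rule sum.cong) (use assms in \<open>auto simp: orthonormal_cinner[OF assms(1)] subset_iff\<close>)
  then show ?thesis using assms(3) by simp
qed

definition scaled_proj :: "real \<Rightarrow> 'a::chilbert_space set \<Rightarrow> 'a \<Rightarrow> 'a" where
  "scaled_proj t S = (\<lambda>x. t *\<^sub>R coord_sum S x)"

lemma qform_scaled_proj: "qform (scaled_proj t S) x = t * (\<Sum>s\<in>S. (cmod (cinner s x))\<^sup>2)"
  by (simp add: scaled_proj_def qform_real_scale qform_coord_sum)

lemma coord_sum_cone:
  fixes S :: "'a::chilbert_space set"
  assumes "orthonormal S" "finite S"
  shows "coord_sum S \<in> trace_class_cone" "rtrace (coord_sum S) = card S"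
proof -
  have pos: "positive_op (coord_sum S)"
    using assms by (intro positive_opI bounded_clinear_coord_sum hermitian_coord_sum)
      (auto simp: qform_coord_sum intro: sum_nonneg)
  obtain E where E: "S \<subseteq> E" "is_onb E"
    using orthonormal_extends_to_onb[OF assms(1)] by blast
  note oE = is_onb_orthonormal[OF E(2)]
  have val: "qform (coord_sum S) e = (if e \<in> S then 1 else 0)" if "e \<in> E" for e
    using that by (simp add: qform_def coord_sum_mem[OF oE E(1) assms(2)] orthonormal_cinner[OF oE])
  have "(qform (coord_sum S) has_sum real (card S)) E"
  proof (rule has_sum_finite_neutralI[OF assms(2) E(1)])
    have "sum (qform (coord_sum S)) S = (\<Sum>e\<in>S. 1)"
      by (rule sum.cong) (use val E(1) in auto)
    then show "real (card S) = sum (qform (coord_sum S)) S" by simp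
  qed (use val in auto)
  from coneI[OF pos E(2) this]
  show "coord_sum S \<in> trace_class_cone" "rtrace (coord_sum S) = card S" by blast+
qed

lemma scaled_proj_cone:
  assumes "orthonormal S" "finite S" "0 \<le> t"
  shows "scaled_proj t S \<in> trace_class_cone" "rtrace (scaled_proj t S) = t * card S"
  unfolding scaled_proj_def
  using cone_real_scale[OF coord_sum_cone(1)[OF assms(1,2)] assms(3)] coord_sum_cone(2)[OF assms(1,2)]
  by auto

text \<open>With \<open>P\<close> the projection onto the span of \<open>S\<close>, the diagonal block \<open>(1 - P)B(1 - P)\<close>.\<close>

definition off_corner :: "('a::chilbert_space \<Rightarrow> 'a) \<Rightarrow> 'a set \<Rightarrow> 'a \<Rightarrow> 'a" where
  "off_corner B S = (\<lambda>x. B (x - coord_sum S x) - coord_sum S (B (x - coord_sum S x)))"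

lemma qform_off_corner: "qform (off_corner B S) x = qform B (x - coord_sum S x)"
  using hermitianD[OF hermitian_coord_sum, of S x]
  by (simp add: qform_def off_corner_def cinner_diff_left cinner_diff_right)

lemma off_corner_cone:
  assumes S: "orthonormal S" "finite S" and B: "B \<in> trace_class_cone"
  shows "off_corner B S \<in> trace_class_cone" "rtrace (off_corner B S) = rtrace B - sum (qform B) S"
proof -
  note pB = cone_positive[OF B]
  note bB = positive_op_bounded_clinear[OF pB] and bS = bounded_clinear_coord_sum[OF S]
  have bC: "bounded_clinear (\<lambda>x. x - coord_sum S x)"
    by (rule bounded_clinear_minus[OF _ bS]) (rule bounded_clinearI[of _ 1], auto)
  have pos: "positive_op (off_corner B S)"
  proof (rule positive_opI)
    show "bounded_clinear (off_corner B S)"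
      using bounded_clinear_compose[OF bC bounded_clinear_compose[OF bB bC]]
      by (simp add: off_corner_def)
    show "hermitian (off_corner B S)"
      unfolding hermitian_def off_corner_def
      by (simp add: cinner_diff_left cinner_diff_right hermitianD[OF hermitian_coord_sum]
          hermitianD[OF positive_op_hermitian[OF pB]] bounded_clinear_diff[OF bB]
          bounded_clinear_diff[OF bS])
    show "0 \<le> qform (off_corner B S) x" for x
      unfolding qform_off_corner by (rule positive_op_nonneg[OF pB])
  qed
  obtain E where E: "S \<subseteq> E" "is_onb E"
    using orthonormal_extends_to_onb[OF S(1)] by blast
  note oE = is_onb_orthonormal[OF E(2)]
  have "((\<lambda>e. if e \<in> S then - qform B e else 0) has_sum - sum (qform B) S) E"
    by (rule has_sum_finite_neutralI[OF S(2) E(1)]) (auto simp: sum_negf)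
  from has_sum_add[OF cone_has_sum_rtrace[OF B E(2)] this]
  have "((\<lambda>e. qform B e + (if e \<in> S then - qform B e else 0)) has_sum (rtrace B - sum (qform B) S)) E"
    by simp
  moreover have "qform B e + (if e \<in> S then - qform B e else 0) = qform (off_corner B S) e" if "e \<in> E" for e
    unfolding qform_off_corner coord_sum_mem[OF oE E(1) S(2) that]
    by (simp add: qform_def)
  ultimately have "(qform (off_corner B S) has_sum (rtrace B - sum (qform B) S)) E"
    using has_sum_cong by (metis (no_types, lifting))
  from coneI[OF pos E(2) this]
  show "off_corner B S \<in> trace_class_cone" "rtrace (off_corner B S) = rtrace B - sum (qform B) S"
    by blast+
qed

lemma norm_coord_sum_sq:
  assumes "orthonormal S" "finite S"
  shows "(norm (coord_sum S x))\<^sup>2 = qform (coord_sum S) x"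
  unfolding qform_coord_sum coord_sum_def norm_sum_orthonormal[OF assms] ..

text \<open>The off-diagonal blocks of a positive operator are dominated by its two diagonal blocks: one of
  them can be kept almost unchanged if the other one is enlarged enough. The block on the span of \<open>S\<close> is in
  turn at most \<open>M\<close> times the projection.\<close>

lemma qform_pinching_le:
  assumes B: "B \<in> trace_class_cone" and \<eta>: "\<eta> > 0" and M: "\<And>x. qform B x \<le> M * (norm x)\<^sup>2"
    and S: "orthonormal S" "finite S"
  shows "qform B x \<le> (1 + \<eta>) * M * qform (coord_sum S) x + (1 + 1 / \<eta>) * qform (off_corner B S) x"
proof -
  have "qform B (coord_sum S x + (x - coord_sum S x))
      \<le> (1 + \<eta>) * qform B (coord_sum S x) + (1 + 1 / \<eta>) * qform B (x - coord_sum S x)"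
    by (rule qform_add_le[OF cone_positive[OF B] \<eta>])
  also have "(1 + \<eta>) * qform B (coord_sum S x) \<le> (1 + \<eta>) * (M * (norm (coord_sum S x))\<^sup>2)"
    using \<eta> M by (intro mult_left_mono) auto
  finally show ?thesis
    by (simp add: norm_coord_sum_sq[OF S] qform_off_corner mult.assoc)
qed

text \<open>This is small when the span of \<open>S\<close> almost exhausts the trace of \<open>Q\<close> and that trace is almost the largest
  possible one, \<open>M \<cdot> card S\<close>. The majorant \<open>Y\<close> collects what pinching adds to \<open>M\<close> times the projection.\<close>

lemma tdist_scaled_proj_le:
  assumes Q: "Q \<in> trace_class_cone" and \<eta>: "\<eta> > 0" and M: "0 \<le> M" "\<And>x. qform Q x \<le> M * (norm x)\<^sup>2"
    and S: "orthonormal S" "finite S"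
  shows "tdist (scaled_proj M S) Q
    \<le> M * card S - rtrace Q + 2 * (\<eta> * M * card S + (1 + 1 / \<eta>) * (rtrace Q - sum (qform Q) S))"
proof -
  define Y where "Y = (\<lambda>x. (\<eta> * M) *\<^sub>R coord_sum S x + (1 + 1 / \<eta>) *\<^sub>R off_corner Q S x)"
  have nn: "0 \<le> \<eta> * M" "0 \<le> 1 + 1 / \<eta>" using M \<eta> by auto
  note c1 = cone_real_scale[OF coord_sum_cone(1)[OF S] nn(1)]
  note c2 = cone_real_scale[OF off_corner_cone(1)[OF S Q] nn(2)]
  have Y: "Y \<in> trace_class_cone"
    "rtrace Y = \<eta> * M * card S + (1 + 1 / \<eta>) * (rtrace Q - sum (qform Q) S)"
    unfolding Y_def using cone_plus[OF c1(1) c2(1)] c1(2) c2(2) coord_sum_cone(2)[OF S]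
      off_corner_cone(2)[OF S Q] by auto
  have "qform Q x \<le> qform (scaled_proj M S) x + qform Y x" for x
  proof -
    have "qform Y x = \<eta> * M * qform (coord_sum S) x + (1 + 1 / \<eta>) * qform (off_corner Q S) x"
      by (simp only: Y_def qform_plus qform_real_scale)
    moreover have "qform (scaled_proj M S) x = M * qform (coord_sum S) x"
      by (simp only: scaled_proj_def qform_real_scale)
    ultimately show ?thesis
      using qform_pinching_le[OF Q \<eta> M(2) S, of x] by (simp add: algebra_simps)
  qed
  from tdist_le_of_majorant[OF scaled_proj_cone(1)[OF S M(1)] Q Y(1) this]
  show ?thesis
    by (simp add: Y(2) scaled_proj_cone(2)[OF S M(1)])
qed

text \<open>Along the ray through a projection \<open>P\<close> the distance to \<open>B\<close> determines the trace of \<open>PB\<close>: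
  \<open>\<parallel>rP - B\<parallel>\<^sub>1 - r Tr P\<close> is at least \<open>Tr B - 2 Tr PB\<close> and tends to it.\<close>

lemma ray_tdist_ge:
  fixes r :: real
  assumes B: "B \<in> trace_class_cone" and S: "orthonormal S" "finite S" and r: "0 \<le> r"
  shows "r * card S + rtrace B - 2 * sum (qform B) S \<le> tdist (scaled_proj r S) B"
proof -
  have "qform (scaled_proj r S) s = r" if "s \<in> S" for s
    using that by (simp add: qform_def scaled_proj_def coord_sum_mem[OF S(1) subset_refl S(2)]
        cinner_scaleR_right orthonormal_cinner[OF S(1)])
  then have "(\<Sum>s\<in>S. qform (scaled_proj r S) s - qform B s) = r * card S - sum (qform B) S"
    by (simp add: sum_subtractf)
  then show ?thesis
    using tdist_ge[OF scaled_proj_cone(1)[OF S r] B S] scaled_proj_cone(2)[OF S r] by simp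
qed

lemma ray_tdist_le:
  assumes B: "B \<in> trace_class_cone" and S: "orthonormal S" "finite S" and \<kappa>: "\<kappa> > 0"
  obtains r where "r > 0" "tdist (scaled_proj r S) B \<le> r * card S + rtrace B - 2 * sum (qform B) S + \<kappa>"
proof -
  define c where "c = rtrace B - sum (qform B) S"
  have c: "0 \<le> c" unfolding c_def using sum_qform_le_rtrace[OF B S] by simp
  \<comment> \<open>chosen so that \<open>2\<eta>c \<le> \<kappa>\<close>; the height \<open>r\<close> then absorbs the block on the span of \<open>S\<close>, which pinching
    enlarges by \<open>1 + 1 / \<eta>\<close>\<close>
  define \<eta> where "\<eta> = \<kappa> / (2 * (c + 1))"
  have \<eta>: "\<eta> > 0" using \<kappa> c by (simp add: \<eta>_def)
  define r where "r = (1 + 1 / \<eta>) * rtrace B + 1"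
  have trB: "0 \<le> (1 + 1 / \<eta>) * rtrace B" using rtrace_nonneg[OF B] \<eta> by simp
  then have r: "r > 0" by (simp add: r_def)
  define Y where "Y = (\<lambda>x. (1 + \<eta>) *\<^sub>R off_corner B S x)"
  have nn: "0 \<le> 1 + \<eta>" using \<eta> by simp
  have Y: "Y \<in> trace_class_cone" "rtrace Y = (1 + \<eta>) * c"
    unfolding Y_def c_def using cone_real_scale[OF off_corner_cone(1)[OF S B] nn] off_corner_cone(2)[OF S B]
    by auto
  have "qform B x \<le> qform (scaled_proj r S) x + qform Y x" for x
  proof -
    have "qform B x \<le> (1 + 1 / \<eta>) * rtrace B * qform (coord_sum S) x + (1 + 1 / (1 / \<eta>)) * qform (off_corner B S) x"
      by (rule qform_pinching_le[OF B _ qform_le_rtrace[OF B] S]) (use \<eta> in simp)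
    also have "(1 + 1 / \<eta>) * rtrace B * qform (coord_sum S) x \<le> r * qform (coord_sum S) x"
      by (rule mult_right_mono) (simp_all add: r_def qform_coord_sum sum_nonneg)
    finally show ?thesis
      by (simp add: Y_def scaled_proj_def qform_real_scale)
  qed
  from tdist_le_of_majorant[OF scaled_proj_cone(1)[OF S less_imp_le[OF r]] B Y(1) this]
  have "tdist (scaled_proj r S) B \<le> r * card S - rtrace B + 2 * ((1 + \<eta>) * c)"
    by (simp add: Y(2) scaled_proj_cone(2)[OF S less_imp_le[OF r]])
  also have "\<dots> = r * card S + rtrace B - 2 * sum (qform B) S + 2 * \<eta> * c"
    by (simp add: c_def algebra_simps)
  also have "2 * \<eta> * c \<le> \<kappa>"
  proof -
    have "2 * \<eta> * c = \<kappa> * (c / (c + 1))"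
      using c by (simp add: \<eta>_def field_simps)
    also have "\<dots> \<le> \<kappa> * 1"
      using \<kappa> c by (intro mult_left_mono) (auto simp: field_simps)
    finally show ?thesis by simp
  qed
  finally show thesis using that[OF r] by simp
qed

instance chilbert_space \<subseteq> banach ..

section \<open>Rays of projections\<close>

lemma sum_orthonormal_weights_le:
  assumes "orthonormal R" "finite R" "orthonormal S"
  shows "(\<Sum>r\<in>R. \<Sum>s\<in>S. (cmod (cinner s r))\<^sup>2) \<le> card S"
proof -
  have "(\<Sum>r\<in>R. \<Sum>s\<in>S. (cmod (cinner s r))\<^sup>2) = (\<Sum>s\<in>S. \<Sum>r\<in>R. (cmod (cinner r s))\<^sup>2)"
    by (subst sum.swap) (simp add: cmod_cinner_commute)
  also have "\<dots> \<le> (\<Sum>s\<in>S. 1)"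
  proof (rule sum_mono)
    fix s assume "s \<in> S"
    then show "(\<Sum>r\<in>R. (cmod (cinner r s))\<^sup>2) \<le> 1"
      using bessel[OF assms(1,2), of s] orthonormal_norm[OF assms(3)] by simp
  qed
  finally show ?thesis by simp
qed

lemma tdist_scaled_proj_scaled_proj_le:
  fixes S :: "'a::chilbert_space set"
  assumes S: "orthonormal S" "finite S" and ab: "0 \<le> a" "0 \<le> b"
  shows "tdist (scaled_proj a S) (scaled_proj b S) \<le> \<bar>a - b\<bar> * card S"
proof (rule tdist_leI)
  fix R :: "'a set" assume R: "orthonormal R" "finite R"
  let ?w = "\<Sum>r\<in>R. \<Sum>s\<in>S. (cmod (cinner s r))\<^sup>2"
  have w: "0 \<le> ?w" "?w \<le> card S"
    using sum_orthonormal_weights_le[OF R S(1)] by (auto intro!: sum_nonneg)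
  have "(\<Sum>r\<in>R. qform (scaled_proj a S) r - qform (scaled_proj b S) r) = (a - b) * ?w"
    by (simp add: qform_scaled_proj sum_subtractf sum_distrib_left left_diff_distrib)
  moreover have "2 * ((a - b) * ?w) \<le> \<bar>a - b\<bar> * card S + (a - b) * card S"
  proof (cases "a \<ge> b")
    case True
    then show ?thesis using mult_left_mono[OF w(2), of "a - b"] by simp
  next
    case False
    then have "(a - b) * ?w \<le> 0" using w(1) by (simp add: mult_nonpos_nonneg)
    moreover have "\<bar>a - b\<bar> * card S + (a - b) * card S = 0"
      using False by (simp add: algebra_simps)
    ultimately show ?thesis by linarith
  qed
  ultimately show "2 * (\<Sum>r\<in>R. qform (scaled_proj a S) r - qform (scaled_proj b S) r)
      - rtrace (scaled_proj a S) + rtrace (scaled_proj b S) \<le> \<bar>a - b\<bar> * card S"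
    by (simp add: scaled_proj_cone(2)[OF S] ab left_diff_distrib)
qed (use scaled_proj_cone S ab in auto)

lemma cone_diff:
  assumes A: "A \<in> trace_class_cone" and B: "B \<in> trace_class_cone" and le: "\<And>x. qform B x \<le> qform A x"
  shows "(\<lambda>x. A x - B x) \<in> trace_class_cone" "rtrace (\<lambda>x. A x - B x) = rtrace A - rtrace B"
proof -
  note pA = cone_positive[OF A] and pB = cone_positive[OF B]
  have pos: "positive_op (\<lambda>x. A x - B x)"
    using pA pB le by (intro positive_opI bounded_clinear_minus hermitian_minus)
      (auto simp: positive_op_bounded_clinear positive_op_hermitian qform_minus)
  have "(qform (\<lambda>x. A x - B x) has_sum (rtrace A - rtrace B)) some_onb"
    unfolding qform_minus
    using has_sum_add[OF cone_has_sum_rtrace[OF A is_onb_some_onb]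
        has_sum_uminusI[OF cone_has_sum_rtrace[OF B is_onb_some_onb]]]
    by simp
  from coneI[OF pos is_onb_some_onb this]
  show "(\<lambda>x. A x - B x) \<in> trace_class_cone" "rtrace (\<lambda>x. A x - B x) = rtrace A - rtrace B"
    by blast+
qed

text \<open>\<open>Q\<close> is asymptotic, with relative error tending to \<open>0\<close>, to the ray through the projection onto the span of
  \<open>S\<close>. Sampling the heights \<open>4\<^sup>n\<close> suffices, and makes errors of the order of the square root of the height
  decay geometrically.\<close>

definition ray_to :: "(nat \<Rightarrow> 'a::chilbert_space \<Rightarrow> 'a) \<Rightarrow> 'a set \<Rightarrow> bool" where
  "ray_to Q S \<longleftrightarrow> (\<lambda>n. tdist (Q n) (scaled_proj (4 ^ n) S) / 4 ^ n) \<longlonglongrightarrow> 0"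

text \<open>The bounds of \<open>tdist_scaled_proj_le\<close> have relative size \<open>2\<eta> card S\<close> in the limit, for every \<open>\<eta> > 0\<close>.\<close>

lemma ray_toI:
  fixes S :: "'a::chilbert_space set" and M :: "nat \<Rightarrow> real"
  assumes Q: "\<And>n. Q n \<in> trace_class_cone" and S: "orthonormal S" "finite S"
    and M: "\<And>n. 0 \<le> M n" "\<And>n x. qform (Q n) x \<le> M n * (norm x)\<^sup>2"
    and limM: "(\<lambda>n. M n / 4 ^ n) \<longlonglongrightarrow> 1"
    and limt: "(\<lambda>n. rtrace (Q n) / 4 ^ n) \<longlonglongrightarrow> card S"
    and limS: "(\<lambda>n. sum (qform (Q n)) S / 4 ^ n) \<longlonglongrightarrow> card S"
  shows "ray_to Q S"
  unfolding ray_to_def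
proof (rule order_tendstoI)
  fix y :: real assume "y < 0"
  then show "\<forall>\<^sub>F n in sequentially. y < tdist (Q n) (scaled_proj (4 ^ n) S) / 4 ^ n"
    using tdist_nonneg[OF Q scaled_proj_cone(1)[OF S]]
    by (intro always_eventually allI) (smt (verit) divide_nonneg_nonneg zero_le_power)
next
  fix y :: real assume y: "0 < y"
  let ?k = "real (card S)"
  define \<eta> where "\<eta> = y / (4 * (?k + 1))"
  have \<eta>: "\<eta> > 0" using y by (simp add: \<eta>_def add_nonneg_pos)
  define b where "b n = \<bar>1 - M n / 4 ^ n\<bar> * ?k + (M n / 4 ^ n * ?k - rtrace (Q n) / 4 ^ n
      + 2 * (\<eta> * (M n / 4 ^ n) * ?k
        + (1 + 1 / \<eta>) * (rtrace (Q n) / 4 ^ n - sum (qform (Q n)) S / 4 ^ n)))" for n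
  have "tdist (Q n) (scaled_proj (4 ^ n) S) / 4 ^ n \<le> b n" for n
  proof -
    have "tdist (Q n) (scaled_proj (4 ^ n) S)
        \<le> tdist (scaled_proj (M n) S) (Q n) + tdist (scaled_proj (4 ^ n) S) (scaled_proj (M n) S)"
      using tdist_triangle[OF scaled_proj_cone(1)[OF S] scaled_proj_cone(1)[OF S] Q, of "4 ^ n" "M n" n]
        tdist_commute[OF Q scaled_proj_cone(1)[OF S], of "4 ^ n" n] M(1) by simp
    also have "\<dots> \<le> (M n * ?k - rtrace (Q n)
        + 2 * (\<eta> * M n * ?k + (1 + 1 / \<eta>) * (rtrace (Q n) - sum (qform (Q n)) S))) + \<bar>4 ^ n - M n\<bar> * ?k"
      by (intro add_mono tdist_scaled_proj_le tdist_scaled_proj_scaled_proj_le Q S M \<eta>) simp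
    finally have "tdist (Q n) (scaled_proj (4 ^ n) S) / 4 ^ n \<le> ((M n * ?k - rtrace (Q n)
        + 2 * (\<eta> * M n * ?k + (1 + 1 / \<eta>) * (rtrace (Q n) - sum (qform (Q n)) S))) + \<bar>4 ^ n - M n\<bar> * ?k) / 4 ^ n"
      by (rule divide_right_mono) simp
    also have "\<dots> = b n"
    proof -
      have "\<bar>4 ^ n - M n\<bar> / 4 ^ n = \<bar>(4 ^ n - M n) / 4 ^ n\<bar>"
        by (simp add: abs_divide)
      also have "\<dots> = \<bar>1 - M n / 4 ^ n\<bar>"
        by (simp add: diff_divide_distrib)
      finally have "\<bar>4 ^ n - M n\<bar> * ?k / 4 ^ n = \<bar>1 - M n / 4 ^ n\<bar> * ?k"
        by (metis times_divide_eq_left)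
      then show ?thesis
        by (simp add: b_def divide_inverse algebra_simps)
    qed
    finally show ?thesis .
  qed
  moreover have "b \<longlonglongrightarrow> \<bar>1 - 1\<bar> * ?k + (1 * ?k - ?k + 2 * (\<eta> * 1 * ?k + (1 + 1 / \<eta>) * (?k - ?k)))"
    unfolding b_def by (intro tendsto_intros limM limt limS)
  moreover have "2 * \<eta> * ?k < y"
  proof -
    have "2 * \<eta> * ?k = y * (?k / (2 * (?k + 1)))"
      by (simp add: \<eta>_def field_simps)
    also have "\<dots> < y * 1"
      using y by (intro mult_strict_left_mono) (auto simp: divide_less_eq)
    finally show ?thesis by simp
  qed
  ultimately have "\<forall>\<^sub>F n in sequentially. b n < y"
    by (intro order_tendstoD(2)[of b]) (auto simp: mult.assoc)
  then show "\<forall>\<^sub>F n in sequentially. tdist (Q n) (scaled_proj (4 ^ n) S) / 4 ^ n < y"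
    by (rule eventually_mono) (use \<open>\<And>n. _ \<le> b n\<close> in \<open>rule le_less_trans\<close>)
qed

lemma ray_to_close:
  assumes "ray_to Q S" and Q: "\<And>n. Q n \<in> trace_class_cone" "\<And>n. Q' n \<in> trace_class_cone"
    and S: "orthonormal S" "finite S" and c: "\<And>n. tdist (Q' n) (Q n) / 4 ^ n \<le> c n" "c \<longlonglongrightarrow> 0"
  shows "ray_to Q' S"
  unfolding ray_to_def
proof (rule Lim_null_comparison)
  show "(\<lambda>n. c n + tdist (Q n) (scaled_proj (4 ^ n) S) / 4 ^ n) \<longlonglongrightarrow> 0"
    using tendsto_add[OF c(2) assms(1)[unfolded ray_to_def]] by simp
  have "tdist (Q' n) (scaled_proj (4 ^ n) S) / 4 ^ n
      \<le> tdist (Q' n) (Q n) / 4 ^ n + tdist (Q n) (scaled_proj (4 ^ n) S) / 4 ^ n" for n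
    using tdist_triangle[OF Q(2) Q(1) scaled_proj_cone(1)[OF S], of "4 ^ n" n n]
    by (simp add: add_divide_distrib[symmetric] divide_right_mono)
  then show "\<forall>\<^sub>F n in sequentially. norm (tdist (Q' n) (scaled_proj (4 ^ n) S) / 4 ^ n)
      \<le> c n + tdist (Q n) (scaled_proj (4 ^ n) S) / 4 ^ n"
    using c(1) tdist_nonneg[OF Q(2) scaled_proj_cone(1)[OF S]]
    by (intro always_eventually allI) (smt (verit) divide_nonneg_nonneg zero_le_power real_norm_def)
qed

lemma inverse_four_power_tendsto: "(\<lambda>n. (c::real) / 4 ^ n) \<longlonglongrightarrow> 0"
  using tendsto_mult_right_zero[OF LIMSEQ_inverse_realpow_zero[of 4], of c]
  by (simp add: divide_inverse)

lemma abs_quotient_diff: "\<bar>x / 4 ^ n - k\<bar> = \<bar>x - 4 ^ n * k\<bar> / 4 ^ n" for x k :: real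
proof -
  have "x / 4 ^ n - k = (x - 4 ^ n * k) / 4 ^ n"
    by (simp add: diff_divide_distrib)
  then show ?thesis by (simp add: abs_divide)
qed

lemma ray_to_qform:
  assumes "ray_to Q S" and Q: "\<And>n. Q n \<in> trace_class_cone" and S: "orthonormal S" "finite S"
    and x: "norm x = 1"
  shows "(\<lambda>n. qform (Q n) x / 4 ^ n) \<longlonglongrightarrow> (\<Sum>s\<in>S. (cmod (cinner s x))\<^sup>2)"
proof -
  let ?w = "\<Sum>s\<in>S. (cmod (cinner s x))\<^sup>2"
  have "\<bar>qform (Q n) x / 4 ^ n - ?w\<bar> \<le> tdist (Q n) (scaled_proj (4 ^ n) S) / 4 ^ n" for n
  proof -
    have "\<bar>qform (Q n) x / 4 ^ n - ?w\<bar> = \<bar>qform (Q n) x - 4 ^ n * ?w\<bar> / 4 ^ n"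
      by (rule abs_quotient_diff)
    also have "\<dots> \<le> tdist (Q n) (scaled_proj (4 ^ n) S) / 4 ^ n"
      using qform_diff_le_tdist[OF Q[of n] scaled_proj_cone(1)[OF S, of "4 ^ n"] x]
        qform_diff_le_tdist[OF scaled_proj_cone(1)[OF S, of "4 ^ n"] Q[of n] x]
        tdist_commute[OF Q[of n] scaled_proj_cone(1)[OF S, of "4 ^ n"]]
      by (intro divide_right_mono) (auto simp: qform_scaled_proj)
    finally show ?thesis .
  qed
  then have "(\<lambda>n. qform (Q n) x / 4 ^ n - ?w) \<longlonglongrightarrow> 0"
    by (intro Lim_null_comparison[OF _ assms(1)[unfolded ray_to_def]]) simp
  then show ?thesis
    using LIM_zero_iff by blast
qed

lemma ray_to_singleton_unique:
  assumes "ray_to Q {p}" "ray_to Q {p'}" "\<And>n. Q n \<in> trace_class_cone" "norm p = 1" "norm p' = 1"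
  shows "cmod (cinner p p') = 1"
proof -
  have "(\<lambda>n. qform (Q n) p' / 4 ^ n) \<longlonglongrightarrow> (cmod (cinner p p'))\<^sup>2"
    using ray_to_qform[OF assms(1,3), of p'] assms(4,5) by simp
  moreover have "(\<lambda>n. qform (Q n) p' / 4 ^ n) \<longlonglongrightarrow> 1"
    using ray_to_qform[OF assms(2,3), of p'] assms(5) by (simp add: cinner_self)
  ultimately have "(cmod (cinner p p'))\<^sup>2 = 1"
    using LIMSEQ_unique by blast
  then show ?thesis
    by (simp add: power2_eq_1_iff) (metis norm_ge_zero not_one_le_zero neg_0_le_iff_le)
qed

text \<open>The distance of a fixed \<open>B\<close> to points far out near the ray of \<open>P\<close>. Moving from \<open>Q n\<close> back to the
  fixed height \<open>r\<close> on its own ray costs exactly the difference of the traces, so only the relative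
  error \<open>\<parallel>Q n - 4\<^sup>n P\<parallel>\<^sub>1 / 4\<^sup>n\<close> enters, scaled by \<open>r\<close>.\<close>

lemma ray_to_tdist_le:
  assumes ray: "ray_to Q S" and Q: "\<And>n. Q n \<in> trace_class_cone" and S: "orthonormal S" "finite S"
    and B: "B \<in> trace_class_cone" and \<kappa>: "\<kappa> > 0"
  shows "\<forall>\<^sub>F n in sequentially. tdist (Q n) B - rtrace (Q n) \<le> rtrace B - 2 * sum (qform B) S + \<kappa>"
proof -
  obtain r where r: "r > 0"
    "tdist (scaled_proj r S) B \<le> r * card S + rtrace B - 2 * sum (qform B) S + \<kappa> / 2"
    using ray_tdist_le[OF B S half_gt_zero[OF \<kappa>]] by metis
  let ?d = "\<lambda>n. tdist (Q n) (scaled_proj (4 ^ n) S) / 4 ^ n"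
  have "\<forall>\<^sub>F n in sequentially. ?d n < \<kappa> / (4 * r)"
    using ray \<kappa> r(1) unfolding ray_to_def by (intro order_tendstoD(2)[where f = ?d and y = 0]) auto
  moreover have "\<forall>\<^sub>F n in sequentially. r / 4 ^ n < 1"
    by (intro order_tendstoD(2)[OF inverse_four_power_tendsto]) simp
  ultimately show ?thesis
  proof eventually_elim
    case (elim n)
    let ?\<theta> = "r / 4 ^ n"
    have \<theta>: "0 \<le> ?\<theta>" "?\<theta> \<le> 1" using r(1) elim(2) by auto
    let ?q = "\<lambda>x. ?\<theta> *\<^sub>R Q n x" and ?p = "scaled_proj r S"
    have q: "?q \<in> trace_class_cone" and p: "?p \<in> trace_class_cone"
      and p4: "scaled_proj (4 ^ n) S \<in> trace_class_cone"
      using cone_real_scale(1)[OF Q \<theta>(1)] scaled_proj_cone(1)[OF S] r(1) by auto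
    have peq: "(\<lambda>x. ?\<theta> *\<^sub>R scaled_proj (4 ^ n) S x) = ?p"
      by (rule ext) (simp add: scaled_proj_def)
    have 1: "tdist (Q n) ?q \<le> (1 - ?\<theta>) * rtrace (Q n)"
      by (rule tdist_shrink_le[OF Q \<theta>])
    have 2: "tdist ?q ?p \<le> r * ?d n"
      using tdist_real_scale_le[OF Q p4 \<theta>(1), of n] unfolding peq by simp
    have 3: "r * card S - r * ?d n \<le> ?\<theta> * rtrace (Q n)"
      using rtrace_diff_le_tdist[OF q p] 2 cone_real_scale(2)[OF Q \<theta>(1), of n]
        scaled_proj_cone(2)[OF S less_imp_le[OF r(1)]] by simp
    have 4: "r * ?d n < \<kappa> / 4"
      using mult_strict_left_mono[OF elim(1) r(1)] r(1) by simp
    have "tdist (Q n) B \<le> tdist (Q n) ?q + (tdist ?q ?p + tdist ?p B)"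
      using tdist_triangle[OF Q q B, of n] tdist_triangle[OF q p B] by linarith
    moreover have "(1 - ?\<theta>) * rtrace (Q n) = rtrace (Q n) - ?\<theta> * rtrace (Q n)"
      by (simp add: left_diff_distrib)
    moreover have "D - t \<le> R - 2 * s + \<kappa>" if "D \<le> u + (v + w)" "m = t - b" "u \<le> m" "v \<le> a"
      "c - a \<le> b" "a < \<kappa> / 4" "w \<le> c + R - 2 * s + \<kappa> / 2" for D t u v w m b a c R s :: real
      using that by linarith
    ultimately show ?case
      using 1 2 3 4 r(2) by blast
  qed
qed

section \<open>Dominant eigenvalues\<close>

text \<open>If every finite part of a nonnegative family has a sum close to \<open>0\<close> or to the total, then a minimal
  finite part exceeding half of the total loses almost everything when one element is removed.\<close>

lemma dominant_term:
  fixes \<mu> :: "'i \<Rightarrow> real"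
  assumes \<mu>: "(\<mu> has_sum \<tau>) G" "\<And>g. g \<in> G \<Longrightarrow> 0 \<le> \<mu> g" and G: "G \<noteq> {}" and \<kappa>: "0 \<le> \<kappa>"
    and split: "\<And>J. finite J \<Longrightarrow> J \<subseteq> G \<Longrightarrow> \<tau> \<le> \<bar>2 * sum \<mu> J - \<tau>\<bar> + \<kappa>"
  obtains g where "g \<in> G" "\<tau> - \<kappa> \<le> \<mu> g"
proof (cases "\<tau> \<le> 0")
  case True
  obtain g where g: "g \<in> G" using G by blast
  have "\<tau> - \<kappa> \<le> \<mu> g" using True \<kappa> \<mu>(2)[OF g] by linarith
  with g show thesis by (rule that)
next
  case False
  define P where "P J \<longleftrightarrow> finite J \<and> J \<subseteq> G \<and> \<tau> / 2 < sum \<mu> J" for J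
  obtain J0 where J0: "finite J0" "J0 \<subseteq> G" "dist (sum \<mu> J0) \<tau> \<le> \<tau> / 4"
    using has_sum_finite_approximation[OF \<mu>(1), of "\<tau> / 4"] False by auto
  have "\<tau> / 2 < sum \<mu> J0"
    using J0(3) False unfolding dist_real_def by linarith
  then have "P J0"
    using J0 by (simp add: P_def)
  from ex_has_least_nat[of P, OF this, of card]
  obtain J where J: "P J" and min: "\<forall>J'. P J' \<longrightarrow> card J \<le> card J'"
    by (elim exE conjE)
  have "J \<noteq> {}" using J False by (auto simp: P_def)
  then obtain g where g: "g \<in> J" by blast
  have fin: "finite J" "J \<subseteq> G" using J by (auto simp: P_def)
  have "\<not> P (J - {g})"
    using min[rule_format, of "J - {g}"] card_Diff1_less[OF fin(1) g] by linarith
  then have small: "sum \<mu> (J - {g}) \<le> \<tau> / 2"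
    using fin by (auto simp: P_def)
  have "\<tau> \<le> \<bar>2 * sum \<mu> J - \<tau>\<bar> + \<kappa>" "\<tau> \<le> \<bar>2 * sum \<mu> (J - {g}) - \<tau>\<bar> + \<kappa>"
    using fin by (auto intro: split)
  moreover have "sum \<mu> J = \<mu> g + sum \<mu> (J - {g})"
    using fin(1) g by (simp add: sum.remove)
  ultimately have "\<tau> - \<kappa> \<le> \<mu> g"
    using J small unfolding P_def by linarith
  with g fin(2) show thesis by (intro that) auto
qed

text \<open>The part of a cone element carried by finitely many of its eigenvectors.\<close>

lemma eigen_part_cone:
  fixes G :: "'a::chilbert_space set"
  assumes Q: "Q \<in> trace_class_cone" and G: "is_onb G" "\<And>g. g \<in> G \<Longrightarrow> Q g = \<mu> g *\<^sub>R g"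
    and \<mu>: "\<And>g. g \<in> G \<Longrightarrow> 0 \<le> \<mu> g" and J: "finite J" "J \<subseteq> G"
  shows "(\<lambda>x. coord_sum J (Q x)) \<in> trace_class_cone"
    "rtrace (\<lambda>x. coord_sum J (Q x)) = sum \<mu> J"
    "\<And>x. qform (\<lambda>x. coord_sum J (Q x)) x = (\<Sum>g\<in>J. \<mu> g * (cmod (cinner g x))\<^sup>2)"
proof -
  let ?W = "\<lambda>x. coord_sum J (Q x)"
  note pQ = cone_positive[OF Q]
  note bQ = positive_op_bounded_clinear[OF pQ] and oG = is_onb_orthonormal[OF G(1)]
  note oJ = orthonormal_subset[OF oG J(2)]
  have c: "cinner g (Q x) = \<mu> g * cinner g x" if "g \<in> J" for g x
    using hermitianD[OF positive_op_hermitian[OF pQ], of g x] G(2)[of g] that J(2)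
    by (auto simp: cinner_scaleR_left)
  have W: "?W x = (\<Sum>g\<in>J. (\<mu> g * cinner g x) *\<^sub>C g)" for x
    unfolding coord_sum_def by (rule sum.cong) (auto simp: c)
  have Wc: "cinner y (?W x) = (\<Sum>g\<in>J. \<mu> g * (cinner g x * cinner y g))" for x y
    unfolding W cinner_sum_right cinner_scaleC_right by (simp add: mult.assoc)
  show q: "qform ?W x = (\<Sum>g\<in>J. \<mu> g * (cmod (cinner g x))\<^sup>2)" for x
  proof -
    have "cinner g x * cinner x g = complex_of_real ((cmod (cinner g x))\<^sup>2)" for g
      by (simp add: cinner_commute[of x g] complex_norm_square del: of_real_power)
    then have "cinner x (?W x) = complex_of_real (\<Sum>g\<in>J. \<mu> g * (cmod (cinner g x))\<^sup>2)"
      unfolding Wc by simp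
    then show ?thesis
      unfolding qform_def by (simp only: Re_complex_of_real)
  qed
  have pos: "positive_op ?W"
  proof (rule positive_opI)
    show "bounded_clinear ?W"
      by (rule bounded_clinear_compose[OF bounded_clinear_coord_sum[OF oJ J(1)] bQ])
    show "hermitian ?W"
      unfolding hermitian_def
    proof (intro allI)
      fix x y
      have "cinner (?W x) y = cnj (cinner y (?W x))"
        by (rule cinner_commute)
      also have "\<dots> = (\<Sum>g\<in>J. \<mu> g * (cinner x g * cinner g y))"
        unfolding Wc by (simp add: cinner_commute[of _ x, symmetric] cinner_commute[of y, symmetric])
          (rule sum.cong, simp_all, metis cinner_commute complex_cnj_cnj)
      also have "\<dots> = cinner x (?W y)"
        unfolding Wc by (simp add: mult.commute)
      finally show "cinner (?W x) y = cinner x (?W y)" .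
    qed
    show "0 \<le> qform ?W x" for x
      unfolding q by (intro sum_nonneg mult_nonneg_nonneg) (use \<mu> J in auto)
  qed
  have "(qform ?W has_sum sum \<mu> J) G"
  proof (rule has_sum_finite_neutralI[OF J])
    show "qform ?W g = 0" if "g \<in> G - J" for g
      unfolding q by (rule sum.neutral) (use that J(2) orthonormal_cinner[OF oG] in \<open>auto simp: subset_iff\<close>)
    have "qform ?W g = \<mu> g" if g: "g \<in> J" for g
    proof -
      have "qform ?W g = (\<Sum>h\<in>J. if h = g then \<mu> h else 0)"
        unfolding q by (rule sum.cong) (use g orthonormal_cinner[OF oJ] in auto)
      then show ?thesis using J(1) g by simp
    qed
    then show "sum \<mu> J = sum (qform ?W) J" by simp
  qed
  from coneI[OF pos G(1) this] show "?W \<in> trace_class_cone" "rtrace ?W = sum \<mu> J"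
    by blast+
qed

section \<open>Coarse isometries of the cone\<close>

locale coarse_isometry =
  fixes T :: "('a::chilbert_space \<Rightarrow> 'a) \<Rightarrow> ('a \<Rightarrow> 'a)" and \<epsilon> \<delta> :: real
  assumes eps_nonneg: "0 \<le> \<epsilon>" and delta_nonneg: "0 \<le> \<delta>"
    and maps: "A \<in> trace_class_cone \<Longrightarrow> T A \<in> trace_class_cone"
    and zero: "T (\<lambda>x. 0) = (\<lambda>x. 0)"
    and almost_isometry: "A \<in> trace_class_cone \<Longrightarrow> B \<in> trace_class_cone \<Longrightarrow>
      \<bar>tdist (T A) (T B) - tdist A B\<bar> \<le> \<epsilon>"
    and almost_surj: "B \<in> trace_class_cone \<Longrightarrow> \<exists>A\<in>trace_class_cone. tdist (T A) B \<le> \<delta>"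
begin

lemma rtrace_image:
  assumes "A \<in> trace_class_cone"
  shows "\<bar>rtrace (T A) - rtrace A\<bar> \<le> \<epsilon>"
  using almost_isometry[OF assms cone_zero(1)] tdist_zero[OF assms] tdist_zero[OF maps[OF assms]]
  by (simp add: zero)

text \<open>Choosing preimages up to \<open>\<delta>\<close> gives a coarse inverse, which is again a coarse isometry. This lets
  every statement about \<open>T\<close> be used in both directions.\<close>

lemma coarse_inverse:
  obtains S where "coarse_isometry S (\<epsilon> + 2 * \<delta>) (\<epsilon> + \<delta>)"
    "\<And>B. B \<in> trace_class_cone \<Longrightarrow> tdist (T (S B)) B \<le> \<delta>"
    "\<And>A. A \<in> trace_class_cone \<Longrightarrow> tdist (S (T A)) A \<le> \<epsilon> + \<delta>"
proof -
  have "\<exists>A. A \<in> trace_class_cone \<and> tdist (T A) B \<le> \<delta> \<and> (B = (\<lambda>x. 0) \<longrightarrow> A = (\<lambda>x. 0))"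
    if B: "B \<in> trace_class_cone" for B
  proof (cases "B = (\<lambda>x. 0)")
    case True
    have "tdist (\<lambda>x::'a. 0::'a) (\<lambda>x. 0) = 0"
      by (simp only: tdist_zero[OF cone_zero(1)] cone_zero(2))
    then show ?thesis
      using True delta_nonneg by (intro exI[of _ "\<lambda>x. 0"]) (simp add: zero cone_zero(1))
  qed (use almost_surj[OF B] in blast)
  then obtain S where S: "\<And>B. B \<in> trace_class_cone \<Longrightarrow> S B \<in> trace_class_cone"
    "\<And>B. B \<in> trace_class_cone \<Longrightarrow> tdist (T (S B)) B \<le> \<delta>"
    "\<And>B. B \<in> trace_class_cone \<Longrightarrow> B = (\<lambda>x. 0) \<Longrightarrow> S B = (\<lambda>x. 0)"
    by metis
  have near: "tdist (S (T A)) A \<le> \<epsilon> + \<delta>" if A: "A \<in> trace_class_cone" for A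
    using almost_isometry[OF S(1)[OF maps[OF A]] A] S(2)[OF maps[OF A]] by linarith
  have "coarse_isometry S (\<epsilon> + 2 * \<delta>) (\<epsilon> + \<delta>)"
  proof
    show "0 \<le> \<epsilon> + 2 * \<delta>" "0 \<le> \<epsilon> + \<delta>"
      using eps_nonneg delta_nonneg by auto
    show "S A \<in> trace_class_cone" if "A \<in> trace_class_cone" for A
      using S(1) that .
    show "S (\<lambda>x. 0) = (\<lambda>x. 0)"
      using S(3)[OF cone_zero(1)] by simp
    show "\<exists>A\<in>trace_class_cone. tdist (S A) B \<le> \<epsilon> + \<delta>" if "B \<in> trace_class_cone" for B
      using near[OF that] maps[OF that] by blast
    show "\<bar>tdist (S A) (S B) - tdist A B\<bar> \<le> \<epsilon> + 2 * \<delta>"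
      if A: "A \<in> trace_class_cone" and B: "B \<in> trace_class_cone" for A B
    proof -
      note c = maps[OF S(1)[OF A]] maps[OF S(1)[OF B]]
      have "\<bar>tdist (T (S A)) (T (S B)) - tdist (S A) (S B)\<bar> \<le> \<epsilon>"
        by (rule almost_isometry[OF S(1)[OF A] S(1)[OF B]])
      moreover have "tdist (T (S A)) (T (S B)) \<le> tdist (T (S A)) A + (tdist A B + tdist B (T (S B)))"
        using tdist_triangle[OF c(1) A c(2)] tdist_triangle[OF A B c(2)] by linarith
      moreover have "tdist A B \<le> tdist A (T (S A)) + (tdist (T (S A)) (T (S B)) + tdist (T (S B)) B)"
        using tdist_triangle[OF A c(1) B] tdist_triangle[OF c(1) c(2) B] by linarith
      ultimately show ?thesis
        using S(2)[OF A] S(2)[OF B] tdist_commute[OF A c(1)] tdist_commute[OF B c(2)] by linarith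
    qed
  qed
  with S(2) near show thesis using that by blast
qed

text \<open>Where \<open>A \<le> B\<close>, expressed by \<open>\<parallel>A - B\<parallel>\<^sub>1 \<le> Tr B - Tr A\<close>, the images are ordered up to a
  constant.\<close>

lemma almost_monotone:
  assumes A: "A \<in> trace_class_cone" and B: "B \<in> trace_class_cone"
    and le: "tdist A B \<le> rtrace B - rtrace A" and S: "orthonormal S" "finite S"
  shows "sum (qform (T A)) S \<le> sum (qform (T B)) S + 3 / 2 * \<epsilon>"
proof (rule sum_qform_le_add_tdist[OF maps[OF A] maps[OF B] S])
  show "tdist (T A) (T B) \<le> rtrace (T B) - rtrace (T A) + 2 * (3 / 2 * \<epsilon>)"
    using almost_isometry[OF A B] rtrace_image[OF A] rtrace_image[OF B] le by linarith
qed

text \<open>Let \<open>P\<close> be the projection onto the span of \<open>p\<close>. If \<open>W\<close> lies below the image of \<open>tP\<close>, then a near preimage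
  \<open>A\<close> of \<open>W\<close> lies almost below \<open>tP\<close>, so that its trace off \<open>p\<close> is bounded independently of \<open>t\<close>; the
  off-diagonal part of \<open>A\<close> costs a further factor \<open>\<surd>t\<close>. The complementary part \<open>Z\<close> enters because the upper
  bound \<open>Tr Z\<close> for the distance from \<open>W\<close> to the image of \<open>tP\<close> is what makes \<open>A\<close> lie almost below \<open>tP\<close>.\<close>

lemma preimage_near_ray:
  assumes p: "norm p = 1" and t: "1 \<le> t"
    and W: "W \<in> trace_class_cone" and Z: "Z \<in> trace_class_cone"
    and sum: "\<And>x. qform (T (scaled_proj t {p})) x = qform W x + qform Z x"
      "rtrace (T (scaled_proj t {p})) = rtrace W + rtrace Z"
  obtains A where "A \<in> trace_class_cone" "tdist (T A) W \<le> \<delta>"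
    "tdist (scaled_proj (rtrace A) {p}) A \<le> (2 + 6 * \<delta> + 10 * \<epsilon>) * sqrt t"
proof -
  have S: "orthonormal {p}" "finite {p}" using p by auto
  let ?P = "scaled_proj t {p}"
  have P: "?P \<in> trace_class_cone" "rtrace ?P = t"
    using scaled_proj_cone[OF S, of t] t by auto
  obtain A where A: "A \<in> trace_class_cone" "tdist (T A) W \<le> \<delta>"
    using almost_surj[OF W] by blast
  have trA: "rtrace A \<le> rtrace W + \<delta> + \<epsilon>"
    using rtrace_image[OF A(1)] rtrace_diff_le_tdist[OF maps[OF A(1)] W] A(2) by linarith
  have trWZ: "rtrace W + rtrace Z \<le> t + \<epsilon>"
    using rtrace_image[OF P(1)] P(2) sum(2) by linarith
  have "tdist (T ?P) W \<le> rtrace Z"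
  proof (rule tdist_leI[OF maps[OF P(1)] W])
    fix R :: "'a set" assume R: "orthonormal R" "finite R"
    have "(\<Sum>r\<in>R. qform (T ?P) r - qform W r) = sum (qform Z) R"
      by (simp add: sum(1))
    then show "2 * (\<Sum>r\<in>R. qform (T ?P) r - qform W r) - rtrace (T ?P) + rtrace W \<le> rtrace Z"
      using sum_qform_le_rtrace[OF Z R] sum(2) by simp
  qed
  then have "tdist (T ?P) (T A) \<le> rtrace Z + \<delta>"
    using tdist_triangle[OF maps[OF P(1)] W maps[OF A(1)]] tdist_commute[OF W maps[OF A(1)]] A(2)
    by linarith
  then have "tdist ?P A \<le> rtrace Z + \<delta> + \<epsilon>"
    using almost_isometry[OF P(1) A(1)] by linarith
  then have c: "rtrace A - qform A p \<le> \<delta> + 3 / 2 * \<epsilon>"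
    using ray_tdist_ge[OF A(1) S, of t] t trA trWZ by simp
  have c0: "0 \<le> rtrace A - qform A p"
    using sum_qform_le_rtrace[OF A(1) S] by simp
  \<comment> \<open>pinching with weight \<open>1 / s\<close> balances \<open>Tr A / s\<close>, at most about \<open>s\<close>, against \<open>s\<close> times the bounded trace off \<open>p\<close>\<close>
  define s where "s = sqrt t"
  have s: "1 \<le> s" "t = s * s" using t by (auto simp: s_def)
  have m: "rtrace A \<le> t + (\<delta> + 2 * \<epsilon>)" "0 \<le> rtrace A"
    using trA trWZ rtrace_nonneg[OF Z] rtrace_nonneg[OF A(1)] by linarith+
  have "tdist (scaled_proj (rtrace A) {p}) A
      \<le> 2 * (1 / s * rtrace A + (1 + s) * (rtrace A - qform A p))"
    using tdist_scaled_proj_le[OF A(1) _ m(2) qform_le_rtrace[OF A(1)] S, of "1 / s"] s(1) by simp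
  also have "1 / s * rtrace A \<le> s * (1 + \<delta> + 2 * \<epsilon>)"
  proof -
    have "rtrace A \<le> s * s + (\<delta> + 2 * \<epsilon>) * (s * s)"
      using m(1) mult_left_mono[of 1 "s * s" "\<delta> + 2 * \<epsilon>"] s t eps_nonneg delta_nonneg by simp
    then show ?thesis
      using s(1) by (simp add: field_simps)
  qed
  also have "(1 + s) * (rtrace A - qform A p) \<le> (2 * s) * (\<delta> + 3 / 2 * \<epsilon>)"
    using c c0 s(1) by (intro mult_mono) auto
  finally have "tdist (scaled_proj (rtrace A) {p}) A \<le> (2 + 6 * \<delta> + 10 * \<epsilon>) * s"
    by (simp add: algebra_simps)
  then show thesis
    using that A by (simp add: s_def)
qed

text \<open>Twice the constant of \<open>preimage_near_ray\<close>, plus \<open>4\<delta> + 3\<epsilon>\<close> for passing to the preimages and back.\<close>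

definition split_const :: real where
  "split_const = 4 + 16 * \<delta> + 23 * \<epsilon>"

lemma split_const_nonneg: "0 \<le> split_const"
  using eps_nonneg delta_nonneg by (simp add: split_const_def)

text \<open>Both parts have near preimages close to multiples of the same projection, and the distance of two such
  multiples is the difference of their traces.\<close>

lemma split_tdist_le:
  assumes p: "norm p = 1" and t: "1 \<le> t"
    and W: "W \<in> trace_class_cone" and Z: "Z \<in> trace_class_cone"
    and sum: "\<And>x. qform (T (scaled_proj t {p})) x = qform W x + qform Z x"
      "rtrace (T (scaled_proj t {p})) = rtrace W + rtrace Z"
  shows "tdist W Z \<le> \<bar>rtrace W - rtrace Z\<bar> + split_const * sqrt t"
proof -
  have S: "orthonormal {p}" "finite {p}" using p by auto
  define k where "k = (2 + 6 * \<delta> + 10 * \<epsilon>) * sqrt t"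
  obtain A where A: "A \<in> trace_class_cone" "tdist (T A) W \<le> \<delta>"
    "tdist (scaled_proj (rtrace A) {p}) A \<le> k"
    unfolding k_def using preimage_near_ray[OF p t W Z sum] by blast
  have "\<And>x. qform (T (scaled_proj t {p})) x = qform Z x + qform W x"
    "rtrace (T (scaled_proj t {p})) = rtrace Z + rtrace W"
    using sum by auto
  then obtain B where B: "B \<in> trace_class_cone" "tdist (T B) Z \<le> \<delta>"
    "tdist (scaled_proj (rtrace B) {p}) B \<le> k"
    unfolding k_def using preimage_near_ray[OF p t Z W] by blast
  let ?a = "scaled_proj (rtrace A) {p}" and ?b = "scaled_proj (rtrace B) {p}"
  have ab: "?a \<in> trace_class_cone" "?b \<in> trace_class_cone"
    using scaled_proj_cone(1)[OF S] rtrace_nonneg A(1) B(1) by blast+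
  have "tdist ?a ?b \<le> \<bar>rtrace A - rtrace B\<bar>"
    using tdist_scaled_proj_scaled_proj_le[OF S rtrace_nonneg[OF A(1)] rtrace_nonneg[OF B(1)]] by simp
  moreover have "\<bar>rtrace A - rtrace B\<bar> \<le> \<bar>rtrace W - rtrace Z\<bar> + 2 * \<delta> + 2 * \<epsilon>"
    using rtrace_image[OF A(1)] rtrace_diff_le_tdist[OF maps[OF A(1)] W] A(2)
      rtrace_image[OF B(1)] rtrace_diff_le_tdist[OF maps[OF B(1)] Z] B(2) by linarith
  moreover have "tdist A B \<le> tdist ?a A + (tdist ?a ?b + tdist ?b B)"
    using tdist_triangle[OF A(1) ab(1) B(1)] tdist_triangle[OF ab(1,2) B(1)]
      tdist_commute[OF A(1) ab(1)] by linarith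
  moreover have "tdist W Z \<le> tdist (T A) W + (tdist (T A) (T B) + tdist (T B) Z)"
    using tdist_triangle[OF W maps[OF A(1)] Z] tdist_triangle[OF maps[OF A(1)] maps[OF B(1)] Z]
      tdist_commute[OF W maps[OF A(1)]] by linarith
  moreover have "tdist (T A) (T B) \<le> tdist A B + \<epsilon>"
    using almost_isometry[OF A(1) B(1)] by linarith
  ultimately have "tdist W Z \<le> \<bar>rtrace W - rtrace Z\<bar> + 2 * k + (4 * \<delta> + 3 * \<epsilon>)"
    using A(2,3) B(2,3) by linarith
  also have "4 * \<delta> + 3 * \<epsilon> \<le> (4 * \<delta> + 3 * \<epsilon>) * sqrt t"
    using t mult_left_mono[of 1 "sqrt t" "4 * \<delta> + 3 * \<epsilon>"] eps_nonneg delta_nonneg by simp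
  finally show ?thesis
    by (simp add: k_def split_const_def algebra_simps)
qed

text \<open>A spectral part and its complement are orthogonal, so their distance is the sum of their traces. Together
  with \<open>split_tdist_le\<close> this leaves one of the two with a trace of order \<open>\<surd>t\<close>, for every choice of
  finitely many eigenvectors.\<close>

lemma dominant_eigenvector:
  assumes p: "norm p = 1" and t: "1 \<le> t"
  obtains u l where "norm u = 1" "T (scaled_proj t {p}) u = l *\<^sub>R u"
    "rtrace (T (scaled_proj t {p})) - split_const * sqrt t \<le> l"
proof -
  define Q where "Q = T (scaled_proj t {p})"
  have S: "orthonormal {p}" "finite {p}" using p by auto
  have Q: "Q \<in> trace_class_cone"
    unfolding Q_def using scaled_proj_cone(1)[OF S, of t] t by (intro maps) simp
  obtain G \<mu> where G: "is_onb G" "\<And>g. g \<in> G \<Longrightarrow> Q g = \<mu> g *\<^sub>R g" "\<And>g. g \<in> G \<Longrightarrow> 0 \<le> \<mu> g"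
    "\<mu> summable_on G"
    using cone_eigenbasis[OF Q] by metis
  note oG = is_onb_orthonormal[OF G(1)]
  obtain \<tau> where \<tau>: "(\<mu> has_sum \<tau>) G"
    using G(4) unfolding summable_on_def by blast
  have trQ: "rtrace Q = \<tau>"
    using cone_rtrace_eigenvalues[OF Q G(1,2) \<tau>] by blast
  have Gne: "G \<noteq> {}"
  proof
    assume "G = {}"
    then have "p = 0" using onb_eqI[OF G(1), of p 0] by simp
    then show False using p by simp
  qed
  have split: "\<tau> \<le> \<bar>2 * sum \<mu> J - \<tau>\<bar> + split_const * sqrt t" if J: "finite J" "J \<subseteq> G" for J
  proof -
    define W where "W = (\<lambda>x. coord_sum J (Q x))"
    define Z where "Z = (\<lambda>x. Q x - W x)"
    have W: "W \<in> trace_class_cone" "rtrace W = sum \<mu> J"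
      "\<And>x. qform W x = (\<Sum>g\<in>J. \<mu> g * (cmod (cinner g x))\<^sup>2)"
      unfolding W_def by (rule eigen_part_cone[OF Q G(1) _ _ J], erule G(2), erule G(3))+
    have oJ: "orthonormal J" using orthonormal_subset[OF oG J(2)] .
    have le: "qform W x \<le> qform Q x" for x
      unfolding W(3)
      by (rule finite_sum_le_has_sum[OF qform_eigenbasis_has_sum[OF
              positive_op_bounded_clinear[OF cone_positive[OF Q]] G(1,2)]]) (use G(3) J in auto)
    have qZ: "qform Z x = qform Q x - qform W x" for x
      unfolding Z_def by (rule qform_minus)
    have Z: "Z \<in> trace_class_cone" "rtrace Z = \<tau> - sum \<mu> J"
      using cone_diff[OF Q W(1) le] unfolding Z_def[symmetric] trQ W(2) by auto
    have "tdist W Z \<le> \<bar>rtrace W - rtrace Z\<bar> + split_const * sqrt t"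
      by (rule split_tdist_le[OF p t W(1) Z(1), folded Q_def]) (simp_all add: qZ Z(2) W(2) trQ)
    then have "tdist W Z \<le> \<bar>2 * sum \<mu> J - \<tau>\<bar> + split_const * sqrt t"
      by (simp add: W(2) Z(2))
    moreover have "(\<Sum>g\<in>J. qform W g - qform Z g) = sum \<mu> J"
    proof (rule sum.cong)
      fix g assume g: "g \<in> J"
      then have Qg: "Q g = \<mu> g *\<^sub>R g" and ng: "norm g = 1"
        using G(2) J(2) orthonormal_norm[OF oJ] by auto
      have "qform W g = \<mu> g"
        using coord_sum_mem[OF oJ subset_refl J(1) g] g
        by (simp add: qform_def W_def Qg bounded_clinear_scaleR[OF bounded_clinear_coord_sum[OF oJ J(1)]]
            cinner_scaleR_right cinner_self ng)
      moreover have "qform Q g = \<mu> g"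
        using ng Qg by (rule qform_eigenvector)
      ultimately show "qform W g - qform Z g = \<mu> g"
        by (simp add: qZ)
    qed simp
    ultimately show ?thesis
      using tdist_ge[OF W(1) Z(1) oJ J(1)] by (simp add: W(2) Z(2))
  qed
  have "0 \<le> split_const * sqrt t"
    using split_const_nonneg t by simp
  from dominant_term[OF \<tau> G(3) Gne this split]
  obtain g where g: "g \<in> G" "\<tau> - split_const * sqrt t \<le> \<mu> g" by blast
  show thesis
    using that[of g "\<mu> g"] g G(2) orthonormal_norm[OF oG g(1)] trQ unfolding Q_def by simp
qed

end

section \<open>Limits of rank-one rays\<close>

lemma phase_align:
  fixes u v :: "'a::complex_inner"
  assumes "norm u = 1" "norm v = 1"
  obtains c where "cmod c = 1" "(norm (v - c *\<^sub>C u))\<^sup>2 \<le> 2 * (1 - (cmod (cinner u v))\<^sup>2)"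
proof (cases "cinner u v = 0")
  case True
  then have "cinner v u = 0" using cinner_commute[of v u] by simp
  then show thesis
    using that[of 1] True assms by (simp add: norm_diff_sq)
next
  case False
  define a where "a = cmod (cinner u v)"
  have a: "0 < a" "a \<le> 1"
    using False cinner_cauchy_schwarz[of u v] assms by (auto simp: a_def)
  define c where "c = cinner u v / a"
  have c: "cmod c = 1" using a by (simp add: c_def norm_divide a_def)
  have "cinner v (c *\<^sub>C u) = c * cnj (cinner u v)"
    using cinner_commute[of v u] by (simp add: cinner_scaleC_right)
  also have "\<dots> = complex_of_real a"
    using a complex_norm_square[of "cinner u v"] by (simp add: c_def a_def field_simps power2_eq_square)
  finally have "(norm (v - c *\<^sub>C u))\<^sup>2 = 2 - 2 * a"
    using assms c by (simp add: norm_diff_sq norm_scaleC)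
  also have "\<dots> \<le> 2 * (1 - a\<^sup>2)"
    using a mult_left_mono[of a 1 a] by (simp add: power2_eq_square)
  finally show thesis using that[OF c] by (simp add: a_def)
qed

lemma qform_lipschitz:
  assumes A: "A \<in> trace_class_cone"
  shows "\<bar>qform A x - qform A y\<bar> \<le> rtrace A * (norm (x + y) * norm (x - y))"
proof -
  note pA = cone_positive[OF A]
  note bA = positive_op_bounded_clinear[OF pA]
  have "Re (cinner y (A x)) = Re (cinner x (A y))"
    using hermitianD[OF positive_op_hermitian[OF pA], of x y] cinner_commute[of y "A x"] by simp
  then have "qform A x - qform A y = Re (cinner (x + y) (A (x - y)))"
    by (simp add: qform_def bounded_clinear_diff[OF bA] cinner_simps)
  also have "\<bar>\<dots>\<bar> \<le> cmod (cinner (x + y) (A (x - y)))"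
    by (rule abs_Re_le_cmod)
  also have "\<dots> \<le> rtrace A * (norm (x + y) * norm (x - y))"
  proof (rule power2_le_imp_le)
    have "(cmod (cinner (x + y) (A (x - y))))\<^sup>2 \<le> qform A (x + y) * qform A (x - y)"
      by (rule positive_op_cauchy_schwarz[OF pA])
    also have "\<dots> \<le> (rtrace A * (norm (x + y))\<^sup>2) * (rtrace A * (norm (x - y))\<^sup>2)"
      by (intro mult_mono qform_le_rtrace A positive_op_nonneg pA mult_nonneg_nonneg rtrace_nonneg) simp
    finally show "(cmod (cinner (x + y) (A (x - y))))\<^sup>2 \<le> (rtrace A * (norm (x + y) * norm (x - y)))\<^sup>2"
      by (simp add: power2_eq_square mult_ac)
  qed (simp add: rtrace_nonneg[OF A])
  finally show ?thesis .
qed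

lemma ray_to_refl:
  assumes S: "orthonormal S" "finite S"
  shows "ray_to (\<lambda>n. scaled_proj (4 ^ n) S) S"
proof -
  have "tdist (scaled_proj (4 ^ n) S) (scaled_proj (4 ^ n) S) = 0" for n
    using tdist_scaled_proj_scaled_proj_le[OF S, of "4 ^ n" "4 ^ n"]
      tdist_nonneg[OF scaled_proj_cone(1)[OF S] scaled_proj_cone(1)[OF S], of "4 ^ n" "4 ^ n"] by simp
  then show ?thesis by (simp add: ray_to_def)
qed

context coarse_isometry begin

text \<open>On unit vectors orthogonal to the later eigenvector \<open>y\<close>, the form of the later image has order \<open>2\<^sup>n\<close>, and by
  almost-monotonicity so has the form of the earlier one. But at the normalized component \<open>w'\<close> of \<open>x\<close>
  orthogonal to \<open>y\<close> the latter is at least \<open>l \<bar>\<langle>w', x\<rangle>\<bar>\<^sup>2\<close>, with \<open>l\<close> of order \<open>4\<^sup>n\<close>.\<close>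

lemma consecutive_eigenvectors:
  assumes p: "norm p = 1"
    and x: "norm x = 1" "T (scaled_proj (4 ^ n) {p}) x = l *\<^sub>R x"
      "rtrace (T (scaled_proj (4 ^ n) {p})) - split_const * 2 ^ n \<le> l"
    and y: "norm y = 1" "T (scaled_proj (4 ^ Suc n) {p}) y = m *\<^sub>R y"
      "rtrace (T (scaled_proj (4 ^ Suc n) {p})) - split_const * 2 ^ Suc n \<le> m"
  shows "1 - (cmod (cinner y x))\<^sup>2 \<le> (3 * split_const + 3 * \<epsilon>) / 2 ^ n"
proof -
  define K where "K = split_const"
  have K: "0 \<le> K" unfolding K_def by (rule split_const_nonneg)
  let ?Q = "T (scaled_proj (4 ^ n) {p})" and ?R = "T (scaled_proj (4 ^ Suc n) {p})"
  have S: "orthonormal {p}" "finite {p}" using p by auto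
  have cone: "scaled_proj (4 ^ k) {p} \<in> trace_class_cone" for k
    using scaled_proj_cone(1)[OF S] by simp
  have Q: "?Q \<in> trace_class_cone" and R: "?R \<in> trace_class_cone"
    by (rule maps[OF cone])+
  note pQ = cone_positive[OF Q]
  define b where "b = 1 - (cmod (cinner y x))\<^sup>2"
  define w where "w = x - coord_sum {y} x"
  have oy: "orthonormal {y}" "finite {y}" using y(1) by auto
  have nw: "(norm w)\<^sup>2 = b"
    unfolding w_def norm_sub_coord_sum[OF oy] b_def by (simp add: x(1))
  have yw: "cinner y w = 0"
    by (simp add: w_def coord_sum_def cinner_diff_right cinner_scaleC_right cinner_self y(1))
  have wx: "cinner w x = complex_of_real b"
  proof -
    have "cinner w y = 0" using yw cinner_commute[of w y] by simp
    then have "cinner w x = cinner w w"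
      by (simp add: w_def coord_sum_def cinner_diff_right cinner_scaleC_right)
    then show ?thesis by (simp add: cinner_self nw del: of_real_power)
  qed
  have b1: "b \<le> 1" by (simp add: b_def)
  have "b \<le> (3 * K + 3 * \<epsilon>) / 2 ^ n"
  proof (cases "b \<le> 0")
    case True
    have "0 \<le> (3 * K + 3 * \<epsilon>) / 2 ^ n" using K eps_nonneg by simp
    then show ?thesis using True by linarith
  next
    case False
    then have b: "0 < b" by simp
    have lx: "qform ?Q x = l" using x(1,2) by (rule qform_eigenvector)
    have my: "qform ?R y = m" using y(1,2) by (rule qform_eigenvector)
    have lb: "l * b * b \<le> qform ?Q w"
    proof (cases "0 < l")
      case True
      have "(cmod (cinner w (?Q x)))\<^sup>2 \<le> qform ?Q w * qform ?Q x"
        by (rule positive_op_cauchy_schwarz[OF pQ])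
      moreover have "cmod (cinner w (?Q x)) = l * b"
        using True b by (simp add: x(2) cinner_scaleR_right wx norm_mult)
      ultimately have "(l * b) * (l * b) \<le> qform ?Q w * l"
        by (simp add: lx power2_eq_square)
      then have "l * (l * b * b) \<le> l * qform ?Q w"
        by (simp add: mult_ac)
      then show ?thesis using True by simp
    next
      case False
      then have "l * b * b \<le> 0" using b by (simp add: mult_nonpos_nonneg)
      then show ?thesis using positive_op_nonneg[OF pQ, of w] by linarith
    qed
    define w' where "w' = (1 / sqrt b) *\<^sub>R w"
    have "norm w = sqrt b" using nw b by (metis real_sqrt_unique norm_ge_zero)
    then have nw': "norm w' = 1" using b by (simp add: w'_def)
    have yw': "cinner y w' = 0" by (simp add: w'_def cinner_scaleR_right yw)
    have "qform ?Q w' = qform ?Q w / b"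
      unfolding w'_def qform_scaleR[OF positive_op_bounded_clinear[OF pQ]]
      using b by (simp add: power_divide)
    then have lb': "l * b \<le> qform ?Q w'"
      using lb b by (simp add: pos_le_divide_eq)
    have "cinner w' y = 0" using yw' cinner_commute[of w' y] by simp
    then have o2: "orthonormal {w', y}" using nw' y(1) yw' by (auto simp: orthonormal_def)
    have ne: "w' \<noteq> y" using yw' y(1) by (auto simp: cinner_self)
    have "sum (qform ?R) {w', y} \<le> rtrace ?R"
      by (rule sum_qform_le_rtrace[OF R o2]) simp
    then have Rw: "qform ?R w' \<le> K * 2 ^ Suc n"
      using ne y(3) my by (simp add: K_def)
    have "tdist (scaled_proj (4 ^ n) {p}) (scaled_proj (4 ^ Suc n) {p})
        \<le> rtrace (scaled_proj (4 ^ Suc n) {p}) - rtrace (scaled_proj (4 ^ n) {p})"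
      using tdist_scaled_proj_scaled_proj_le[OF S, of "4 ^ n" "4 ^ Suc n"]
        scaled_proj_cone(2)[OF S, of "4 ^ n"] scaled_proj_cone(2)[OF S, of "4 ^ Suc n"] by simp
    then have "qform ?Q w' \<le> qform ?R w' + 3 / 2 * \<epsilon>"
      using almost_monotone[OF cone cone, of n "Suc n" "{w'}"] nw' by simp
    then have 1: "l * b \<le> 2 * K * 2 ^ n + 3 / 2 * \<epsilon>"
      using lb' Rw by simp
    have 2: "4 ^ n - \<epsilon> - K * 2 ^ n \<le> l"
      using x(3) rtrace_image[OF cone, of n] scaled_proj_cone(2)[OF S, of "4 ^ n"]
      by (simp add: K_def)
    have "4 ^ n * b \<le> (l + (\<epsilon> + K * 2 ^ n)) * b"
      using 2 b by (intro mult_right_mono) auto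
    also have "\<dots> = l * b + (\<epsilon> + K * 2 ^ n) * b"
      by (rule distrib_right)
    also have "(\<epsilon> + K * 2 ^ n) * b \<le> (\<epsilon> + K * 2 ^ n) * 1"
      using b1 K eps_nonneg by (intro mult_left_mono) auto
    also have "l * b + (\<epsilon> + K * 2 ^ n) * 1 \<le> (3 * K + 3 * \<epsilon>) * 2 ^ n"
      using 1 eps_nonneg mult_left_mono[of 1 "2 ^ n" "3 * \<epsilon>"] by (simp add: algebra_simps)
    finally have "4 ^ n * b \<le> (3 * K + 3 * \<epsilon>) * 2 ^ n" by simp
    moreover have "(4::real) ^ n = 2 ^ n * 2 ^ n"
      by (simp add: power_mult_distrib[symmetric])
    ultimately have "2 ^ n * (b * 2 ^ n) \<le> 2 ^ n * (3 * K + 3 * \<epsilon>)"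
      by (simp add: mult_ac)
    then have "b * 2 ^ n \<le> 3 * K + 3 * \<epsilon>" by simp
    then show ?thesis by (simp add: pos_le_divide_eq)
  qed
  then show ?thesis by (simp add: b_def K_def)
qed

text \<open>Eigenvectors are determined up to a phase only. Aligning each one with its predecessor turns the previous
  bound into \<open>\<parallel>v\<^sub>n\<^sub>+\<^sub>1 - v\<^sub>n\<parallel>\<^sup>2 = O(2\<^sup>-\<^sup>n)\<close>, so that they converge.\<close>

lemma rank_one_ray_limit:
  assumes p: "norm p = 1"
  obtains p' where "norm p' = 1" "ray_to (\<lambda>n. T (scaled_proj (4 ^ n) {p})) {p'}"
proof -
  define Q where "Q n = T (scaled_proj (4 ^ n) {p})" for n :: nat
  define K where "K = split_const"
  define L where "L = 3 * K + 3 * \<epsilon>"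
  have K: "0 \<le> K" unfolding K_def by (rule split_const_nonneg)
  have L: "0 \<le> L" using K eps_nonneg by (simp add: L_def)
  have S: "orthonormal {p}" "finite {p}" using p by auto
  have cone: "scaled_proj (4 ^ k) {p} \<in> trace_class_cone" for k
    using scaled_proj_cone(1)[OF S] by simp
  have Q: "Q n \<in> trace_class_cone" for n
    unfolding Q_def using maps[OF cone] .
  define P where "P n x \<longleftrightarrow> norm x = 1 \<and> (\<exists>l::real. Q n x = l *\<^sub>R x \<and> rtrace (Q n) - K * 2 ^ n \<le> l)"
    for n :: nat and x :: 'a
  have ex: "\<exists>x. P n x" for n
  proof -
    have "sqrt (4 ^ n) = 2 ^ n"
      by (rule real_sqrt_unique) (simp_all add: power2_eq_square power_mult_distrib[symmetric])
    then show ?thesis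
      using dominant_eigenvector[OF p, of "4 ^ n"] unfolding P_def Q_def K_def by (metis one_le_numeral one_le_power)
  qed
  have step: "\<exists>y. P (Suc n) y \<and> (norm (y - x))\<^sup>2 \<le> 2 * L / 2 ^ n" if x: "P n x" for n x
  proof -
    obtain z where z: "P (Suc n) z" using ex by blast
    obtain l m where l: "Q n x = l *\<^sub>R x" "rtrace (Q n) - K * 2 ^ n \<le> l"
      and m: "Q (Suc n) z = m *\<^sub>R z" "rtrace (Q (Suc n)) - K * 2 ^ Suc n \<le> m"
      using x z unfolding P_def by blast
    have nx: "norm x = 1" "norm z = 1" using x z by (auto simp: P_def)
    have b: "1 - (cmod (cinner z x))\<^sup>2 \<le> L / 2 ^ n"
      unfolding L_def K_def
      by (rule consecutive_eigenvectors[OF p nx(1) _ _ nx(2)]) (use l m in \<open>auto simp: Q_def K_def\<close>)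
    obtain c where c: "cmod c = 1" "(norm (x - c *\<^sub>C z))\<^sup>2 \<le> 2 * (1 - (cmod (cinner z x))\<^sup>2)"
      using phase_align[OF nx(2,1)] by blast
    have "Q (Suc n) (c *\<^sub>C z) = m *\<^sub>R (c *\<^sub>C z)"
      using m(1) bounded_clinear_scaleC[OF positive_op_bounded_clinear[OF cone_positive[OF Q[of "Suc n"]]]]
      by (simp add: scaleR_scaleC_commute)
    then have "P (Suc n) (c *\<^sub>C z)"
      unfolding P_def using m(2) nx(2) c(1) by (auto simp: norm_scaleC)
    moreover have "(norm (c *\<^sub>C z - x))\<^sup>2 \<le> 2 * L / 2 ^ n"
      using c(2) b by (simp add: norm_minus_commute)
    ultimately show ?thesis by blast
  qed
  obtain v where v: "\<And>n. P n (v n)" "\<And>n. (norm (v (Suc n) - v n))\<^sup>2 \<le> 2 * L / 2 ^ n"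
    using dependent_nat_choice[of P "\<lambda>n x y. (norm (y - x))\<^sup>2 \<le> 2 * L / 2 ^ n"] ex step by blast
  have "summable (\<lambda>n. v (Suc n) - v n)"
  proof (rule summable_comparison_test)
    show "\<exists>N. \<forall>n\<ge>N. norm (v (Suc n) - v n) \<le> sqrt (2 * L) * (sqrt (1 / 2)) ^ n"
    proof (intro exI allI impI)
      fix n
      have "norm (v (Suc n) - v n) \<le> sqrt (2 * L / 2 ^ n)"
        by (rule real_le_rsqrt[OF v(2)])
      also have "\<dots> = sqrt (2 * L) * (sqrt (1 / 2)) ^ n"
        by (simp add: real_sqrt_divide real_sqrt_power power_divide)
      finally show "norm (v (Suc n) - v n) \<le> sqrt (2 * L) * (sqrt (1 / 2)) ^ n" .
    qed
    have "norm (sqrt (1 / 2)) < 1" by (simp add: real_sqrt_divide)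
    then show "summable (\<lambda>n. sqrt (2 * L) * (sqrt (1 / 2)) ^ n)"
      by (intro summable_mult summable_geometric)
  qed
  then have "(\<lambda>n. \<Sum>i<n. v (Suc i) - v i) \<longlonglongrightarrow> suminf (\<lambda>n. v (Suc n) - v n)"
    by (rule summable_LIMSEQ)
  then have "(\<lambda>n. v n - v 0) \<longlonglongrightarrow> suminf (\<lambda>n. v (Suc n) - v n)"
    by (simp add: sum_lessThan_telescope)
  from tendsto_add[OF this tendsto_const[of "v 0"]]
  obtain p' where p': "v \<longlonglongrightarrow> p'" by auto
  have nv: "norm (v n) = 1" for n using v(1) by (simp add: P_def)
  have np': "norm p' = 1"
    using tendsto_norm[OF p'] by (simp add: nv LIMSEQ_const_iff)
  have limM: "(\<lambda>n. rtrace (Q n) / 4 ^ n) \<longlonglongrightarrow> 1"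
  proof -
    have "\<bar>rtrace (Q n) / 4 ^ n - 1\<bar> \<le> \<epsilon> / 4 ^ n" for n
      unfolding abs_quotient_diff Q_def
      using rtrace_image[OF cone, of n] scaled_proj_cone(2)[OF S, of "4 ^ n"]
      by (intro divide_right_mono) auto
    then have "(\<lambda>n. rtrace (Q n) / 4 ^ n - 1) \<longlonglongrightarrow> 0"
      by (intro Lim_null_comparison[OF _ inverse_four_power_tendsto[of \<epsilon>]]) simp
    then show ?thesis using LIM_zero_iff by blast
  qed
  have "(\<lambda>n. qform (Q n) p' / 4 ^ n) \<longlonglongrightarrow> 1"
  proof (rule tendsto_sandwich)
    have "(\<lambda>n. K * (1 / 2) ^ n) \<longlonglongrightarrow> 0"
      by (intro tendsto_mult_right_zero LIMSEQ_power_zero) simp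
    then have "(\<lambda>n. rtrace (Q n) / 4 ^ n - K * (1 / 2) ^ n - 2 * (rtrace (Q n) / 4 ^ n) * norm (v n - p'))
        \<longlonglongrightarrow> 1 - 0 - 2 * 1 * norm (p' - p')"
      by (intro tendsto_intros limM p')
    then show "(\<lambda>n. rtrace (Q n) / 4 ^ n - K * (1 / 2) ^ n - 2 * (rtrace (Q n) / 4 ^ n) * norm (v n - p'))
        \<longlonglongrightarrow> 1" by simp
    have "rtrace (Q n) / 4 ^ n - K * (1 / 2) ^ n - 2 * (rtrace (Q n) / 4 ^ n) * norm (v n - p')
        \<le> qform (Q n) p' / 4 ^ n" for n
    proof -
      obtain l where l: "Q n (v n) = l *\<^sub>R v n" "rtrace (Q n) - K * 2 ^ n \<le> l"
        using v(1)[of n] by (auto simp: P_def)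
      have "qform (Q n) (v n) = l" using nv l(1) by (rule qform_eigenvector)
      moreover have "\<bar>qform (Q n) (v n) - qform (Q n) p'\<bar> \<le> rtrace (Q n) * (norm (v n + p') * norm (v n - p'))"
        by (rule qform_lipschitz[OF Q])
      moreover have "rtrace (Q n) * (norm (v n + p') * norm (v n - p')) \<le> rtrace (Q n) * (2 * norm (v n - p'))"
        using norm_triangle_ineq[of "v n" p'] nv[of n] np' rtrace_nonneg[OF Q]
        by (intro mult_left_mono mult_right_mono) auto
      ultimately have "rtrace (Q n) - K * 2 ^ n - 2 * rtrace (Q n) * norm (v n - p') \<le> qform (Q n) p'"
        using l(2) by linarith
      then have "(rtrace (Q n) - K * 2 ^ n - 2 * rtrace (Q n) * norm (v n - p')) / 4 ^ n \<le> qform (Q n) p' / 4 ^ n"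
        by (rule divide_right_mono) simp
      moreover have "K * 2 ^ n / 4 ^ n = K * (1 / 2) ^ n"
      proof -
        have "(4::real) ^ n = 2 ^ n * 2 ^ n"
          by (simp add: power_mult_distrib[symmetric])
        then show ?thesis by (simp add: power_divide)
      qed
      ultimately show ?thesis
        by (simp add: diff_divide_distrib)
    qed
    then show "\<forall>\<^sub>F n in sequentially. rtrace (Q n) / 4 ^ n - K * (1 / 2) ^ n
        - 2 * (rtrace (Q n) / 4 ^ n) * norm (v n - p') \<le> qform (Q n) p' / 4 ^ n" by simp
    show "\<forall>\<^sub>F n in sequentially. qform (Q n) p' / 4 ^ n \<le> rtrace (Q n) / 4 ^ n"
      using qform_le_rtrace[OF Q, of _ p'] np' by (intro always_eventually allI divide_right_mono) auto
  qed (rule limM)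
  then have "ray_to Q {p'}"
    using np' limM by (intro ray_toI[of Q "{p'}" "\<lambda>n. rtrace (Q n)"] Q rtrace_nonneg qform_le_rtrace) auto
  then show thesis unfolding Q_def[abs_def] by (rule that[OF np'])
qed

text \<open>Distances from \<open>T A\<close> to points far out on an image ray recover the traces of \<open>T A\<close> against the limiting
  projection. The error \<open>2\<epsilon>\<close> collects one \<open>\<epsilon>\<close> from the distance to the ray and one from the height
  of its points.\<close>

lemma trace_comparison:
  assumes S: "orthonormal S" "finite S" and S': "orthonormal S'" "finite S'" "card S' = card S"
    and ray: "ray_to (\<lambda>n. T (scaled_proj (4 ^ n) S)) S'" and A: "A \<in> trace_class_cone"
  shows "2 * sum (qform (T A)) S' - 2 * sum (qform A) S \<le> rtrace (T A) - rtrace A + 2 * \<epsilon>"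
proof (rule field_le_epsilon)
  fix \<kappa> :: real assume \<kappa>: "0 < \<kappa>"
  have cone: "scaled_proj (4 ^ k) S \<in> trace_class_cone" for k
    using scaled_proj_cone(1)[OF S] by simp
  have "\<forall>\<^sub>F n in sequentially. tdist (T (scaled_proj (4 ^ n) S)) (T A) - rtrace (T (scaled_proj (4 ^ n) S))
      \<le> rtrace (T A) - 2 * sum (qform (T A)) S' + \<kappa>"
    by (rule ray_to_tdist_le[OF ray maps[OF cone] S'(1,2) maps[OF A] \<kappa>])
  then obtain n where n: "tdist (T (scaled_proj (4 ^ n) S)) (T A) - rtrace (T (scaled_proj (4 ^ n) S))
      \<le> rtrace (T A) - 2 * sum (qform (T A)) S' + \<kappa>"
    using eventually_happens'[OF sequentially_bot] by blast
  then show "2 * sum (qform (T A)) S' - 2 * sum (qform A) S \<le> rtrace (T A) - rtrace A + 2 * \<epsilon> + \<kappa>"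
    using almost_isometry[OF cone A, of n] ray_tdist_ge[OF A S, of "4 ^ n"]
      rtrace_image[OF cone, of n] scaled_proj_cone(2)[OF S, of "4 ^ n"] by simp
qed

lemma qform_image_le:
  assumes x: "norm x = 1" "norm x' = 1" and ray: "ray_to (\<lambda>n. T (scaled_proj (4 ^ n) {x})) {x'}"
    and A: "A \<in> trace_class_cone"
  shows "qform (T A) x' \<le> qform A x + 3 / 2 * \<epsilon>"
  using trace_comparison[OF _ _ _ _ _ ray A] x rtrace_image[OF A] by simp

text \<open>Apply \<open>qform_image_le\<close> to the points of the ray through \<open>y\<close> and divide by the height; the constant error
  disappears in the limit.\<close>

lemma transition_le:
  assumes x: "norm x = 1" "norm x' = 1" "ray_to (\<lambda>n. T (scaled_proj (4 ^ n) {x})) {x'}"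
    and y: "norm y = 1" "norm y' = 1" "ray_to (\<lambda>n. T (scaled_proj (4 ^ n) {y})) {y'}"
  shows "cmod (cinner y' x') \<le> cmod (cinner y x)"
proof -
  have S: "orthonormal {y}" "finite {y}" "orthonormal {y'}" "finite {y'}" using y by auto
  have cone: "scaled_proj (4 ^ k) {y} \<in> trace_class_cone" for k
    using scaled_proj_cone(1)[OF S(1,2)] by simp
  have "(cmod (cinner y' x'))\<^sup>2 \<le> (cmod (cinner y x))\<^sup>2"
  proof (rule LIMSEQ_le)
    show "(\<lambda>n. qform (T (scaled_proj (4 ^ n) {y})) x' / 4 ^ n) \<longlonglongrightarrow> (cmod (cinner y' x'))\<^sup>2"
      using ray_to_qform[OF y(3) maps[OF cone] S(3,4) x(2)] by simp
    show "(\<lambda>n. (cmod (cinner y x))\<^sup>2 + (3 / 2 * \<epsilon>) / 4 ^ n) \<longlonglongrightarrow> (cmod (cinner y x))\<^sup>2"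
      using tendsto_add[OF tendsto_const[of "(cmod (cinner y x))\<^sup>2"]
          inverse_four_power_tendsto[of "3 / 2 * \<epsilon>"]] by simp
    have "qform (T (scaled_proj (4 ^ n) {y})) x' / 4 ^ n \<le> (cmod (cinner y x))\<^sup>2 + (3 / 2 * \<epsilon>) / 4 ^ n" for n
    proof -
      have "qform (T (scaled_proj (4 ^ n) {y})) x' \<le> 4 ^ n * (cmod (cinner y x))\<^sup>2 + 3 / 2 * \<epsilon>"
        using qform_image_le[OF x cone, of n] by (simp add: qform_scaled_proj)
      then have "qform (T (scaled_proj (4 ^ n) {y})) x' / 4 ^ n
          \<le> (4 ^ n * (cmod (cinner y x))\<^sup>2 + 3 / 2 * \<epsilon>) / 4 ^ n"
        by (rule divide_right_mono) simp
      then show ?thesis by (simp add: add_divide_distrib)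
    qed
    then show "\<exists>N. \<forall>n\<ge>N. qform (T (scaled_proj (4 ^ n) {y})) x' / 4 ^ n
        \<le> (cmod (cinner y x))\<^sup>2 + (3 / 2 * \<epsilon>) / 4 ^ n" by blast
  qed
  then show ?thesis by (rule power2_le_imp_le) simp
qed

text \<open>The round trip moves the points of the ray through \<open>x\<close> by at most \<open>c\<close>, so the same sequence is asymptotic to
  the rays through \<open>x\<close> and through \<open>z\<close>.\<close>

lemma round_trip_phase:
  assumes R: "\<And>B. B \<in> trace_class_cone \<Longrightarrow> R B \<in> trace_class_cone"
    "\<And>B. B \<in> trace_class_cone \<Longrightarrow> tdist (T (R B)) B \<le> c"
    and x: "norm x = 1" and y: "norm y = 1" "ray_to (\<lambda>n. R (scaled_proj (4 ^ n) {x})) {y}"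
    and z: "norm z = 1" "ray_to (\<lambda>n. T (scaled_proj (4 ^ n) {y})) {z}"
  shows "cmod (cinner x z) = 1"
proof -
  have Sx: "orthonormal {x}" "finite {x}" and Sy: "orthonormal {y}" "finite {y}"
    and Sz: "orthonormal {z}" "finite {z}"
    using x y z by auto
  have cx: "scaled_proj (4 ^ k) {x} \<in> trace_class_cone" and cy: "scaled_proj (4 ^ k) {y} \<in> trace_class_cone" for k
    using scaled_proj_cone(1)[OF Sx] scaled_proj_cone(1)[OF Sy] by auto
  let ?Q = "\<lambda>n. T (R (scaled_proj (4 ^ n) {x}))"
  have 1: "ray_to ?Q {x}"
    by (rule ray_to_close[OF ray_to_refl[OF Sx] cx maps[OF R(1)[OF cx]] Sx
          divide_right_mono[OF R(2)[OF cx]] inverse_four_power_tendsto]) simp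
  have 2: "ray_to ?Q {z}"
  proof (rule ray_to_close[OF z(2) maps[OF cy] maps[OF R(1)[OF cx]] Sz])
    let ?d = "\<lambda>n. tdist (R (scaled_proj (4 ^ n) {x})) (scaled_proj (4 ^ n) {y})"
    show "tdist (?Q n) (T (scaled_proj (4 ^ n) {y})) / 4 ^ n \<le> ?d n / 4 ^ n + \<epsilon> / 4 ^ n" for n
      using almost_isometry[OF R(1)[OF cx] cy, of n n]
      by (simp add: add_divide_distrib[symmetric] divide_right_mono)
    show "(\<lambda>n. ?d n / 4 ^ n + \<epsilon> / 4 ^ n) \<longlonglongrightarrow> 0"
      using tendsto_add[OF y(2)[unfolded ray_to_def] inverse_four_power_tendsto] by simp
  qed
  show ?thesis
    by (rule ray_to_singleton_unique[OF 1 2 maps[OF R(1)[OF cx]] x z(1)])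
qed

end

section \<open>Wigner's theorem\<close>

text \<open>The unitary case is \<open>\<sigma> = id\<close>, the antiunitary case \<open>\<sigma> = cnj\<close>.\<close>

definition semiunitary :: "(complex \<Rightarrow> complex) \<Rightarrow> ('a::complex_inner \<Rightarrow> 'a) \<Rightarrow> bool" where
  "semiunitary \<sigma> U \<longleftrightarrow> (\<sigma> = id \<or> \<sigma> = cnj) \<and>
     (\<forall>x y. U (x + y) = U x + U y) \<and> (\<forall>c x. U (c *\<^sub>C x) = \<sigma> c *\<^sub>C U x) \<and>
     surj U \<and> (\<forall>x y. cinner (U x) (U y) = \<sigma> (cinner x y))"

lemma semiunitary_iff: "(\<exists>\<sigma>. semiunitary \<sigma> U) \<longleftrightarrow> unitary U \<or> antiunitary U"
  by (auto simp: semiunitary_def unitary_def antiunitary_def)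

text \<open>The equality case of the Cauchy--Schwarz inequality.\<close>

lemma parallel_of_norm_cinner:
  fixes u v :: "'a::complex_inner"
  assumes "norm v = norm u" "cmod (cinner u v) = (norm u)\<^sup>2"
  obtains c where "cmod c = 1" "v = c *\<^sub>C u"
proof (cases "u = 0")
  case True
  then show thesis using that[of 1] assms(1) by simp
next
  case False
  define r where "r = norm u"
  have r: "r > 0" using False by (simp add: r_def)
  let ?u = "(1 / r) *\<^sub>R u" and ?v = "(1 / r) *\<^sub>R v"
  define c where "c = cinner ?u ?v"
  have n: "norm ?u = 1" "norm ?v = 1" using r assms(1) by (auto simp: r_def)
  have c: "cmod c = 1"
    using assms(2) r by (simp add: c_def cinner_simps norm_mult norm_divide r_def[symmetric] power2_eq_square)
  have "(norm (?v - coord_sum {?u} ?v))\<^sup>2 = 0"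
    using norm_sub_coord_sum[of "{?u}" ?v] n(1) c
    unfolding n(2) by (simp only: orthonormal_singleton c_def) simp
  then have "?v = c *\<^sub>C ?u"
    by (simp add: coord_sum_def c_def)
  then have "r *\<^sub>R ?v = c *\<^sub>C (r *\<^sub>R ?u)"
    by (metis scaleR_scaleC_commute)
  then show thesis using that[OF c] r by simp
qed

text \<open>Fix a unit vector \<open>e\<close>. On the orthogonal complement of \<open>e\<close> the phase of the image of \<open>e + x\<close> can be normalized
  by requiring inner product \<open>1\<close> with the image of \<open>e\<close>. The resulting map \<open>V\<close> satisfies
  \<open>\<bar>\<langle>Vx, Vy\<rangle>\<bar> = \<bar>\<langle>x, y\<rangle>\<bar>\<close> and \<open>\<bar>1 + \<langle>Vx, Vy\<rangle>\<bar> = \<bar>1 + \<langle>x, y\<rangle>\<bar>\<close>, hence preserves real inner products and is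
  real linear. Moreover \<open>V(ix) = \<plusminus> iVx\<close> for each \<open>x\<close>, with a common sign because a group is not a union of two
  proper subgroups.\<close>

theorem wigner:
  fixes \<phi> :: "'a::complex_inner \<Rightarrow> 'a"
  assumes nonzero: "\<exists>x::'a. x \<noteq> 0"
    and unit: "\<And>x. norm x = 1 \<Longrightarrow> norm (\<phi> x) = 1"
    and pres: "\<And>x y. norm x = 1 \<Longrightarrow> norm y = 1 \<Longrightarrow> cmod (cinner (\<phi> x) (\<phi> y)) = cmod (cinner x y)"
    and onto: "\<And>y. norm y = 1 \<Longrightarrow> \<exists>x. norm x = 1 \<and> cmod (cinner y (\<phi> x)) = 1"
  obtains \<sigma> U where "semiunitary \<sigma> U" "\<And>x. norm x = 1 \<Longrightarrow> \<exists>c. cmod c = 1 \<and> U x = c *\<^sub>C \<phi> x"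
proof -
  \<comment> \<open>the homogeneous extension of \<open>\<phi>\<close>, so that vectors need not be normalized\<close>
  define f where "f x = norm x *\<^sub>R \<phi> ((1 / norm x) *\<^sub>R x)" for x
  have nf: "norm (f x) = norm x" for x
    using unit[of "(1 / norm x) *\<^sub>R x"] by (cases "x = 0") (auto simp: f_def)
  have pf: "cmod (cinner (f x) (f y)) = cmod (cinner x y)" for x y
  proof (cases "x = 0 \<or> y = 0")
    case True
    then show ?thesis by (auto simp: f_def)
  next
    case False
    then show ?thesis
      using pres[of "(1 / norm x) *\<^sub>R x" "(1 / norm y) *\<^sub>R y"]
      by (simp add: f_def cinner_simps norm_mult norm_divide field_simps)
  qed
  have f1: "f x = \<phi> x" if "norm x = 1" for x
    using that by (simp add: f_def)
  obtain z :: 'a where "z \<noteq> 0" using nonzero by blast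
  define e where "e = (1 / norm z) *\<^sub>R z"
  have e: "norm e = 1" using \<open>z \<noteq> 0\<close> by (simp add: e_def)
  define e' where "e' = f e"
  have e': "norm e' = 1" using nf e by (simp add: e'_def)
  have ee: "cinner e e = 1" "cinner e' e' = 1" using e e' by (auto simp: cinner_self)
  define M where "M = {x. cinner e x = 0}"
  have M0: "cinner e x = 0" "cinner x e = 0" if "x \<in> M" for x
    using that cinner_commute[of x e] by (auto simp: M_def)
  have Madd: "x + y \<in> M" if "x \<in> M" "y \<in> M" for x y using that by (simp add: M_def cinner_simps)
  have Mc: "c *\<^sub>C x \<in> M" if "x \<in> M" for c x using that by (simp add: M_def cinner_simps)
  have Mr: "r *\<^sub>R x \<in> M" if "x \<in> M" for r x using that by (simp add: M_def cinner_simps)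
  \<comment> \<open>the phase that makes the inner product of the image of \<open>e + x\<close> with \<open>e'\<close> equal to \<open>1\<close>\<close>
  define k where "k x = cnj (cinner e' (f (e + x)))" for x
  define V where "V x = k x *\<^sub>C f (e + x) - e'" for x
  have k: "cmod (k x) = 1" if "x \<in> M" for x
    using pf[of e "e + x"] M0[OF that] by (simp add: k_def e'_def cinner_simps ee)
  have Vf: "e' + V x = k x *\<^sub>C f (e + x)" for x by (simp add: V_def)
  have e'V: "cinner e' (V x) = 0" "cinner (V x) e' = 0" if "x \<in> M" for x
  proof -
    have "cinner e' (k x *\<^sub>C f (e + x)) = complex_of_real ((cmod (k x))\<^sup>2)"
      unfolding complex_norm_square by (simp add: cinner_scaleC_right k_def mult.commute)
    then show "cinner e' (V x) = 0"
      using k[OF that] by (simp add: V_def cinner_simps ee)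
    then show "cinner (V x) e' = 0" using cinner_commute[of "V x" e'] by simp
  qed
  have nV: "norm (V x) = norm x" if x: "x \<in> M" for x
  proof -
    have "(norm (e' + V x))\<^sup>2 = (norm (e + x))\<^sup>2"
      unfolding Vf by (simp add: norm_scaleC k[OF x] nf)
    then have "(norm (V x))\<^sup>2 = (norm x)\<^sup>2"
      by (simp add: norm_add_sq e e' M0[OF x] e'V[OF x])
    then show ?thesis by simp
  qed
  have fV: "cmod (cinner (f x) (V x)) = (norm x)\<^sup>2" if x: "x \<in> M" for x
  proof -
    have "cmod (cinner (f x) e') = 0"
      using pf[of x e] M0[OF x] by (simp add: e'_def)
    then have "cmod (cinner (f x) (V x)) = cmod (cinner (f x) (e' + V x))"
      by (simp add: cinner_add_right)
    also have "\<dots> = cmod (cinner x (e + x))"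
      unfolding Vf by (simp add: cinner_scaleC_right norm_mult k[OF x] pf)
    also have "\<dots> = (norm x)\<^sup>2"
      by (simp add: cinner_add_right M0[OF x] cinner_self norm_power)
    finally show ?thesis .
  qed
  have modV: "cmod (cinner (V x) (V y)) = cmod (cinner x y)" if x: "x \<in> M" and y: "y \<in> M" for x y
  proof -
    obtain a where a: "cmod a = 1" "V x = a *\<^sub>C f x"
      using parallel_of_norm_cinner[of "V x" "f x"] fV[OF x] nV[OF x] nf by metis
    obtain b where b: "cmod b = 1" "V y = b *\<^sub>C f y"
      using parallel_of_norm_cinner[of "V y" "f y"] fV[OF y] nV[OF y] nf by metis
    show ?thesis by (simp add: a b cinner_simps norm_mult pf)
  qed
  have ReV: "Re (cinner (V x) (V y)) = Re (cinner x y)" if x: "x \<in> M" and y: "y \<in> M" for x y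
  proof -
    have "cmod (1 + cinner (V x) (V y)) = cmod (cinner (e' + V x) (e' + V y))"
      by (simp add: cinner_simps ee e'V[OF x] e'V[OF y])
    also have "\<dots> = cmod (cinner (e + x) (e + y))"
      unfolding Vf by (simp add: cinner_simps norm_mult k[OF x] k[OF y] pf del: cinner_add_left cinner_add_right)
    also have "\<dots> = cmod (1 + cinner x y)"
      by (simp add: cinner_simps ee M0[OF x] M0[OF y])
    finally have "(cmod (1 + cinner (V x) (V y)))\<^sup>2 = (cmod (1 + cinner x y))\<^sup>2" by simp
    moreover have "(cmod (1 + w))\<^sup>2 = 1 + 2 * Re w + (cmod w)\<^sup>2" for w
      unfolding cmod_power2 by (simp add: power2_eq_square algebra_simps)
    ultimately show ?thesis using modV[OF x y] by simp
  qed
  have innV: "inner (V x) (V y) = inner x y" if "x \<in> M" "y \<in> M" for x y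
    using ReV[OF that] by (simp add: inner_eq_Re_cinner)
  have Vadd: "V (x + y) = V x + V y" if x: "x \<in> M" and y: "y \<in> M" for x y
  proof -
    note xy = Madd[OF x y]
    have "inner (V (x + y) - V x - V y) (V (x + y) - V x - V y) = 0"
      by (simp add: inner_diff_left inner_diff_right innV x y xy inner_add_left inner_add_right)
    then have "V (x + y) - V x - V y = 0"
      by (simp only: inner_eq_zero_iff)
    then show ?thesis by (simp add: diff_diff_eq)
  qed
  have Vscale: "V (r *\<^sub>R x) = r *\<^sub>R V x" if x: "x \<in> M" for r x
  proof -
    have "inner (V (r *\<^sub>R x) - r *\<^sub>R V x) (V (r *\<^sub>R x) - r *\<^sub>R V x) = 0"
      by (simp add: inner_diff_left inner_diff_right innV x Mr[OF x])
    then show ?thesis by simp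
  qed
  have Vi: "V (\<i> *\<^sub>C x) = \<i> *\<^sub>C V x \<or> V (\<i> *\<^sub>C x) = (- \<i>) *\<^sub>C V x" if x: "x \<in> M" for x
  proof -
    note ix = Mc[OF x, of \<i>]
    let ?z = "cinner (V x) (V (\<i> *\<^sub>C x))"
    have Re: "Re ?z = 0"
      using ReV[OF x ix] by (simp add: cinner_simps cinner_self)
    have "cmod ?z = (norm x)\<^sup>2"
      using modV[OF x ix] by (simp add: cinner_simps cinner_self norm_mult norm_power)
    then have "\<bar>Im ?z\<bar> = (norm x)\<^sup>2"
      using Re by (simp add: cmod_def)
    then have cases: "Im ?z = (norm x)\<^sup>2 \<or> Im ?z = - (norm x)\<^sup>2" by linarith
    have dist: "(norm (V (\<i> *\<^sub>C x) - c *\<^sub>C V x))\<^sup>2 = 2 * (norm x)\<^sup>2 - 2 * Re (c * cnj ?z)"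
      if "cmod c = 1" for c
    proof -
      have "cinner (V (\<i> *\<^sub>C x)) (c *\<^sub>C V x) = c * cnj ?z"
        using cinner_commute[of "V (\<i> *\<^sub>C x)" "V x"] by (simp add: cinner_scaleC_right)
      then show ?thesis
        by (simp add: norm_diff_sq nV[OF x] nV[OF ix] norm_scaleC that del: times_complex.sel)
    qed
    from cases show ?thesis
    proof
      assume "Im ?z = (norm x)\<^sup>2"
      then have "(norm (V (\<i> *\<^sub>C x) - \<i> *\<^sub>C V x))\<^sup>2 = 0"
        using dist[of \<i>] by simp
      then show ?thesis by simp
    next
      assume "Im ?z = - (norm x)\<^sup>2"
      then have "(norm (V (\<i> *\<^sub>C x) - (- \<i>) *\<^sub>C V x))\<^sup>2 = 0"
        using dist[of "- \<i>"] by simp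
      then have "V (\<i> *\<^sub>C x) = (- \<i>) *\<^sub>C V x"
        by (simp only: power_eq_0_iff norm_eq_zero right_minus_eq)
      then show ?thesis ..
    qed
  qed
  have sign: "(\<forall>x\<in>M. V (\<i> *\<^sub>C x) = \<i> *\<^sub>C V x) \<or> (\<forall>x\<in>M. V (\<i> *\<^sub>C x) = (- \<i>) *\<^sub>C V x)"
  proof (rule ccontr)
    assume "\<not> ?thesis"
    then obtain x y where x: "x \<in> M" "V (\<i> *\<^sub>C x) \<noteq> \<i> *\<^sub>C V x"
      and y: "y \<in> M" "V (\<i> *\<^sub>C y) \<noteq> (- \<i>) *\<^sub>C V y" by blast
    have "V (\<i> *\<^sub>C (x + y)) = V (\<i> *\<^sub>C x) + V (\<i> *\<^sub>C y)"
      by (simp add: scaleC_add_right Vadd Mc x y)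
    moreover have "V (x + y) = V x + V y" by (simp add: Vadd x y)
    ultimately show False
      using Vi[OF x(1)] Vi[OF y(1)] Vi[OF Madd[OF x(1) y(1)]] x(2) y(2)
      by (auto simp: scaleC_add_right)
  qed
  define \<sigma> :: "complex \<Rightarrow> complex" where "\<sigma> = (if \<forall>x\<in>M. V (\<i> *\<^sub>C x) = \<i> *\<^sub>C V x then id else cnj)"
  have \<sigma>: "\<sigma> = id \<or> \<sigma> = cnj" by (simp add: \<sigma>_def)
  have \<sigma>i: "V (\<i> *\<^sub>C x) = \<sigma> \<i> *\<^sub>C V x" if "x \<in> M" for x
    using sign that by (auto simp: \<sigma>_def)
  have \<sigma>s: "\<sigma> (a + b) = \<sigma> a + \<sigma> b" "\<sigma> (a * b) = \<sigma> a * \<sigma> b" "\<sigma> (cnj a) = cnj (\<sigma> a)" "\<sigma> (\<sigma> a) = a"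
    "cmod (\<sigma> a) = cmod a" "\<sigma> (complex_of_real r) = complex_of_real r" "\<sigma> 1 = 1" "\<sigma> 0 = 0" "Re (\<sigma> a) = Re a" for a b r
    using \<sigma> by auto
  have Vc: "V (c *\<^sub>C x) = \<sigma> c *\<^sub>C V x" if x: "x \<in> M" for c x
  proof -
    have c: "c = complex_of_real (Re c) + complex_of_real (Im c) * \<i>"
      by (simp add: complex_eq_iff)
    have "c *\<^sub>C x = Re c *\<^sub>R x + Im c *\<^sub>R (\<i> *\<^sub>C x)"
      by (subst c) (simp only: scaleC_add_left scaleR_scaleC scaleC_scaleC)
    then have "V (c *\<^sub>C x) = Re c *\<^sub>R V x + Im c *\<^sub>R (\<sigma> \<i> *\<^sub>C V x)"
      by (simp add: Vadd Mr Mc x Vscale \<sigma>i)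
    also have "\<dots> = \<sigma> (complex_of_real (Re c) + complex_of_real (Im c) * \<i>) *\<^sub>C V x"
      by (simp only: \<sigma>s scaleC_add_left scaleR_scaleC scaleC_scaleC)
    finally show ?thesis using c by simp
  qed
  have Vin: "cinner (V x) (V y) = \<sigma> (cinner x y)" if x: "x \<in> M" and y: "y \<in> M" for x y
  proof -
    have "Re (cinner (V x) (V (\<i> *\<^sub>C y))) = Re (cinner x (\<i> *\<^sub>C y))"
      by (rule ReV[OF x Mc[OF y]])
    then have "Re (\<sigma> \<i> * cinner (V x) (V y)) = Re (\<i> * cinner x y)"
      by (simp only: Vc[OF y] cinner_scaleC_right)
    then show ?thesis
      using ReV[OF x y] \<sigma> by (auto simp: complex_eq_iff)
  qed
  define U where "U v = \<sigma> (cinner e v) *\<^sub>C e' + V (v - cinner e v *\<^sub>C e)" for v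
  have Mv: "v - cinner e v *\<^sub>C e \<in> M" for v
    by (simp add: M_def cinner_simps ee)
  have Uadd: "U (v + w) = U v + U w" for v w
  proof -
    have "v + w - cinner e (v + w) *\<^sub>C e = (v - cinner e v *\<^sub>C e) + (w - cinner e w *\<^sub>C e)"
      by (simp add: cinner_add_right scaleC_add_left)
    then show ?thesis
      by (simp only: U_def Vadd[OF Mv Mv]) (simp add: cinner_add_right \<sigma>s scaleC_add_left)
  qed
  have Uc: "U (c *\<^sub>C v) = \<sigma> c *\<^sub>C U v" for c v
  proof -
    have "c *\<^sub>C v - cinner e (c *\<^sub>C v) *\<^sub>C e = c *\<^sub>C (v - cinner e v *\<^sub>C e)"
      by (simp add: cinner_scaleC_right cvec.scale_right_diff_distrib scaleC_scaleC)
    then show ?thesis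
      by (simp only: U_def Vc[OF Mv]) (simp add: cinner_scaleC_right \<sigma>s scaleC_add_right scaleC_scaleC)
  qed
  have Uin: "cinner (U v) (U w) = \<sigma> (cinner v w)" for v w
  proof -
    let ?x = "v - cinner e v *\<^sub>C e" and ?y = "w - cinner e w *\<^sub>C e"
    have "cinner (U v) (U w) = cnj (\<sigma> (cinner e v)) * \<sigma> (cinner e w) + \<sigma> (cinner ?x ?y)"
      by (simp only: U_def cinner_add_left cinner_add_right cinner_scaleC_left cinner_scaleC_right
          e'V[OF Mv] ee Vin[OF Mv Mv]) simp
    also have "\<dots> = \<sigma> (cnj (cinner e v) * cinner e w + cinner ?x ?y)"
      by (simp only: \<sigma>s)
    also have "cnj (cinner e v) * cinner e w + cinner ?x ?y = cinner v w"
      using cinner_commute[of v e] by (simp add: cinner_simps ee)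
    finally show ?thesis .
  qed
  have nU: "norm (U v) = norm v" for v
  proof -
    have "complex_of_real ((norm (U v))\<^sup>2) = complex_of_real ((norm v)\<^sup>2)"
      using Uin[of v v] unfolding cinner_self \<sigma>s(6) .
    then have "(norm (U v))\<^sup>2 = (norm v)\<^sup>2" using of_real_eq_iff by blast
    then show ?thesis by simp
  qed
  have Uf: "cmod (cinner (f v) (U v)) = (norm v)\<^sup>2" for v
  proof (cases "cinner e v = 0")
    case True
    then have "U v = V v" "v \<in> M" by (auto simp: U_def \<sigma>s M_def)
    then show ?thesis using fV by simp
  next
    case False
    define a where "a = cinner e v"
    define x where "x = (1 / a) *\<^sub>C (v - a *\<^sub>C e)"
    have a: "a \<noteq> 0" using False by (simp add: a_def)
    have xM: "x \<in> M" unfolding x_def a_def by (rule Mc[OF Mv])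
    have v: "v = a *\<^sub>C (e + x)"
      using a by (simp add: x_def scaleC_add_right scaleC_scaleC)
    have "U (e + x) = e' + V x"
      using M0[OF xM] by (simp add: U_def cinner_add_right ee \<sigma>s)
    then have "U v = \<sigma> a *\<^sub>C (k x *\<^sub>C f (e + x))"
      unfolding Vf[symmetric] by (metis v Uc)
    then have "cmod (cinner (f v) (U v)) = cmod a * cmod (cinner v (e + x))"
      by (simp add: cinner_scaleC_right norm_mult k[OF xM] \<sigma>s pf)
    also have "\<dots> = cmod (cinner v (a *\<^sub>C (e + x)))"
      by (simp add: cinner_scaleC_right norm_mult)
    also have "\<dots> = (norm v)\<^sup>2"
      unfolding v[symmetric] by (simp add: cinner_self norm_power)
    finally show ?thesis .
  qed
  have U\<phi>: "\<exists>c. cmod c = 1 \<and> U x = c *\<^sub>C \<phi> x" if x: "norm x = 1" for x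
    using parallel_of_norm_cinner[of "U x" "\<phi> x"] Uf[of x] nU[of x] unit[OF x] x f1[OF x] by (metis power_one)
  have "surj U"
    unfolding surj_def
  proof
    fix y :: 'a
    show "\<exists>x. y = U x"
    proof (cases "y = 0")
      case True
      then show ?thesis using nU[of 0] by (intro exI[of _ 0]) simp
    next
      case False
      let ?y = "(1 / norm y) *\<^sub>R y"
      have ny: "norm ?y = 1" using False by simp
      obtain x where x: "norm x = 1" "cmod (cinner ?y (\<phi> x)) = 1" using onto[OF ny] by blast
      obtain c where c: "cmod c = 1" "U x = c *\<^sub>C \<phi> x" using U\<phi>[OF x(1)] by blast
      have "cmod (cinner (U x) ?y) = 1"
        using x(2) c(1) cmod_cinner_commute[of "U x" ?y]
        by (simp only: c(2) cinner_scaleC_right norm_mult)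
      then obtain d where d: "?y = d *\<^sub>C U x"
        using parallel_of_norm_cinner[of ?y "U x"] ny nU[of x] x(1) by (metis power_one)
      have "y = norm y *\<^sub>R ?y" using False by simp
      also have "\<dots> = complex_of_real (norm y) *\<^sub>C (d *\<^sub>C U x)"
        unfolding d by (rule scaleR_scaleC)
      also have "\<dots> = U (\<sigma> (complex_of_real (norm y) * d) *\<^sub>C x)"
        by (simp only: Uc \<sigma>s scaleC_scaleC)
      finally show ?thesis by blast
    qed
  qed
  then have "semiunitary \<sigma> U"
    using \<sigma> Uadd Uc Uin by (simp add: semiunitary_def)
  then show thesis using that U\<phi> by blast
qed

section \<open>Conjugation by unitary and antiunitary operators\<close>

lemma semiunitary_properties:
  assumes "semiunitary \<sigma> (U :: 'a::complex_inner \<Rightarrow> 'a)"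
  shows "U (x + y) = U x + U y" "U (c *\<^sub>C x) = \<sigma> c *\<^sub>C U x" "cinner (U x) (U y) = \<sigma> (cinner x y)"
    "norm (U x) = norm x" "bij U" "\<sigma> (\<sigma> c) = c" "cmod (\<sigma> c) = cmod c" "Re (\<sigma> c) = Re c"
    "\<sigma> c = 0 \<longleftrightarrow> c = 0"
proof -
  show 1: "U (x + y) = U x + U y" "U (c *\<^sub>C x) = \<sigma> c *\<^sub>C U x" "cinner (U x) (U y) = \<sigma> (cinner x y)" for c x y
    using assms by (auto simp: semiunitary_def)
  have \<sigma>: "\<sigma> = id \<or> \<sigma> = cnj" using assms by (simp add: semiunitary_def)
  then show "\<sigma> (\<sigma> c) = c" "cmod (\<sigma> c) = cmod c" "Re (\<sigma> c) = Re c" "\<sigma> c = 0 \<longleftrightarrow> c = 0" for c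
    by auto
  have n: "norm (U x) = norm x" for x
  proof -
    have "complex_of_real ((norm (U x))\<^sup>2) = complex_of_real ((norm x)\<^sup>2)"
      using 1(3)[of x x] \<sigma> unfolding cinner_self by auto
    then have "(norm (U x))\<^sup>2 = (norm x)\<^sup>2" using of_real_eq_iff by blast
    then show ?thesis by simp
  qed
  show "norm (U x) = norm x" by (rule n)
  have "inj U"
  proof (rule injI)
    fix x y assume eq: "U x = U y"
    have "U (x + (- 1) *\<^sub>C y) = U x + \<sigma> (- 1) *\<^sub>C U y" by (simp only: 1)
    also have "\<dots> = 0" using \<sigma> eq by auto
    finally have "norm (x + (- 1) *\<^sub>C y) = 0" using n by (metis norm_zero)
    then show "x = y" by simp
  qed
  then show "bij U" using assms by (simp add: semiunitary_def bij_def)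
qed

lemma semiunitary_orthonormal_image:
  assumes U: "semiunitary \<sigma> (U :: 'a::complex_inner \<Rightarrow> 'a)" and S: "orthonormal S"
  shows "orthonormal (U ` S)"
  using S by (auto simp: orthonormal_def semiunitary_properties[OF U])

lemma semiunitary_orthonormal_preimage:
  assumes U: "semiunitary \<sigma> (U :: 'a::complex_inner \<Rightarrow> 'a)" and S: "orthonormal (U ` S)"
  shows "orthonormal S"
proof -
  have inj: "inj U" using semiunitary_properties(5)[OF U] by (rule bij_is_inj)
  show ?thesis
    using S unfolding orthonormal_def
    by (auto simp: semiunitary_properties[OF U] inj_eq[OF inj])
qed

lemma semiunitary_onb_image:
  assumes U: "semiunitary \<sigma> (U :: 'a::chilbert_space \<Rightarrow> 'a)" and E: "is_onb E"
  shows "is_onb (U ` E)"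
proof (rule onb_if_trivial_complement)
  show "orthonormal (U ` E)"
    by (rule semiunitary_orthonormal_image[OF U is_onb_orthonormal[OF E]])
  fix x assume x: "\<And>f. f \<in> U ` E \<Longrightarrow> cinner f x = 0"
  obtain y where y: "x = U y" using semiunitary_properties(5)[OF U] by (metis bij_is_surj surjD)
  have "y = 0"
  proof (rule onb_eqI[OF E])
    fix e assume "e \<in> E"
    then have "cinner (U e) (U y) = 0" using x by (simp add: y)
    then show "cinner e y = cinner e 0"
      by (simp add: semiunitary_properties(3,9)[OF U])
  qed
  then show "x = 0" using semiunitary_properties(4)[OF U, of y] by (simp add: y)
qed

lemma conjugate_cone:
  assumes U: "semiunitary \<sigma> (U :: 'a::chilbert_space \<Rightarrow> 'a)" and A: "A \<in> trace_class_cone"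
  shows "(\<lambda>x. U (A (inv U x))) \<in> trace_class_cone"
    "rtrace (\<lambda>x. U (A (inv U x))) = rtrace A"
    "\<And>x. qform (\<lambda>x. U (A (inv U x))) (U x) = qform A x"
proof -
  note U' = semiunitary_properties[OF U]
  note pA = cone_positive[OF A]
  note bA = positive_op_bounded_clinear[OF pA]
  let ?B = "\<lambda>x. U (A (inv U x))"
  have inv: "inv U (U x) = x" "U (inv U x) = x" for x
    using U'(5) by (simp_all add: bij_is_inj bij_is_surj surj_f_inv_f)
  have iadd: "inv U (x + y) = inv U x + inv U y" for x y
    by (metis U'(1) inv)
  have ic: "inv U (c *\<^sub>C x) = \<sigma> c *\<^sub>C inv U x" for c x
    by (metis U'(2) U'(6) inv)
  have inorm: "norm (inv U x) = norm x" for x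
    by (metis U'(4) inv(2))
  show q: "qform ?B (U x) = qform A x" for x
    by (simp add: qform_def inv U')
  obtain K where K: "\<And>x. norm (A x) \<le> K * norm x"
    using bounded_clinear_bound[OF bA] by metis
  have pos: "positive_op ?B"
  proof (rule positive_opI)
    show "bounded_clinear ?B"
    proof (rule bounded_clinearI[of _ K])
      show "norm (?B x) \<le> K * norm x" for x
        using K[of "inv U x"] by (simp add: U' inorm)
    qed (simp_all add: iadd ic U' bounded_clinear_add[OF bA] bounded_clinear_scaleC[OF bA])
    show "hermitian ?B"
      unfolding hermitian_def
    proof (intro allI)
      fix x y
      have "cinner (?B x) (U (inv U y)) = cinner (U (inv U x)) (?B y)"
        by (simp only: U'(3) hermitianD[OF positive_op_hermitian[OF pA]])
      then show "cinner (?B x) y = cinner x (?B y)" by (simp only: inv)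
    qed
    show "0 \<le> qform ?B x" for x
      using q[of "inv U x"] positive_op_nonneg[OF pA, of "inv U x"] by (simp add: inv)
  qed
  have "(qform ?B has_sum rtrace A) (U ` some_onb)"
    by (subst has_sum_reindex)
      (use U'(5) cone_has_sum_rtrace[OF A is_onb_some_onb] in \<open>auto simp: comp_def q bij_def intro: inj_on_subset\<close>)
  from coneI[OF pos semiunitary_onb_image[OF U is_onb_some_onb] this]
  show "?B \<in> trace_class_cone" "rtrace ?B = rtrace A" by blast+
qed

lemma coord_sum_phase:
  assumes "cmod c = 1" "norm u = 1"
  shows "coord_sum {c *\<^sub>C u} x = coord_sum {u} x"
proof -
  have "cnj c * c = 1"
    using complex_norm_square[of c] assms(1) by (simp add: mult.commute)
  then have "cnj c * cinner u x * c = cinner u x" by (simp add: mult.commute mult.left_commute)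
  then show ?thesis
    by (simp add: coord_sum_def cinner_scaleC_left scaleC_scaleC)
qed

section \<open>Stability of coarse isometries\<close>

context coarse_isometry begin

text \<open>Wigner's theorem applies to the rays: transition probabilities do not increase under \<open>T\<close> nor under its
  coarse inverse, and the two limiting maps invert each other up to phases.\<close>

lemma ray_limits_semiunitary:
  assumes nonzero: "\<exists>x::'a. x \<noteq> 0"
  obtains \<sigma> U where "semiunitary \<sigma> U"
    "\<And>x. norm x = 1 \<Longrightarrow> ray_to (\<lambda>n. T (scaled_proj (4 ^ n) {x})) {U x}"
proof -
  obtain R where R: "coarse_isometry R (\<epsilon> + 2 * \<delta>) (\<epsilon> + \<delta>)"
    "\<And>B. B \<in> trace_class_cone \<Longrightarrow> tdist (T (R B)) B \<le> \<delta>"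
    "\<And>A. A \<in> trace_class_cone \<Longrightarrow> tdist (R (T A)) A \<le> \<epsilon> + \<delta>"
    using coarse_inverse by blast
  interpret R: coarse_isometry R "\<epsilon> + 2 * \<delta>" "\<epsilon> + \<delta>" by (rule R(1))
  have "\<exists>y. norm x = 1 \<longrightarrow> norm y = 1 \<and> ray_to (\<lambda>n. T (scaled_proj (4 ^ n) {x})) {y}" for x
    using rank_one_ray_limit[of x] by metis
  then obtain \<phi> where \<phi>: "\<And>x. norm x = 1 \<Longrightarrow> norm (\<phi> x) = 1"
    "\<And>x. norm x = 1 \<Longrightarrow> ray_to (\<lambda>n. T (scaled_proj (4 ^ n) {x})) {\<phi> x}" by metis
  have "\<exists>y. norm x = 1 \<longrightarrow> norm y = 1 \<and> ray_to (\<lambda>n. R (scaled_proj (4 ^ n) {x})) {y}" for x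
    using R.rank_one_ray_limit[of x] by metis
  then obtain \<psi> where \<psi>: "\<And>x. norm x = 1 \<Longrightarrow> norm (\<psi> x) = 1"
    "\<And>x. norm x = 1 \<Longrightarrow> ray_to (\<lambda>n. R (scaled_proj (4 ^ n) {x})) {\<psi> x}" by metis
  have \<phi>\<psi>: "cmod (cinner x (\<phi> (\<psi> x))) = 1" if x: "norm x = 1" for x
    by (rule round_trip_phase[OF R.maps R(2) x \<psi>(1)[OF x] \<psi>(2)[OF x] \<phi>(1)[OF \<psi>(1)[OF x]] \<phi>(2)[OF \<psi>(1)[OF x]]])
  have \<psi>\<phi>: "cmod (cinner x (\<psi> (\<phi> x))) = 1" if x: "norm x = 1" for x
    by (rule R.round_trip_phase[OF maps R(3) x \<phi>(1)[OF x] \<phi>(2)[OF x] \<psi>(1)[OF \<phi>(1)[OF x]] \<psi>(2)[OF \<phi>(1)[OF x]]])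
  have pres: "cmod (cinner (\<phi> x) (\<phi> y)) = cmod (cinner x y)" if x: "norm x = 1" and y: "norm y = 1" for x y
  proof (rule antisym)
    show "cmod (cinner (\<phi> x) (\<phi> y)) \<le> cmod (cinner x y)"
      by (rule transition_le[OF y \<phi>(1)[OF y] \<phi>(2)[OF y] x \<phi>(1)[OF x] \<phi>(2)[OF x]])
    note x' = \<phi>(1)[OF x] and y' = \<phi>(1)[OF y]
    obtain a b where ab: "cmod a = 1" "\<psi> (\<phi> x) = a *\<^sub>C x" "cmod b = 1" "\<psi> (\<phi> y) = b *\<^sub>C y"
      using parallel_of_norm_cinner[of "\<psi> (\<phi> x)" x] parallel_of_norm_cinner[of "\<psi> (\<phi> y)" y]
        \<psi>\<phi>[OF x] \<psi>\<phi>[OF y] \<psi>(1)[OF x'] \<psi>(1)[OF y'] x y by (metis power_one)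
    have "cmod (cinner (\<psi> (\<phi> x)) (\<psi> (\<phi> y))) \<le> cmod (cinner (\<phi> x) (\<phi> y))"
      by (rule R.transition_le[OF y' \<psi>(1)[OF y'] \<psi>(2)[OF y'] x' \<psi>(1)[OF x'] \<psi>(2)[OF x']])
    then show "cmod (cinner x y) \<le> cmod (cinner (\<phi> x) (\<phi> y))"
      by (simp add: ab cinner_simps norm_mult)
  qed
  have onto: "\<exists>x. norm x = 1 \<and> cmod (cinner y (\<phi> x)) = 1" if "norm y = 1" for y
    using \<phi>\<psi>[OF that] \<psi>(1)[OF that] by blast
  obtain \<sigma> U where U: "semiunitary \<sigma> U" "\<And>x. norm x = 1 \<Longrightarrow> \<exists>c. cmod c = 1 \<and> U x = c *\<^sub>C \<phi> x"
    using wigner[OF nonzero \<phi>(1) pres onto] by blast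
  have "ray_to (\<lambda>n. T (scaled_proj (4 ^ n) {x})) {U x}" if x: "norm x = 1" for x
  proof -
    obtain c where c: "cmod c = 1" "U x = c *\<^sub>C \<phi> x" using U(2)[OF x] by blast
    have "scaled_proj t {U x} = scaled_proj t {\<phi> x}" for t
      unfolding scaled_proj_def c(2) by (simp add: coord_sum_phase[OF c(1) \<phi>(1)[OF x]])
    then show ?thesis using \<phi>(2)[OF x] by (simp add: ray_to_def)
  qed
  then show thesis using that U(1) by blast
qed

text \<open>The behaviour on rank-one rays determines that on the ray of any finite-rank projection: almost-monotonicity
  bounds the image from below on each \<open>U s\<close>, and the one-dimensional trace comparison in all directions
  bounds it from above by \<open>4\<^sup>n + 3\<epsilon>/2\<close>.\<close>

lemma finite_rank_ray:
  assumes U: "semiunitary \<sigma> U"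
    and ray: "\<And>x. norm x = 1 \<Longrightarrow> ray_to (\<lambda>n. T (scaled_proj (4 ^ n) {x})) {U x}"
    and S: "orthonormal S" "finite S"
  shows "ray_to (\<lambda>n. T (scaled_proj (4 ^ n) S)) (U ` S)"
proof -
  note U' = semiunitary_properties[OF U]
  have inj: "inj_on U S" using U'(5) by (auto simp: bij_def intro: inj_on_subset)
  have oUS: "orthonormal (U ` S)" "finite (U ` S)"
    using semiunitary_orthonormal_image[OF U S(1)] S(2) by auto
  have card: "card (U ` S) = card S" by (rule card_image[OF inj])
  have cone: "scaled_proj (4 ^ k) S \<in> trace_class_cone" for k
    using scaled_proj_cone(1)[OF S] by simp
  define Q where "Q n = T (scaled_proj (4 ^ n) S)" for n :: nat
  have Q: "Q n \<in> trace_class_cone" for n unfolding Q_def by (rule maps[OF cone])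
  define M where "M n = 4 ^ n + 3 / 2 * \<epsilon>" for n :: nat
  have QM: "qform (Q n) y \<le> M n * (norm y)\<^sup>2" for n y
  proof (cases "y = 0")
    case False
    let ?y = "(1 / norm y) *\<^sub>R y"
    obtain x where x: "?y = U x" using U'(5) by (metis bij_is_surj surjD)
    have nx: "norm x = 1"
      using False U'(4)[of x] by (simp flip: x)
    have "qform (Q n) (U x) \<le> qform (scaled_proj (4 ^ n) S) x + 3 / 2 * \<epsilon>"
      unfolding Q_def by (rule qform_image_le[OF nx _ ray[OF nx] cone]) (simp add: U' nx)
    also have "qform (scaled_proj (4 ^ n) S) x \<le> 4 ^ n"
      using bessel[OF S, of x] by (simp add: qform_scaled_proj nx mult_left_le)
    finally have "qform (Q n) ?y \<le> M n" by (simp add: x M_def)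
    then show ?thesis
      using False unfolding qform_scaleR[OF positive_op_bounded_clinear[OF cone_positive[OF Q]]]
      by (simp add: field_simps)
  qed (simp add: qform_def)
  have limM: "(\<lambda>n. M n / 4 ^ n) \<longlonglongrightarrow> 1"
    using tendsto_add[OF tendsto_const[of 1] inverse_four_power_tendsto[of "3 / 2 * \<epsilon>"]]
    by (simp add: M_def add_divide_distrib)
  have limt: "(\<lambda>n. rtrace (Q n) / 4 ^ n) \<longlonglongrightarrow> card S"
  proof -
    have "\<bar>rtrace (Q n) / 4 ^ n - real (card S)\<bar> \<le> \<epsilon> / 4 ^ n" for n
      unfolding abs_quotient_diff Q_def
      using rtrace_image[OF cone, of n] scaled_proj_cone(2)[OF S, of "4 ^ n"]
      by (intro divide_right_mono) auto
    then have "(\<lambda>n. rtrace (Q n) / 4 ^ n - real (card S)) \<longlonglongrightarrow> 0"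
      by (intro Lim_null_comparison[OF _ inverse_four_power_tendsto[of \<epsilon>]]) simp
    then show ?thesis using LIM_zero_iff by blast
  qed
  have lims: "(\<lambda>n. qform (Q n) (U s) / 4 ^ n) \<longlonglongrightarrow> 1" if s: "s \<in> S" for s
  proof (rule tendsto_sandwich)
    have ns: "norm s = 1" "norm (U s) = 1" using orthonormal_norm[OF S(1) s] U' by auto
    have os: "orthonormal {s}" "finite {s}" "orthonormal {U s}" "finite {U s}" using ns by auto
    have cones: "scaled_proj (4 ^ k) {s} \<in> trace_class_cone" for k
      using scaled_proj_cone(1)[OF os(1,2)] by simp
    let ?R = "\<lambda>n. T (scaled_proj (4 ^ n) {s})"
    have "(\<lambda>n. qform (?R n) (U s) / 4 ^ n) \<longlonglongrightarrow> 1"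
      using ray_to_qform[OF ray[OF ns(1)] maps[OF cones] os(3,4) ns(2)] by (simp add: cinner_self ns)
    from tendsto_diff[OF this inverse_four_power_tendsto[of "3 / 2 * \<epsilon>"]]
    show "(\<lambda>n. qform (?R n) (U s) / 4 ^ n - 3 / 2 * \<epsilon> / 4 ^ n) \<longlonglongrightarrow> 1" by simp
    have "qform (?R n) (U s) / 4 ^ n - 3 / 2 * \<epsilon> / 4 ^ n \<le> qform (Q n) (U s) / 4 ^ n" for n
    proof -
      have "tdist (scaled_proj (4 ^ n) S) (scaled_proj (4 ^ n) {s})
          \<le> rtrace (scaled_proj (4 ^ n) S) - rtrace (scaled_proj (4 ^ n) {s}) + 2 * rtrace (\<lambda>x::'a. 0::'a)"
      proof (rule tdist_le_of_majorant[OF cone cones cone_zero(1)])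
        fix x
        have "(cmod (cinner s x))\<^sup>2 \<le> (\<Sum>s\<in>S. (cmod (cinner s x))\<^sup>2)"
          by (rule member_le_sum[OF s _ S(2)]) simp
        then show "qform (scaled_proj (4 ^ n) {s}) x \<le> qform (scaled_proj (4 ^ n) S) x + qform (\<lambda>x. 0) x"
          by (simp add: qform_scaled_proj qform_def[of "\<lambda>x. 0"])
      qed
      then have "tdist (scaled_proj (4 ^ n) {s}) (scaled_proj (4 ^ n) S)
          \<le> rtrace (scaled_proj (4 ^ n) S) - rtrace (scaled_proj (4 ^ n) {s})"
        using tdist_commute[OF cone cones, of n n] by (simp add: cone_zero(2))
      from almost_monotone[OF cones cone this os(3,4)]
      have "qform (?R n) (U s) - 3 / 2 * \<epsilon> \<le> qform (Q n) (U s)" by (simp add: Q_def)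
      then have "(qform (?R n) (U s) - 3 / 2 * \<epsilon>) / 4 ^ n \<le> qform (Q n) (U s) / 4 ^ n"
        by (rule divide_right_mono) simp
      then show ?thesis by (simp add: diff_divide_distrib)
    qed
    then show "\<forall>\<^sub>F n in sequentially. qform (?R n) (U s) / 4 ^ n - 3 / 2 * \<epsilon> / 4 ^ n \<le> qform (Q n) (U s) / 4 ^ n"
      by simp
    show "\<forall>\<^sub>F n in sequentially. qform (Q n) (U s) / 4 ^ n \<le> M n / 4 ^ n"
      using QM[of _ "U s"] ns(2) by (intro always_eventually allI divide_right_mono) auto
  qed (rule limM)
  have "ray_to Q (U ` S)"
  proof (rule ray_toI[OF Q oUS _ QM limM])
    show "0 \<le> M n" for n using eps_nonneg by (simp add: M_def)
    show "(\<lambda>n. rtrace (Q n) / 4 ^ n) \<longlonglongrightarrow> card (U ` S)" using limt by (simp add: card)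
    have "(\<lambda>n. \<Sum>s\<in>S. qform (Q n) (U s) / 4 ^ n) \<longlonglongrightarrow> (\<Sum>s\<in>S. 1)"
      by (intro tendsto_sum lims)
    then show "(\<lambda>n. sum (qform (Q n)) (U ` S) / 4 ^ n) \<longlonglongrightarrow> card (U ` S)"
      by (simp add: card sum.reindex[OF inj] sum_divide_distrib)
  qed
  then show ?thesis unfolding Q_def[abs_def] .
qed

text \<open>The trace comparisons along all finite-rank rays say that \<open>\<Sum>\<^sub>r \<langle>r, (T A - UAU\<^sup>*) r\<rangle>\<close> is at most
  \<open>Tr (T A - UAU\<^sup>*) / 2 + \<epsilon>\<close> for every finite orthonormal set. That is the bound \<open>2\<epsilon>\<close> on the trace norm.\<close>

theorem near_conjugation:
  assumes nonzero: "\<exists>x::'a. x \<noteq> 0"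
  obtains \<sigma> U where "semiunitary \<sigma> U"
    "\<And>A. A \<in> trace_class_cone \<Longrightarrow> tdist (T A) (\<lambda>x. U (A (inv U x))) \<le> 2 * \<epsilon>"
proof -
  obtain \<sigma> U where U: "semiunitary \<sigma> U"
    and ray: "\<And>x. norm x = 1 \<Longrightarrow> ray_to (\<lambda>n. T (scaled_proj (4 ^ n) {x})) {U x}"
    using ray_limits_semiunitary[OF nonzero] by blast
  note U' = semiunitary_properties[OF U]
  have "tdist (T A) (\<lambda>x. U (A (inv U x))) \<le> 2 * \<epsilon>" if A: "A \<in> trace_class_cone" for A
  proof (rule tdist_leI[OF maps[OF A] conjugate_cone(1)[OF U A]])
    fix R :: "'a set" assume R: "orthonormal R" "finite R"
    let ?B = "\<lambda>x. U (A (inv U x))"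
    define S where "S = inv U ` R"
    have US: "U ` S = R"
      unfolding S_def using U'(5) by (simp add: image_f_inv_f bij_is_surj)
    have inj: "inj_on U S" using U'(5) by (auto simp: bij_def intro: inj_on_subset)
    have S: "orthonormal S" "finite S"
      using semiunitary_orthonormal_preimage[OF U, of S] R unfolding US by (auto simp: S_def)
    have "2 * sum (qform (T A)) R - 2 * sum (qform A) S \<le> rtrace (T A) - rtrace A + 2 * \<epsilon>"
    proof (rule trace_comparison[OF S R _ _ A])
      show "card R = card S" using card_image[OF inj] by (simp add: US)
      show "ray_to (\<lambda>n. T (scaled_proj (4 ^ n) S)) R"
        using finite_rank_ray[OF U ray S] by (simp add: US)
    qed
    moreover have "sum (qform ?B) R = sum (qform A) S"
      unfolding US[symmetric] sum.reindex[OF inj] by (simp add: conjugate_cone(3)[OF U A])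
    ultimately show "2 * (\<Sum>s\<in>R. qform (T A) s - qform ?B s) - rtrace (T A) + rtrace ?B \<le> 2 * \<epsilon>"
      by (simp add: sum_subtractf conjugate_cone(2)[OF U A])
  qed
  then show thesis using that U by blast
qed

end

theorem corollary1p4:
  fixes T :: "('a::chilbert_space \<Rightarrow> 'a) \<Rightarrow> ('a \<Rightarrow> 'a)"
    and \<epsilon> \<delta> :: real
  assumes nonzero: "\<exists>x::'a. x \<noteq> 0"
    and "\<epsilon> \<ge> 0" and "\<delta> \<ge> 0"
    and maps: "\<And>A. A \<in> trace_class_cone \<Longrightarrow> T A \<in> trace_class_cone"
    and zero: "T (\<lambda>x. 0) = (\<lambda>x. 0)"
    and almost_isometry: "\<And>A B. A \<in> trace_class_cone \<Longrightarrow> B \<in> trace_class_cone \<Longrightarrow>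
          \<bar>trace_norm (\<lambda>x. T A x - T B x) - trace_norm (\<lambda>x. A x - B x)\<bar> \<le> \<epsilon>"
    and almost_surj: "\<And>B. B \<in> trace_class_cone \<Longrightarrow>
          \<exists>A\<in>trace_class_cone. trace_norm (\<lambda>x. T A x - B x) \<le> \<delta>"
  shows "\<exists>U::'a \<Rightarrow> 'a. (unitary U \<or> antiunitary U) \<and>
          (\<forall>A\<in>trace_class_cone. trace_norm (\<lambda>x. T A x - U (A (inv U x))) \<le> 3 * \<epsilon>)"
proof -
  interpret coarse_isometry T \<epsilon> \<delta>
    by unfold_locales (use assms in \<open>auto simp: tdist_def\<close>)
  obtain \<sigma> U where U: "semiunitary \<sigma> U"
    "\<And>A. A \<in> trace_class_cone \<Longrightarrow> tdist (T A) (\<lambda>x. U (A (inv U x))) \<le> 2 * \<epsilon>"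
    using near_conjugation[OF nonzero] by blast
  have "unitary U \<or> antiunitary U"
    using U(1) semiunitary_iff by blast
  moreover have "trace_norm (\<lambda>x. T A x - U (A (inv U x))) \<le> 3 * \<epsilon>" if "A \<in> trace_class_cone" for A
    using U(2)[OF that] eps_nonneg by (simp add: tdist_def)
  ultimately show ?thesis by blast
qed

end
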